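(* Let $\Lambda\cong\mathbb{Z}^d$ be a lattice with an endomorphism $F$ satisfying $\ker(F-1)=\ker(F-1)^2$, and let $\Lambda'\subseteq\Lambda$ be a full-rank $F$-stable sublattice. Write the characteristic polynomial of $F$ on $\Lambda$ as $\pm(t-1)^r p(t)$ with $p(1)>0$. Then $$\left|\left(\Lambda/\Lambda'\right)^{F}\right|=\left|\frac{\Lambda^F}{\Lambda'^F}\right|\cdot\frac{p(1)}{|\mathfrak{B}|\cdot|\mathcal{T}'|},$$ and for all integers $e\ge1$, $$\left|\left(\Lambda/e\Lambda'\right)^{F}\right|=\left|\left(\Lambda/\Lambda'\right)^{F}\right|\cdot|\mathfrak{B}[e]|\cdot e^r.$$ Moreover $\mathcal{T}'$ and $\mathfrak{B}$ are finite abelian groups and $|\mathcal{T}'|\cdot|\mathfrak{B}|$ divides $p(1)$. If $\Lambda'$ is the dual lattice of $\Lambda$ with respect to a non-degenerate $F$-invariant symmetric $\mathbb{Q}$-valued bilinear pairing on $\Lambda\otimes\mathbb{Q}$, then $\mathcal{T}\cong\mathcal{T}'$ and $\mathfrak{B}$ admits a perfect antisymmetric $\mathbb{Q}/\mathbb{Z}$-valued pairing; in particular the orders of $\mathfrak{B}$ and of $\mathfrak{B}[e]$ are each either a square or twice a square.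
   Context: $V=\Lambda\otimes_{\mathbb{Z}}\mathbb{Q}$ with $F$ extended linearly; $V^F$ is the $1$-eigenspace and $W=(F-1)V$ (the sum of generalised eigenspaces of $F$ for eigenvalues other than $1$), so $V=V^F\oplus W$. For a full-rank $F$-stable lattice $M\subseteq V$, the separation group is $\mathcal{T}(M)=M/\big((M\cap V^F)+(M\cap W)\big)$; write $\mathcal{T}=\mathcal{T}(\Lambda)$, $\mathcal{T}'=\mathcal{T}(\Lambda')$. Define $\mathfrak{B}=\mathfrak{B}_{\Lambda,\Lambda'}=\dfrac{\Lambda+\{v\in V: Fv-v\in\Lambda'\}}{\Lambda+V^F}$ (equivalently, the image in $V/\Lambda$ of $F$-invariant elements of $V/\Lambda'$, modulo the image of $V^F$). $M^F$ denotes $F$-fixed points and $\mathfrak{B}[e]$ the $e$-torsion. The dual lattice of $\Lambda$ is $\{v\in V:(v,\lambda)\in\mathbb{Z}\ \forall\lambda\in\Lambda\}$. *)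

theory Defs
  imports
    "HOL-Algebra.Coset"
    "HOL-Library.Set_Algebras"
    "Jordan_Normal_Form.Char_Poly"
begin

text \<open>
  The rational vector space \<open>V\<close> is the whole type \<open>'v\<close>, with scalar multiplication \<open>scale\<close>.
  A full-rank lattice in \<open>V\<close> is the integral span of a rational basis of \<open>V\<close>, so that
  \<open>V\<close> is the lattice tensored with the rationals. An endomorphism of the lattice is given by
  its linear extension to \<open>V\<close>. The sum \<open>A + B\<close> of two sets is the elementwise sum.
\<close>

definition lattice_basis ::
    "(rat \<Rightarrow> 'v::ab_group_add \<Rightarrow> 'v) \<Rightarrow> nat \<Rightarrow> (nat \<Rightarrow> 'v) \<Rightarrow> 'v set \<Rightarrow> bool" where
  "lattice_basis scale d b M \<longleftrightarrow>
     inj_on b {..<d} \<and>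
     \<not> Modules.module.dependent scale (b ` {..<d}) \<and>
     Modules.module.span scale (b ` {..<d}) = UNIV \<and>
     M = range (\<lambda>c :: nat \<Rightarrow> int. \<Sum>i<d. scale (of_int (c i)) (b i))"

definition full_rank_lattice ::
    "(rat \<Rightarrow> 'v::ab_group_add \<Rightarrow> 'v) \<Rightarrow> nat \<Rightarrow> 'v set \<Rightarrow> bool" where
  "full_rank_lattice scale d M \<longleftrightarrow> (\<exists>b. lattice_basis scale d b M)"

definition lattice_mat ::
    "(rat \<Rightarrow> 'v::ab_group_add \<Rightarrow> 'v) \<Rightarrow> nat \<Rightarrow> (nat \<Rightarrow> 'v) \<Rightarrow> ('v \<Rightarrow> 'v) \<Rightarrow> int mat" where
  "lattice_mat scale d b F =
     (THE A. A \<in> carrier_mat d d \<and>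
        (\<forall>j<d. F (b j) = (\<Sum>i<d. scale (of_int (A $$ (i, j))) (b i))))"

definition fixed_space :: "('v \<Rightarrow> 'v) \<Rightarrow> 'v set" where
  "fixed_space F = {v. F v = v}"

definition moved_space :: "('v::ab_group_add \<Rightarrow> 'v) \<Rightarrow> 'v set" where
  "moved_space F = range (\<lambda>v. F v - v)"

definition add_group :: "'v::ab_group_add set \<Rightarrow> 'v monoid" where
  "add_group M = \<lparr>carrier = M, monoid.mult = (+), one = 0\<rparr>"

definition separation_group :: "('v::ab_group_add \<Rightarrow> 'v) \<Rightarrow> 'v set \<Rightarrow> 'v set monoid" where
  "separation_group F M =
     add_group M Mod ((M \<inter> fixed_space F) + (M \<inter> moved_space F))"

definition B_group ::
    "('v::ab_group_add \<Rightarrow> 'v) \<Rightarrow> 'v set \<Rightarrow> 'v set \<Rightarrow> 'v set monoid" where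
  "B_group F L L' = add_group (L + {v. F v - v \<in> L'}) Mod (L + fixed_space F)"

text \<open>
  For an \<open>F\<close>-stable \<open>N\<close>, the map induced by \<open>F\<close> on cosets of \<open>N\<close> sends
  \<open>C = N + x\<close> to \<open>N + F x = N + F ` C\<close>.
\<close>

definition quotient_fixed :: "('v::ab_group_add \<Rightarrow> 'v) \<Rightarrow> 'v set \<Rightarrow> 'v set \<Rightarrow> 'v set set" where
  "quotient_fixed F M N = {C \<in> carrier (add_group M Mod N). N + F ` C = C}"

definition torsion :: "('a, 'b) monoid_scheme \<Rightarrow> nat \<Rightarrow> 'a set" where
  "torsion G e = {x \<in> carrier G. x [^]\<^bsub>G\<^esub> e = \<one>\<^bsub>G\<^esub>}"

definition nondegenerate_symmetric_form ::
    "(rat \<Rightarrow> 'v::ab_group_add \<Rightarrow> 'v) \<Rightarrow> ('v \<Rightarrow> 'v \<Rightarrow> rat) \<Rightarrow> bool" where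
  "nondegenerate_symmetric_form scale \<beta> \<longleftrightarrow>
     (\<forall>v. Vector_Spaces.linear scale (*) (\<beta> v)) \<and>
     (\<forall>w. Vector_Spaces.linear scale (*) (\<lambda>v. \<beta> v w)) \<and>
     (\<forall>v w. \<beta> v w = \<beta> w v) \<and>
     (\<forall>v. (\<forall>w. \<beta> v w = 0) \<longrightarrow> v = 0)"

definition dual_lattice :: "('v \<Rightarrow> 'v \<Rightarrow> rat) \<Rightarrow> 'v set \<Rightarrow> 'v set" where
  "dual_lattice \<beta> M = {v. \<forall>l\<in>M. \<beta> v l \<in> \<int>}"

definition rat_mod_int :: "rat set monoid" where
  "rat_mod_int = add_group UNIV Mod \<int>"

text \<open>
  Perfectness: both maps from \<open>G\<close> to the group of homomorphisms from \<open>G\<close> to the rationals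
  modulo the integers are bijective. Homomorphisms are represented by functions that are
  extensional on the carrier, since \<^const>\<open>hom\<close> does not constrain values outside it.
\<close>

definition perfect_pairing ::
    "('a, 'b) monoid_scheme \<Rightarrow> ('a \<Rightarrow> 'a \<Rightarrow> rat set) \<Rightarrow> bool" where
  "perfect_pairing G \<phi> \<longleftrightarrow>
     (\<forall>x\<in>carrier G. \<phi> x \<in> hom G rat_mod_int) \<and>
     (\<forall>y\<in>carrier G. (\<lambda>x. \<phi> x y) \<in> hom G rat_mod_int) \<and>
     bij_betw (\<lambda>x. restrict (\<phi> x) (carrier G))
       (carrier G) (hom G rat_mod_int \<inter> extensional (carrier G)) \<and>
     bij_betw (\<lambda>y. restrict (\<lambda>x. \<phi> x y) (carrier G))
       (carrier G) (hom G rat_mod_int \<inter> extensional (carrier G))"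

definition antisymmetric_pairing ::
    "('a, 'b) monoid_scheme \<Rightarrow> ('a \<Rightarrow> 'a \<Rightarrow> rat set) \<Rightarrow> bool" where
  "antisymmetric_pairing G \<phi> \<longleftrightarrow>
     (\<forall>x\<in>carrier G. \<forall>y\<in>carrier G. \<phi> x y = inv\<^bsub>rat_mod_int\<^esub> (\<phi> y x))"

definition square_or_twice_square :: "nat \<Rightarrow> bool" where
  "square_or_twice_square n \<longleftrightarrow> (\<exists>k. n = k\<^sup>2 \<or> n = 2 * k\<^sup>2)"

end

theory Submission
  imports Defs "HOL-Algebra.Multiplicative_Group" "HOL-Library.Function_Algebras"
begin

text \<open>
  Put \<open>N = F - 1\<close>, \<open>W = N V\<close>. Applying \<open>N\<close> identifies \<open>T'\<close> with \<open>N L' / N (L' \<inter> W)\<close>, the group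
  \<open>B\<close> with \<open>(L' \<inter> W) / (L' \<inter> N L)\<close>, and the fixed points of \<open>L / L'\<close> modulo the image of \<open>L\<^sup>F\<close> with
  \<open>(L' \<inter> N L) / N L'\<close>. These are the successive quotients of the chain
  \<open>N (L' \<inter> W) \<subseteq> N L' \<subseteq> L' \<inter> N L \<subseteq> L' \<inter> W\<close>, whose total index is the absolute value of the determinant
  of \<open>N\<close> on \<open>W\<close>, which is \<open>p(1)\<close>. The second formula follows by applying the first one to \<open>e L'\<close>,
  which replaces \<open>B\<close> by \<open>e B\<close>.

  If \<open>L'\<close> is dual to \<open>L\<close>, then \<open>(u, v) \<mapsto> \<beta> (P u) v\<close>, with \<open>P\<close> the projection onto \<open>V\<^sup>F\<close> along \<open>W\<close>,
  induces a perfect pairing of \<open>T\<close> with \<open>T'\<close>, and \<open>(v, w) \<mapsto> \<beta> v (N w)\<close> one of \<open>B\<close> with itself, where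
  \<open>v\<close> and \<open>w\<close> satisfy \<open>N v, N w \<in> L'\<close>. Finite groups in perfect duality are isomorphic.
\<close>

section \<open>Indices of additive subgroups\<close>

text \<open>All counting is done with subgroups of \<open>V\<close> and \<open>index\<close>, a
  cardinality that is \<open>0\<close> for an infinite quotient. Multiplicativity survives this
  convention, so \<open>p(1) > 0\<close> alone makes every factor of the chain finite. The obstacle
  is the determinant of \<open>N\<close> on \<open>W\<close>: \<open>N\<close> kills
  \<open>VF\<close>, and neither \<open>W\<close> nor \<open>L' \<inter> W\<close> comes with a
  basis. It is read off from \<open>P - N\<close>, which is injective on all of \<open>V\<close>, is
  the identity on \<open>VF\<close> and \<open>-N\<close> on \<open>W\<close>, and preserves
  \<open>(L' \<inter> VF) + (L' \<inter> W)\<close>. For an injective linear map preserving any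
  subgroup of finite index in \<open>L\<close>, the index of the image in that subgroup is the
  absolute determinant. The factor \<open>e^r\<close> is likewise the determinant of the map that
  multiplies by \<open>e\<close> on \<open>VF\<close> only. On the dual side, characters and
  pairings are kept as rational functions that are additive up to integers. The form on
  \<open>B\<close> satisfies
  \<open>\<beta> v (N w) + \<beta> w (N v) = - \<beta> (N v) (N w)\<close>, which is integral but
  need not vanish; so the form is antisymmetric without having to be alternating, and twice a square
  cannot be excluded.\<close>

lemma add_group_simps [simp]:
  "carrier (add_group A) = A" "x \<otimes>\<^bsub>add_group A\<^esub> y = x + y" "\<one>\<^bsub>add_group A\<^esub> = 0"
  by (simp_all add: add_group_def)

definition add_subgroup :: "'a::ab_group_add set \<Rightarrow> bool" where
  "add_subgroup A \<longleftrightarrow> 0 \<in> A \<and> (\<forall>x\<in>A. \<forall>y\<in>A. x - y \<in> A)"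

lemma add_subgroupI:
  "0 \<in> A \<Longrightarrow> (\<And>x y. x \<in> A \<Longrightarrow> y \<in> A \<Longrightarrow> x - y \<in> A) \<Longrightarrow> add_subgroup A"
  by (simp add: add_subgroup_def)

lemma add_subgroup_zero: "add_subgroup A \<Longrightarrow> 0 \<in> A"
  and add_subgroup_diff: "add_subgroup A \<Longrightarrow> x \<in> A \<Longrightarrow> y \<in> A \<Longrightarrow> x - y \<in> A"
  by (simp_all add: add_subgroup_def)

lemma add_subgroup_uminus: "add_subgroup A \<Longrightarrow> x \<in> A \<Longrightarrow> - x \<in> A"
  using add_subgroup_diff[of A 0 x] by (simp add: add_subgroup_zero)

lemma add_subgroup_add: "add_subgroup A \<Longrightarrow> x \<in> A \<Longrightarrow> y \<in> A \<Longrightarrow> x + y \<in> A"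
  using add_subgroup_diff[of A x "- y"] by (simp add: add_subgroup_uminus)

lemmas add_subgroup_closed =
  add_subgroup_zero add_subgroup_diff add_subgroup_uminus add_subgroup_add

lemma add_subgroup_cancel_right:
  "add_subgroup A \<Longrightarrow> y \<in> A \<Longrightarrow> x + y \<in> A \<longleftrightarrow> x \<in> A"
  by (metis add_diff_cancel_right' add_subgroup_add add_subgroup_diff)

lemma add_subgroup_cancel_diff:
  "add_subgroup A \<Longrightarrow> x - y \<in> A \<Longrightarrow> x \<in> A \<longleftrightarrow> y \<in> A"
  by (metis add.commute add_subgroup_cancel_right diff_add_cancel)

lemma add_subgroup_Int: "add_subgroup A \<Longrightarrow> add_subgroup B \<Longrightarrow> add_subgroup (A \<inter> B)"
  by (auto simp: add_subgroup_def)

lemma add_subgroup_UNIV: "add_subgroup UNIV"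
  by (auto simp: add_subgroup_def)

lemma add_subgroup_Ints: "add_subgroup (\<int> :: rat set)"
  by (auto simp: add_subgroup_def)

lemma add_subgroup_plus:
  assumes "add_subgroup A" "add_subgroup B" shows "add_subgroup (A + B)"
proof (rule add_subgroupI)
  show "0 \<in> A + B"
    using assms by (metis add_0 add_subgroup_zero set_plus_intro)
  fix x y assume "x \<in> A + B" "y \<in> A + B"
  then obtain a b a' b' where "a \<in> A" "b \<in> B" "a' \<in> A" "b' \<in> B" "x = a + b" "y = a' + b'"
    by (auto elim!: set_plus_elim)
  then show "x - y \<in> A + B"
    using set_plus_intro[of "a - a'" A "b - b'" B] assms by (simp add: add_subgroup_diff algebra_simps)
qed

lemma subset_plus_left: "add_subgroup B \<Longrightarrow> A \<subseteq> A + B"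
  by (metis add.right_neutral add_subgroup_zero set_plus_intro subsetI)

lemma subset_plus_right: "add_subgroup A \<Longrightarrow> B \<subseteq> A + B"
  by (metis add.left_neutral add_subgroup_zero set_plus_intro subsetI)

lemma plus_subset_add_subgroup:
  "add_subgroup C \<Longrightarrow> A \<subseteq> C \<Longrightarrow> B \<subseteq> C \<Longrightarrow> A + B \<subseteq> C"
  by (auto elim!: set_plus_elim intro: add_subgroup_add)

lemma comm_group_add_group:
  assumes "add_subgroup A" shows "comm_group (add_group A)"
proof (rule comm_groupI)
  show "\<exists>y\<in>carrier (add_group A). y \<otimes>\<^bsub>add_group A\<^esub> x = \<one>\<^bsub>add_group A\<^esub>"
    if "x \<in> carrier (add_group A)" for x
    using that assms by (auto intro!: bexI[of _ "- x"] add_subgroup_uminus)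
qed (use assms in \<open>auto simp: add_subgroup_closed algebra_simps\<close>)

lemma inv_add_group:
  assumes "add_subgroup A" "x \<in> A" shows "inv\<^bsub>add_group A\<^esub> x = - x"
proof -
  interpret comm_group "add_group A" by (rule comm_group_add_group[OF assms(1)])
  show ?thesis using assms by (intro inv_equality) (auto simp: add_subgroup_uminus)
qed

lemma subgroup_add_group:
  assumes "add_subgroup A" "add_subgroup B" "B \<subseteq> A" shows "subgroup B (add_group A)"
proof -
  interpret comm_group "add_group A" by (rule comm_group_add_group[OF assms(1)])
  show ?thesis
  proof (rule subgroupI)
    show "inv\<^bsub>add_group A\<^esub> a \<in> B" if "a \<in> B" for a
      using inv_add_group[OF assms(1), of a] that assms by (auto simp: add_subgroup_uminus)
  qed (use assms in \<open>auto simp: add_subgroup_add dest: add_subgroup_zero\<close>)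
qed

lemma normal_add_group:
  assumes "add_subgroup A" "add_subgroup B" "B \<subseteq> A" shows "B \<lhd> add_group A"
  using comm_group.normal_iff_subgroup[OF comm_group_add_group[OF assms(1)]]
    subgroup_add_group[OF assms] by blast

lemma comm_group_Mod:
  assumes "add_subgroup A" "add_subgroup B" "B \<subseteq> A" shows "comm_group (add_group A Mod B)"
  by (rule comm_group.abelian_FactGroup[OF comm_group_add_group subgroup_add_group]) (use assms in auto)

text \<open>Taken in the whole group, so that one set \<open>coset B a\<close> is an element of
  every quotient \<open>add_group A Mod B\<close> with \<open>a \<in> A\<close>.\<close>

abbreviation coset :: "'a::ab_group_add set \<Rightarrow> 'a \<Rightarrow> 'a set" where
  "coset B a \<equiv> B #>\<^bsub>add_group UNIV\<^esub> a"

lemma coset_altdef: "coset B a = {x. x - a \<in> B}"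
  by (force simp: r_coset_def)

lemma carrier_Mod: "carrier (add_group A Mod B) = coset B ` A"
  by (auto simp: FactGroup_def RCOSETS_def r_coset_def)

lemma coset_eq_iff:
  assumes "add_subgroup B" shows "coset B x = coset B y \<longleftrightarrow> x - y \<in> B"
proof
  assume "coset B x = coset B y"
  moreover have "x \<in> coset B x" using assms by (simp add: coset_altdef add_subgroup_zero)
  ultimately show "x - y \<in> B" by (simp add: coset_altdef)
next
  assume "x - y \<in> B"
  moreover have "u - y = (u - x) + (x - y)" for u by simp
  ultimately show "coset B x = coset B y"
    unfolding coset_altdef using add_subgroup_cancel_right[OF assms] by metis
qed

lemma mult_Mod:
  assumes "add_subgroup A" "add_subgroup B" "B \<subseteq> A" "x \<in> A" "y \<in> A"
  shows "coset B x \<otimes>\<^bsub>add_group A Mod B\<^esub> coset B y = coset B (x + y)"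
  using normal.rcos_sum[OF normal_add_group[OF assms(1-3)], of x y] assms
  by (simp add: FactGroup_def r_coset_def)

lemma one_Mod: "\<one>\<^bsub>add_group A Mod B\<^esub> = B"
  by (simp add: FactGroup_def)

lemma coset_zero: "coset B 0 = B"
  by (simp add: coset_altdef)

text \<open>\<open>card\<close> makes this \<open>0\<close> for an infinite quotient; for nonempty
  \<open>A\<close>, \<open>index A B > 0\<close> is how finiteness is expressed from here
  on.\<close>

definition index :: "'a::ab_group_add set \<Rightarrow> 'a set \<Rightarrow> nat" where
  "index A B = card (carrier (add_group A Mod B))"

lemma index_altdef: "index A B = card (coset B ` A)"
  by (simp add: index_def carrier_Mod)

text \<open>The map \<open>f\<close> need not be additive: the condition on differences says at once
  that it descends to cosets and that it is injective there. This admits floors of coordinates and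
  functions obtained by choice.\<close>

lemma coset_image_bij:
  assumes B: "add_subgroup B" and B': "add_subgroup B'"
    and maps: "\<And>a. a \<in> A \<Longrightarrow> f a \<in> A'"
    and ker: "\<And>a b. a \<in> A \<Longrightarrow> b \<in> A \<Longrightarrow> f a - f b \<in> B' \<longleftrightarrow> a - b \<in> B"
    and onto: "\<And>a'. a' \<in> A' \<Longrightarrow> \<exists>a\<in>A. f a - a' \<in> B'"
  obtains g where "bij_betw g (coset B ` A) (coset B' ` A')"
    "\<And>a. a \<in> A \<Longrightarrow> g (coset B a) = coset B' (f a)"
proof -
  define rep where "rep X = (SOME a. a \<in> A \<and> coset B a = X)" for X
  have rep: "rep (coset B a) \<in> A \<and> coset B (rep (coset B a)) = coset B a" if "a \<in> A" for a
    unfolding rep_def by (rule someI[of _ a]) (use that in auto)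
  define g where "g X = coset B' (f (rep X))" for X
  have g: "g (coset B a) = coset B' (f a)" if "a \<in> A" for a
    using rep[OF that] ker[of "rep (coset B a)" a] that
    by (simp add: g_def coset_eq_iff[OF B] coset_eq_iff[OF B'])
  have "bij_betw g (coset B ` A) (coset B' ` A')"
  proof (rule bij_betwI')
    fix X Y assume "X \<in> coset B ` A" "Y \<in> coset B ` A"
    then obtain a b where "a \<in> A" "b \<in> A" "X = coset B a" "Y = coset B b" by blast
    then show "g X = g Y \<longleftrightarrow> X = Y"
      by (simp add: g coset_eq_iff[OF B] coset_eq_iff[OF B'] ker)
  next
    fix X assume "X \<in> coset B ` A"
    then show "g X \<in> coset B' ` A'" using g maps by auto
  next
    fix Y assume "Y \<in> coset B' ` A'"
    then obtain a' a where "a' \<in> A'" "Y = coset B' a'" "a \<in> A" "f a - a' \<in> B'"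
      using onto by blast
    then show "\<exists>X\<in>coset B ` A. Y = g X"
      using add_subgroup_uminus[OF B', of "f a - a'"]
      by (intro bexI[of _ "coset B a"]) (auto simp: g coset_eq_iff[OF B'])
  qed
  then show thesis using that g by blast
qed

lemma index_eqI:
  assumes "add_subgroup B" "add_subgroup B'" "\<And>a. a \<in> A \<Longrightarrow> f a \<in> A'"
    "\<And>a b. a \<in> A \<Longrightarrow> b \<in> A \<Longrightarrow> f a - f b \<in> B' \<longleftrightarrow> a - b \<in> B"
    "\<And>a'. a' \<in> A' \<Longrightarrow> \<exists>a\<in>A. f a - a' \<in> B'"
  shows "index A B = index A' B'"
  using coset_image_bij[OF assms] bij_betw_same_card unfolding index_altdef by metis

lemma index_plus_right:
  assumes "add_subgroup A" "add_subgroup B"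
  shows "index (A + B) B = index A (A \<inter> B)"
proof (rule sym, rule index_eqI[where f = "\<lambda>x. x"])
  fix a' assume "a' \<in> A + B"
  then obtain a b where "a \<in> A" "b \<in> B" "a' = a + b" by (auto elim!: set_plus_elim)
  then show "\<exists>a\<in>A. a - a' \<in> B" using assms by (auto intro!: bexI[of _ a] simp: add_subgroup_uminus)
qed (use assms subset_plus_left in \<open>auto simp: add_subgroup_Int add_subgroup_diff\<close>)

lemma index_plus_left:
  assumes "add_subgroup A" "add_subgroup B"
  shows "index (A + B) A = index B (A \<inter> B)"
  using index_plus_right[OF assms(2,1)] by (simp add: add.commute Int_commute)

text \<open>Representatives of \<open>A / B\<close> and of \<open>B / C\<close> add up to
  representatives of \<open>A / C\<close>. The cardinality of a product of sets is always the
  product of the cardinalities, so infinite indices are covered.\<close>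

lemma index_mult:
  assumes A: "add_subgroup A" and B: "add_subgroup B" and C: "add_subgroup C"
    and "C \<subseteq> B" "B \<subseteq> A"
  shows "index A C = index A B * index B C"
proof -
  define rep where "rep X = (SOME a. a \<in> A \<and> coset B a = X)" for X
  have rep: "rep X \<in> A \<and> coset B (rep X) = X" if "X \<in> coset B ` A" for X
    unfolding rep_def by (rule someI_ex) (use that in auto)
  define pick where "pick Y = (SOME b. b \<in> B \<and> coset C b = Y)" for Y
  have pick: "pick Y \<in> B \<and> coset C (pick Y) = Y" if "Y \<in> coset C ` B" for Y
    unfolding pick_def by (rule someI_ex) (use that in auto)
  define h where "h = (\<lambda>(X, Y). coset C (rep X + pick Y))"
  have "bij_betw h ((coset B ` A) \<times> (coset C ` B)) (coset C ` A)"
  proof (rule bij_betwI')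
    fix p q assume p: "p \<in> (coset B ` A) \<times> (coset C ` B)" and q: "q \<in> (coset B ` A) \<times> (coset C ` B)"
    obtain X Y X' Y' where [simp]: "p = (X, Y)" "q = (X', Y')" by (cases p, cases q)
    have XY: "rep X \<in> A" "coset B (rep X) = X" "rep X' \<in> A" "coset B (rep X') = X'"
      "pick Y \<in> B" "coset C (pick Y) = Y" "pick Y' \<in> B" "coset C (pick Y') = Y'"
      using rep pick p q by auto
    show "h p = h q \<longleftrightarrow> p = q"
    proof
      assume "h p = h q"
      then have *: "rep X + pick Y - (rep X' + pick Y') \<in> C"
        by (simp add: h_def coset_eq_iff[OF C])
      moreover have "rep X - rep X' = (rep X + pick Y - (rep X' + pick Y')) + (pick Y' - pick Y)"
        by simp
      ultimately have "rep X - rep X' \<in> B"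
        using XY \<open>C \<subseteq> B\<close> add_subgroup_add[OF B] add_subgroup_diff[OF B] by (metis subsetD)
      then have X: "X = X'" using XY coset_eq_iff[OF B] by metis
      with * have "pick Y - pick Y' \<in> C" by (simp add: algebra_simps)
      then show "p = q" using X XY coset_eq_iff[OF C] by (metis \<open>p = (X, Y)\<close> \<open>q = (X', Y')\<close>)
    qed simp
  next
    fix p assume "p \<in> (coset B ` A) \<times> (coset C ` B)"
    then show "h p \<in> coset C ` A"
      using rep pick \<open>B \<subseteq> A\<close> by (force simp: h_def intro!: imageI add_subgroup_add[OF A])
  next
    fix Z assume "Z \<in> coset C ` A"
    then obtain a where a: "a \<in> A" "Z = coset C a" by auto
    have r: "rep (coset B a) \<in> A" "a - rep (coset B a) \<in> B"
      using rep[of "coset B a"] a coset_eq_iff[OF B] by (metis imageI)+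
    let ?Y = "coset C (a - rep (coset B a))"
    have "pick ?Y \<in> B" "pick ?Y - (a - rep (coset B a)) \<in> C"
      using pick[of ?Y] r coset_eq_iff[OF C] by (metis imageI)+
    then show "\<exists>p\<in>(coset B ` A) \<times> (coset C ` B). Z = h p"
      using a r add_subgroup_uminus[OF C, of "pick ?Y - (a - rep (coset B a))"]
      by (intro bexI[of _ "(coset B a, ?Y)"]) (auto simp: h_def coset_eq_iff[OF C] algebra_simps)
  qed
  then have "card (coset C ` A) = card ((coset B ` A) \<times> (coset C ` B))"
    by (metis bij_betw_same_card)
  then show ?thesis by (simp add: index_altdef card_cartesian_product)
qed

lemma index_eq_1_iff:
  assumes "add_subgroup A" "add_subgroup B" "B \<subseteq> A" shows "index A B = 1 \<longleftrightarrow> A = B"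
proof
  assume "index A B = 1"
  then have "\<exists>X. coset B ` A = {X}" by (simp add: index_altdef card_1_singleton_iff)
  then obtain X where X: "coset B ` A = {X}" by blast
  have "a \<in> B" if "a \<in> A" for a
  proof -
    have "coset B a \<in> {X}" "coset B 0 \<in> {X}"
      unfolding X[symmetric] using that add_subgroup_zero[OF assms(1)] by auto
    then have "coset B a = coset B 0" by simp
    then show ?thesis by (simp add: coset_eq_iff[OF assms(2)])
  qed
  then show "A = B" using assms by auto
next
  assume "A = B"
  have "coset B a = B" if "a \<in> B" for a
    using coset_eq_iff[OF assms(2), of a 0] that by (simp add: coset_zero)
  then have "coset B ` A = {B}"
    using \<open>A = B\<close> add_subgroup_zero[OF assms(2)] by auto
  then show "index A B = 1" by (simp add: index_altdef)
qed

definition zmul :: "int \<Rightarrow> 'a::ab_group_add \<Rightarrow> 'a" where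
  "zmul k x = x [^]\<^bsub>add_group UNIV\<^esub> k"

lemma zmul_add_left: "zmul (k + l) x = zmul k x + zmul l x"
  and zmul_add_right: "zmul k (x + y) = zmul k x + zmul k y"
  and zmul_zmul: "zmul k (zmul l x) = zmul (k * l) x"
  and zmul_0 [simp]: "zmul 0 x = 0"
  and zmul_1 [simp]: "zmul 1 x = x"
  and zmul_minus_left: "zmul (- k) x = - zmul k x"
proof -
  interpret comm_group "add_group (UNIV :: 'a set)"
    by (rule comm_group_add_group[OF add_subgroup_UNIV])
  show "zmul (k + l) x = zmul k x + zmul l x" using int_pow_mult[of x k l] by (simp add: zmul_def)
  show "zmul k (x + y) = zmul k x + zmul k y" using int_pow_distrib[of x y k] by (simp add: zmul_def)
  show "zmul k (zmul l x) = zmul (k * l) x" using int_pow_pow[of x l k] by (simp add: zmul_def mult.commute)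
  show "zmul 0 x = 0" "zmul 1 x = x" using int_pow_0 int_pow_1[of x] by (auto simp: zmul_def)
  show "zmul (- k) x = - zmul k x"
    using int_pow_neg[of x k] inv_add_group[OF add_subgroup_UNIV] by (simp add: zmul_def)
qed

lemma zmul_diff_left: "zmul (k - l) x = zmul k x - zmul l x"
  using zmul_add_left[of k "- l" x] by (simp add: zmul_minus_left)

lemma zmul_zero_right [simp]: "zmul k 0 = 0"
  using zmul_add_right[of k 0 0] by simp

lemma zmul_minus_right: "zmul k (- x) = - zmul k x"
  using zmul_add_right[of k x "- x"] by (simp add: eq_neg_iff_add_eq_0 add.commute)

lemma zmul_diff_right: "zmul k (x - y) = zmul k x - zmul k y"
  using zmul_add_right[of k x "- y"] by (simp add: zmul_minus_right)

lemma add_subgroup_zmul: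
  assumes "add_subgroup A" "x \<in> A" shows "zmul k x \<in> A"
proof (induction k rule: int_induct[where k = 0])
  case (step1 i)
  then show ?case using assms by (simp add: zmul_add_left add_subgroup_add)
next
  case (step2 i)
  then show ?case using assms by (simp add: zmul_diff_left add_subgroup_diff)
qed (use assms in \<open>simp add: add_subgroup_zero\<close>)

lemma add_subgroup_dvd_zmul:
  assumes "add_subgroup A" "zmul n x \<in> A" "n dvd k" shows "zmul k x \<in> A"
  using add_subgroup_zmul[OF assms(1,2)] assms(3) by (auto simp: zmul_zmul mult.commute elim!: dvdE)

lemma pow_Mod:
  assumes "add_subgroup A" "add_subgroup B" "B \<subseteq> A" "x \<in> A"
  shows "coset B x [^]\<^bsub>add_group A Mod B\<^esub> (n::nat) = coset B (zmul (int n) x)"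
proof -
  interpret G: comm_group "add_group A Mod B" by (rule comm_group_Mod[OF assms(1-3)])
  show ?thesis
  proof (induction n)
    case 0
    then show ?case by (simp add: one_Mod coset_zero)
  next
    case (Suc n)
    then show ?case
      using mult_Mod[OF assms(1-3) add_subgroup_zmul[OF assms(1,4)] assms(4)]
      by (simp add: zmul_add_left add.commute)
  qed
qed

text \<open>Lagrange's theorem in the quotient; for an infinite quotient the multiple is the zeroth
  one.\<close>

lemma zmul_index_mem:
  assumes "add_subgroup A" "add_subgroup B" "B \<subseteq> A" "x \<in> A"
  shows "zmul (int (index A B)) x \<in> B"
proof (cases "index A B = 0")
  case False
  interpret G: comm_group "add_group A Mod B" by (rule comm_group_Mod[OF assms(1-3)])
  have "coset B x [^]\<^bsub>add_group A Mod B\<^esub> (index A B) = \<one>\<^bsub>add_group A Mod B\<^esub>"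
    using G.pow_order_eq_1[of "coset B x"] assms(4)
    by (simp add: index_def Coset.order_def carrier_Mod)
  then have "coset B (zmul (int (index A B)) x) = coset B 0"
    by (simp add: pow_Mod[OF assms] one_Mod coset_zero)
  then show ?thesis by (simp add: coset_eq_iff[OF assms(2)])
qed (use assms in \<open>simp add: add_subgroup_zero\<close>)

section \<open>Pairings modulo the integers\<close>

text \<open>A homomorphism to the rationals modulo \<int>, given by arbitrary rational lifts of its
  values; equations in the quotient become differences in \<int>.\<close>

definition additive_mod_Z :: "'a::ab_group_add set \<Rightarrow> ('a \<Rightarrow> rat) \<Rightarrow> bool" where
  "additive_mod_Z A f \<longleftrightarrow> (\<forall>x\<in>A. \<forall>y\<in>A. f (x + y) - (f x + f y) \<in> \<int>)"

lemma Ints_cong: "x - y \<in> \<int> \<Longrightarrow> (x :: rat) \<in> \<int> \<longleftrightarrow> y \<in> \<int>"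
  by (rule add_subgroup_cancel_diff[OF add_subgroup_Ints])

lemma additive_mod_Z_zero:
  assumes "add_subgroup A" "additive_mod_Z A f" shows "f 0 \<in> \<int>"
proof -
  have "f (0 + 0) - (f 0 + f 0) \<in> \<int>"
    using assms unfolding additive_mod_Z_def by (blast intro: add_subgroup_zero)
  then show ?thesis by simp
qed

lemma additive_mod_Z_diff:
  assumes "add_subgroup A" "additive_mod_Z A f" "x \<in> A" "y \<in> A"
  shows "f (x - y) - (f x - f y) \<in> \<int>"
proof -
  have "f (x - y + y) - (f (x - y) + f y) \<in> \<int>"
    using assms unfolding additive_mod_Z_def by (blast intro: add_subgroup_diff)
  from Ints_minus[OF this] show ?thesis by (simp add: algebra_simps)
qed

lemma additive_mod_Z_add:
  "additive_mod_Z A f \<Longrightarrow> x \<in> A \<Longrightarrow> y \<in> A \<Longrightarrow> f (x + y) - (f x + f y) \<in> \<int>"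
  by (simp add: additive_mod_Z_def)

lemma additive_mod_Z_zmul:
  assumes A: "add_subgroup A" and f: "additive_mod_Z A f" and x: "x \<in> A"
  shows "f (zmul k x) - of_int k * f x \<in> \<int>"
proof (induction k rule: int_induct[where k = 0])
  case base
  then show ?case using additive_mod_Z_zero[OF A f] by simp
next
  case (step1 i)
  have "f (zmul i x + x) - (f (zmul i x) + f x) \<in> \<int>"
    by (rule additive_mod_Z_add[OF f add_subgroup_zmul[OF A x] x])
  from Ints_add[OF this step1(2)] show ?case by (simp add: zmul_add_left algebra_simps)
next
  case (step2 i)
  have "f (zmul i x - x) - (f (zmul i x) - f x) \<in> \<int>"
    by (rule additive_mod_Z_diff[OF A f add_subgroup_zmul[OF A x] x])
  from Ints_add[OF this step2(2)] show ?case by (simp add: zmul_diff_left algebra_simps)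
qed

lemma Ints_of_int_div: "(of_int k :: rat) / of_nat n \<in> \<int> \<Longrightarrow> n > 0 \<Longrightarrow> int n dvd k"
proof -
  assume "(of_int k :: rat) / of_nat n \<in> \<int>" "n > 0"
  then obtain j where "(of_int k :: rat) / of_nat n = of_int j" by (auto elim: Ints_cases)
  then have "(of_int k :: rat) = of_int (j * int n)" using \<open>n > 0\<close> by (simp add: field_simps)
  then have "k = j * int n" by (simp only: of_int_eq_iff)
  then show ?thesis by simp
qed

text \<open>A character whose order is exactly \<open>n\<close> takes the value \<open>1 / n\<close>: its values generate a
  subgroup of \<open>(1 / n) \<int> / \<int>\<close>, and a proper subgroup would be killed by a smaller number.\<close>

lemma additive_mod_Z_attains_inverse_order:
  assumes C: "add_subgroup C" and f: "additive_mod_Z C f" and "n > 0"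
    and kill: "\<And>c. c \<in> C \<Longrightarrow> of_nat n * f c \<in> \<int>"
    and least: "\<And>m. 0 < m \<Longrightarrow> m < n \<Longrightarrow> \<exists>c\<in>C. of_nat m * f c \<notin> \<int>"
  shows "\<exists>c\<in>C. f c - 1 / of_nat n \<in> \<int>"
proof -
  define I where "I = {k :: int. \<exists>c\<in>C. f c - of_int k / of_nat n \<in> \<int>}"
  have I_diff: "k - l \<in> I" if k: "k \<in> I" and l: "l \<in> I" for k l
  proof -
    obtain c c' where c: "c \<in> C" "f c - of_int k / of_nat n \<in> \<int>"
      and c': "c' \<in> C" "f c' - of_int l / of_nat n \<in> \<int>"
      using k l unfolding I_def by blast
    have "f (c - c') - (f c - f c') \<in> \<int>" by (rule additive_mod_Z_diff[OF C f c(1) c'(1)])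
    from Ints_add[OF this Ints_diff[OF c(2) c'(2)]]
    have "f (c - c') - of_int (k - l) / of_nat n \<in> \<int>" by (simp add: algebra_simps diff_divide_distrib)
    then show ?thesis unfolding I_def using add_subgroup_diff[OF C c(1) c'(1)] by blast
  qed
  have I_n: "int n \<in> I"
    unfolding I_def using \<open>n > 0\<close> additive_mod_Z_zero[OF C f] add_subgroup_zero[OF C]
    by (auto intro!: bexI[of _ 0])
  have I: "add_subgroup I"
    using I_diff I_n by (auto intro!: add_subgroupI) (use I_diff[OF I_n I_n] in simp)
  have zmul_int: "zmul a b = a * b" for a b :: int
    by (induction a rule: int_induct[where k = 0]) (auto simp: zmul_add_left zmul_diff_left algebra_simps)
  define g where "g = (LEAST g. 0 < g \<and> int g \<in> I)"
  have g: "0 < g \<and> int g \<in> I" unfolding g_def by (rule LeastI[of _ n]) (use I_n \<open>n > 0\<close> in auto)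
  have g_dvd: "int g dvd k" if "k \<in> I" for k
  proof -
    have "k - (k div int g) * int g \<in> I"
      using add_subgroup_zmul[OF I, of "int g" "k div int g"] g I_diff[OF that] by (simp add: zmul_int)
    then have "k mod int g \<in> I" by (simp add: minus_div_mult_eq_mod)
    moreover have "0 \<le> k mod int g" "k mod int g < int g" using g by auto
    ultimately have "nat (k mod int g) = 0"
      using not_less_Least[of "nat (k mod int g)" "\<lambda>g. 0 < g \<and> int g \<in> I"]
      by (auto simp: g_def[symmetric])
    then show ?thesis using \<open>0 \<le> k mod int g\<close> by (simp add: dvd_eq_mod_eq_0)
  qed
  \<comment> \<open>\<open>g\<close> generates the numerators \<open>I\<close>, so modulo integers
    every value of \<open>f\<close> is a multiple of \<open>g / n = 1 / m\<close>, and
    \<open>m\<close> already kills \<open>f\<close>. Minimality of \<open>n\<close> leaves only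
    \<open>g = 1\<close>.\<close>
  obtain m where m: "n = g * m" using g_dvd[OF I_n] by auto
  have "of_nat m * f c \<in> \<int>" if c: "c \<in> C" for c
  proof -
    obtain k where k: "of_nat n * f c = of_int k" using kill[OF c] by (auto elim: Ints_cases)
    then have fc: "f c = of_int k / of_nat n" using \<open>n > 0\<close> by (simp add: field_simps)
    then have "k \<in> I" unfolding I_def using c by (auto intro!: bexI[of _ c])
    then obtain j where "k = int g * j" using g_dvd by auto
    then have "of_nat m * f c = of_int j" using fc m \<open>n > 0\<close> by (simp add: field_simps)
    then show ?thesis by simp
  qed
  then have "m = n" using least[of m] m \<open>n > 0\<close> g by (metis gr0I mult_0_right mult_le_mono1 nat_mult_1 Suc_leI One_nat_def le_neq_implies_less)
  then have "g = 1" using m \<open>n > 0\<close> by simp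
  then show ?thesis using g by (auto simp: I_def)
qed

section \<open>Pairings modulo the integers, their kernels and perfect duality\<close>

definition pairing_mod_Z ::
    "'a::ab_group_add set \<Rightarrow> 'b::ab_group_add set \<Rightarrow> ('a \<Rightarrow> 'b \<Rightarrow> rat) \<Rightarrow> bool" where
  "pairing_mod_Z A C \<phi> \<longleftrightarrow> add_subgroup A \<and> add_subgroup C \<and>
     (\<forall>c\<in>C. additive_mod_Z A (\<lambda>a. \<phi> a c)) \<and> (\<forall>a\<in>A. additive_mod_Z C (\<phi> a))"

text \<open>The left kernel; the right kernel arises by exchanging the arguments of
  \<open>\<phi>\<close>. Inserting a smaller \<open>C\<close> gives orthogonal complements.\<close>

definition annihilator :: "'a set \<Rightarrow> 'b set \<Rightarrow> ('a \<Rightarrow> 'b \<Rightarrow> rat) \<Rightarrow> 'a set" where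
  "annihilator A C \<phi> = {a \<in> A. \<forall>c\<in>C. \<phi> a c \<in> \<int>}"

lemma pairing_mod_Z_swap: "pairing_mod_Z A C \<phi> \<Longrightarrow> pairing_mod_Z C A (\<lambda>c a. \<phi> a c)"
  by (auto simp: pairing_mod_Z_def)

lemma pairing_mod_Z_subset:
  "pairing_mod_Z A C \<phi> \<Longrightarrow> add_subgroup A' \<Longrightarrow> A' \<subseteq> A \<Longrightarrow> add_subgroup C' \<Longrightarrow> C' \<subseteq> C \<Longrightarrow>
     pairing_mod_Z A' C' \<phi>"
  unfolding pairing_mod_Z_def additive_mod_Z_def by blast

lemma
  assumes "pairing_mod_Z A C \<phi>"
  shows pairing_subgroup_left: "add_subgroup A"
    and pairing_subgroup_right: "add_subgroup C"
    and pairing_left: "c \<in> C \<Longrightarrow> additive_mod_Z A (\<lambda>a. \<phi> a c)"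
    and pairing_right: "a \<in> A \<Longrightarrow> additive_mod_Z C (\<phi> a)"
  using assms by (auto simp: pairing_mod_Z_def)

lemma
  assumes p: "pairing_mod_Z A C \<phi>" and a: "a \<in> A" and c: "c \<in> C"
  shows pairing_diff_left: "a' \<in> A \<Longrightarrow> \<phi> (a - a') c - (\<phi> a c - \<phi> a' c) \<in> \<int>"
    and pairing_diff_right: "c' \<in> C \<Longrightarrow> \<phi> a (c - c') - (\<phi> a c - \<phi> a c') \<in> \<int>"
    and pairing_add_left: "a' \<in> A \<Longrightarrow> \<phi> (a + a') c - (\<phi> a c + \<phi> a' c) \<in> \<int>"
    and pairing_add_right: "c' \<in> C \<Longrightarrow> \<phi> a (c + c') - (\<phi> a c + \<phi> a c') \<in> \<int>"
    and pairing_zmul_left: "\<phi> (zmul k a) c - of_int k * \<phi> a c \<in> \<int>"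
    and pairing_zmul_right: "\<phi> a (zmul k c) - of_int k * \<phi> a c \<in> \<int>"
    and pairing_zero_left: "\<phi> 0 c \<in> \<int>"
    and pairing_zero_right: "\<phi> a 0 \<in> \<int>"
  using additive_mod_Z_diff[OF pairing_subgroup_left[OF p] pairing_left[OF p c] a, of a']
    additive_mod_Z_diff[OF pairing_subgroup_right[OF p] pairing_right[OF p a] c, of c']
    additive_mod_Z_add[OF pairing_left[OF p c] a, of a']
    additive_mod_Z_add[OF pairing_right[OF p a] c, of c']
    additive_mod_Z_zmul[OF pairing_subgroup_left[OF p] pairing_left[OF p c] a, of k]
    additive_mod_Z_zmul[OF pairing_subgroup_right[OF p] pairing_right[OF p a] c, of k]
    additive_mod_Z_zero[OF pairing_subgroup_left[OF p] pairing_left[OF p c]]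
    additive_mod_Z_zero[OF pairing_subgroup_right[OF p] pairing_right[OF p a]]
  by auto

lemma add_subgroup_annihilator_subset:
  assumes p: "pairing_mod_Z A C \<phi>" and D: "D \<subseteq> C"
  shows "add_subgroup (annihilator A D \<phi>)"
proof (rule add_subgroupI)
  show "0 \<in> annihilator A D \<phi>"
    using pairing_zero_left[OF p] add_subgroup_zero[OF pairing_subgroup_left[OF p]] D
    by (auto simp: annihilator_def)
  fix x y assume x: "x \<in> annihilator A D \<phi>" and y: "y \<in> annihilator A D \<phi>"
  then have xy: "x \<in> A" "y \<in> A" by (auto simp: annihilator_def)
  have "\<phi> (x - y) c \<in> \<int>" if "c \<in> D" for c
    using Ints_cong[OF pairing_diff_left[OF p xy(1) _ xy(2), of c]] x y that D
    by (auto simp: annihilator_def)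
  then show "x - y \<in> annihilator A D \<phi>"
    using add_subgroup_diff[OF pairing_subgroup_left[OF p] xy] by (simp add: annihilator_def)
qed

lemmas add_subgroup_annihilator = add_subgroup_annihilator_subset[OF _ subset_refl]

lemma annihilator_subset: "annihilator A C \<phi> \<subseteq> A"
  by (auto simp: annihilator_def)

text \<open>The order of the coset of \<open>x\<close>. It is meaningful only if some positive
  multiple of \<open>x\<close> lies in \<open>B\<close>, hence the witness \<open>N\<close> in the
  facts below.\<close>

definition order_mod :: "'a::ab_group_add set \<Rightarrow> 'a \<Rightarrow> nat" where
  "order_mod B x = (LEAST n. 0 < n \<and> zmul (int n) x \<in> B)"

lemma order_mod:
  assumes "0 < N" "zmul (int N) x \<in> B"
  shows order_mod_pos: "0 < order_mod B x" and zmul_order_mod: "zmul (int (order_mod B x)) x \<in> B"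
    and order_mod_le: "order_mod B x \<le> N"
  using LeastI[of "\<lambda>n. 0 < n \<and> zmul (int n) x \<in> B" N] assms
    Least_le[of "\<lambda>n. 0 < n \<and> zmul (int n) x \<in> B" N]
  by (auto simp: order_mod_def)

lemma order_mod_least: "0 < m \<Longrightarrow> m < order_mod B x \<Longrightarrow> zmul (int m) x \<notin> B"
  using not_less_Least[of m "\<lambda>n. 0 < n \<and> zmul (int n) x \<in> B"] by (auto simp: order_mod_def)

lemma zmul_annihilator_iff:
  assumes "pairing_mod_Z A C \<phi>" "x \<in> A"
  shows "zmul k x \<in> annihilator A C \<phi> \<longleftrightarrow> (\<forall>c\<in>C. of_int k * \<phi> x c \<in> \<int>)"
  using Ints_cong[OF pairing_zmul_left[OF assms]] add_subgroup_zmul[OF pairing_subgroup_left[OF assms(1)] assms(2)]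
  by (auto simp: annihilator_def)

text \<open>A multiple of \<open>x\<close> lies in the annihilator exactly when the same multiple of
  the character \<open>\<phi> x\<close> is trivial, so \<open>x\<close> and its character have the
  same order.\<close>

lemma pairing_attains_inverse_order:
  assumes p: "pairing_mod_Z A C \<phi>" and x: "x \<in> A"
    and N: "0 < N" "zmul (int N) x \<in> annihilator A C \<phi>"
  shows "\<exists>y\<in>C. \<phi> x y - 1 / of_nat (order_mod (annihilator A C \<phi>) x) \<in> \<int>"
proof (rule additive_mod_Z_attains_inverse_order)
  let ?n = "order_mod (annihilator A C \<phi>) x"
  show "of_nat ?n * \<phi> x c \<in> \<int>" if "c \<in> C" for c
    using zmul_order_mod[OF N] that unfolding zmul_annihilator_iff[OF p x] by simp
  show "\<exists>c\<in>C. of_nat m * \<phi> x c \<notin> \<int>" if "0 < m" "m < ?n" for m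
    using order_mod_least[OF that] unfolding zmul_annihilator_iff[OF p x] by simp
qed (use pairing_subgroup_right[OF p] pairing_right[OF p x] order_mod_pos[OF N] in auto)

text \<open>A correspondence is the graph of an isomorphism from \<open>A / A0\<close> to \<open>C / C0\<close>, pulled back
  to \<open>A \<times> C\<close>.\<close>

definition correspondence ::
    "'a::ab_group_add set \<Rightarrow> 'a set \<Rightarrow> 'b::ab_group_add set \<Rightarrow> 'b set \<Rightarrow> ('a \<times> 'b) set \<Rightarrow> bool" where
  "correspondence A A0 C C0 R \<longleftrightarrow> R \<subseteq> A \<times> C \<and>
     (\<forall>a c a' c'. (a, c) \<in> R \<longrightarrow> (a', c') \<in> R \<longrightarrow> (a - a', c - c') \<in> R) \<and>
     (\<forall>a\<in>A. \<exists>c. (a, c) \<in> R) \<and> (\<forall>c\<in>C. \<exists>a. (a, c) \<in> R) \<and>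
     (\<forall>a c. (a, c) \<in> R \<longrightarrow> a \<in> A0 \<longleftrightarrow> c \<in> C0)"

lemma correspondence_diff:
  "correspondence A A0 C C0 R \<Longrightarrow> (a, c) \<in> R \<Longrightarrow> (a', c') \<in> R \<Longrightarrow> a - a' \<in> A0 \<longleftrightarrow> c - c' \<in> C0"
  unfolding correspondence_def by blast

lemma correspondence_function:
  assumes "correspondence A A0 C C0 R"
  obtains f where "\<And>a. a \<in> A \<Longrightarrow> (a, f a) \<in> R"
  using assms unfolding correspondence_def by metis

lemma correspondence_coset_bij:
  assumes R: "correspondence A A0 C C0 R" and A0: "add_subgroup A0" and C0: "add_subgroup C0"
    and f: "\<And>a. a \<in> A \<Longrightarrow> (a, f a) \<in> R"
  obtains g where "bij_betw g (coset A0 ` A) (coset C0 ` C)"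
    "\<And>a. a \<in> A \<Longrightarrow> g (coset A0 a) = coset C0 (f a)"
proof (rule coset_image_bij[OF A0 C0, of A f C])
  show "f a \<in> C" if "a \<in> A" for a using R f[OF that] by (auto simp: correspondence_def)
  show "f a - f b \<in> C0 \<longleftrightarrow> a - b \<in> A0" if "a \<in> A" "b \<in> A" for a b
    using correspondence_diff[OF R f f] that by blast
  show "\<exists>a\<in>A. f a - c \<in> C0" if "c \<in> C" for c
  proof -
    obtain a where a: "(a, c) \<in> R" "a \<in> A" using R \<open>c \<in> C\<close> unfolding correspondence_def by blast
    then have "f a - c \<in> C0"
      using correspondence_diff[OF R f a(1), of a] add_subgroup_zero[OF A0] by simp
    then show ?thesis using a by blast
  qed
qed (use that in blast)

lemma correspondence_index:
  assumes "correspondence A A0 C C0 R" "add_subgroup A0" "add_subgroup C0"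
  shows "index A A0 = index C C0"
  by (rule correspondence_function[OF assms(1)], rule correspondence_coset_bij[OF assms])
    (auto simp: index_altdef dest: bij_betw_same_card)

text \<open>The chosen \<open>f\<close> is additive only up to \<open>C0\<close>: both
  \<open>f (a + b) - f a\<close> and \<open>f b\<close> are partners of \<open>b\<close>, hence
  agree modulo \<open>C0\<close>.\<close>

lemma correspondence_iso:
  assumes R: "correspondence A A0 C C0 R" and A: "add_subgroup A" and A0: "add_subgroup A0" "A0 \<subseteq> A"
    and C: "add_subgroup C" and C0: "add_subgroup C0" "C0 \<subseteq> C"
  shows "add_group A Mod A0 \<cong> add_group C Mod C0"
proof -
  obtain f where f: "\<And>a. a \<in> A \<Longrightarrow> (a, f a) \<in> R" using correspondence_function[OF R] by blast
  have fC: "f a \<in> C" if "a \<in> A" for a using R f[OF that] by (auto simp: correspondence_def)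
  obtain g where g: "bij_betw g (coset A0 ` A) (coset C0 ` C)"
    "\<And>a. a \<in> A \<Longrightarrow> g (coset A0 a) = coset C0 (f a)"
    using correspondence_coset_bij[OF R A0(1) C0(1) f] by blast
  have "g \<in> hom (add_group A Mod A0) (add_group C Mod C0)"
  proof (rule homI)
    fix X Y assume "X \<in> carrier (add_group A Mod A0)" "Y \<in> carrier (add_group A Mod A0)"
    then obtain a b where ab: "a \<in> A" "b \<in> A" "X = coset A0 a" "Y = coset A0 b"
      by (auto simp: carrier_Mod)
    have sum: "a + b \<in> A" using A ab by (simp add: add_subgroup_add)
    have "((a + b) - a, f (a + b) - f a) \<in> R"
      using R f[OF sum] f[OF ab(1)] unfolding correspondence_def by blast
    then have "f (a + b) - f a - f b \<in> C0"
      using correspondence_diff[OF R _ f[OF ab(2)]] add_subgroup_zero[OF A0(1)] by fastforce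
    then have "coset C0 (f (a + b)) = coset C0 (f a + f b)"
      by (simp add: coset_eq_iff[OF C0(1)] algebra_simps)
    then show "g (X \<otimes>\<^bsub>add_group A Mod A0\<^esub> Y) = g X \<otimes>\<^bsub>add_group C Mod C0\<^esub> g Y"
      using ab sum fC mult_Mod[OF A A0 ab(1,2)] mult_Mod[OF C C0 fC fC, of a b] by (simp add: g(2))
  qed (use bij_betwE[OF g(1)] in \<open>auto simp: carrier_Mod\<close>)
  then have "g \<in> iso (add_group A Mod A0) (add_group C Mod C0)"
    using g(1) by (simp add: iso_def carrier_Mod)
  then show ?thesis by (auto simp: is_iso_def)
qed

text \<open>As \<open>n\<close> kills \<open>\<phi> a y\<close>, this value is some
  \<open>k / n\<close>, which is \<open>k\<close> times \<open>\<phi> x y\<close> modulo integers;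
  subtracting \<open>k\<close> copies of \<open>x\<close> cancels it.\<close>

lemma pairing_split:
  assumes p: "pairing_mod_Z A C \<phi>" and x: "x \<in> A" and y: "y \<in> C" and n: "n > 0"
    and v: "\<phi> x y - 1 / of_nat n \<in> \<int>"
    and a: "a \<in> A" and na: "of_nat n * \<phi> a y \<in> \<int>"
  shows "\<exists>k. \<phi> (a - zmul k x) y \<in> \<int>"
proof -
  obtain k where "of_nat n * \<phi> a y = of_int k" using na by (auto elim: Ints_cases)
  then have k: "\<phi> a y = of_int k / of_nat n" using n by (simp add: field_simps)
  have zx: "zmul k x \<in> A" by (rule add_subgroup_zmul[OF pairing_subgroup_left[OF p] x])
  have "\<phi> (a - zmul k x) y = (\<phi> (a - zmul k x) y - (\<phi> a y - \<phi> (zmul k x) y))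
      - (\<phi> (zmul k x) y - of_int k * \<phi> x y) - of_int k * (\<phi> x y - 1 / of_nat n)"
    by (simp add: k algebra_simps)
  also have "\<dots> \<in> \<int>"
    by (intro Ints_diff Ints_mult pairing_diff_left[OF p a y zx] pairing_zmul_left[OF p x y] v) auto
  finally show ?thesis by blast
qed

text \<open>Choose \<open>x\<close> of maximal order \<open>n\<close> modulo the annihilator and \<open>y\<close> with \<open>\<phi> x y = 1 / n\<close>. Then
  \<open>y\<close> has order \<open>n\<close> as well, both sides split off the cyclic groups generated by \<open>x\<close> and \<open>y\<close>,
  and the orthogonal complements are again paired perfectly.\<close>

theorem pairing_correspondence:
  assumes "pairing_mod_Z A C \<phi>" and "index A (annihilator A C \<phi>) > 0"
  shows "\<exists>R. correspondence A (annihilator A C \<phi>) C (annihilator C A (\<lambda>c a. \<phi> a c)) R"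
  using assms
proof (induction "index A (annihilator A C \<phi>)" arbitrary: A C rule: less_induct)
  case less
  note p = less.prems(1)
  note q = pairing_mod_Z_swap[OF p]
  define A0 where "A0 = annihilator A C \<phi>"
  define C0 where "C0 = annihilator C A (\<lambda>c a. \<phi> a c)"
  have A: "add_subgroup A" and C: "add_subgroup C"
    using p by (auto simp: pairing_mod_Z_def)
  have A0: "add_subgroup A0" "A0 \<subseteq> A"
    unfolding A0_def by (rule add_subgroup_annihilator[OF p] annihilator_subset)+
  have C0: "add_subgroup C0" "C0 \<subseteq> C"
    unfolding C0_def by (rule add_subgroup_annihilator[OF q] annihilator_subset)+
  have pos: "index A A0 > 0" using less.prems by (simp add: A0_def)
  show ?case
  proof (cases "A = A0")
    case True
    then have "C = C0" by (auto simp: A0_def C0_def annihilator_def)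
    then have "correspondence A A0 C C0 (A \<times> C)"
      using True A C add_subgroup_zero[OF A] add_subgroup_zero[OF C]
      by (auto simp: correspondence_def add_subgroup_diff)
    then show ?thesis by (auto simp: A0_def C0_def)
  next
    case False
    have fin: "zmul (int (index A A0)) a \<in> A0" if "a \<in> A" for a
      by (rule zmul_index_mem[OF A A0 that])
    have ord: "0 < order_mod A0 a" "zmul (int (order_mod A0 a)) a \<in> A0"
      "order_mod A0 a \<le> index A A0" if "a \<in> A" for a
      using order_mod[OF pos fin[OF that]] by auto
    obtain x where x: "x \<in> A" and max: "\<And>a. a \<in> A \<Longrightarrow> order_mod A0 a \<le> order_mod A0 x"
      using ex_has_greatest_nat[of "\<lambda>a. a \<in> A" 0 "order_mod A0" "Suc (index A A0)"]
        ord(3) add_subgroup_zero[OF A] by (auto simp: less_Suc_eq_le)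
    define n where "n = order_mod A0 x"
    have n: "0 < n" "zmul (int n) x \<in> A0" using ord[OF x] by (auto simp: n_def)
    obtain a where a: "a \<in> A" "a \<notin> A0" using False A0 by blast
    then have "order_mod A0 a \<noteq> 1" using ord(2)[of a] by auto
    then have "n > 1" using ord(1)[of a] max[of a] a n_def by linarith
    obtain y where y: "y \<in> C" and xy: "\<phi> x y - 1 / of_nat n \<in> \<int>"
      using pairing_attains_inverse_order[OF p x pos] fin[OF x] by (auto simp: A0_def n_def)
    have finy: "zmul (int (index A A0)) y \<in> C0"
      unfolding C0_def zmul_annihilator_iff[OF q y]
    proof
      fix a assume a: "a \<in> A"
      have "zmul (int (index A A0)) a \<in> annihilator A C \<phi>" using fin[OF a] by (simp add: A0_def)
      then show "of_int (int (index A A0)) * \<phi> a y \<in> \<int>"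
        unfolding zmul_annihilator_iff[OF p a] using y by blast
    qed
    \<comment> \<open>The order \<open>m\<close> of \<open>y\<close> is \<open>n\<close>: some
      \<open>a\<close> has \<open>\<phi> a y = 1 / m\<close> modulo integers, so \<open>m\<close>
      divides the order of \<open>a\<close>, which is at most \<open>n\<close> by maximality;
      conversely \<open>m\<close> kills \<open>\<phi> x y = 1 / n\<close>, so \<open>n\<close>
      divides \<open>m\<close>.\<close>
    have ny: "zmul (int n) y \<in> C0"
    proof -
      define m where "m = order_mod C0 y"
      have m: "0 < m" "zmul (int m) y \<in> C0" using order_mod[OF pos finy] by (auto simp: m_def)
      obtain a where a: "a \<in> A" "\<phi> a y - 1 / of_nat m \<in> \<int>"
        using pairing_attains_inverse_order[OF q y pos] finy by (auto simp: C0_def m_def)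
      let ?k = "order_mod A0 a"
      have "of_nat ?k * \<phi> a y \<in> \<int>"
        using zmul_annihilator_iff[OF p a(1), of "int ?k"] ord(2)[OF a(1)] y by (auto simp: A0_def)
      moreover have "of_nat ?k * \<phi> a y - of_int (int ?k) / of_nat m = of_nat ?k * (\<phi> a y - 1 / of_nat m)"
        by (simp add: algebra_simps)
      then have "of_nat ?k * \<phi> a y - of_int (int ?k) / of_nat m \<in> \<int>" using a(2) by simp
      ultimately have "of_int (int ?k) / of_nat m \<in> (\<int> :: rat set)" using Ints_cong by blast
      from Ints_of_int_div[OF this m(1)] have "m dvd ?k" by simp
      then have "m \<le> n" using dvd_imp_le[of m ?k] ord(1)[OF a(1)] max[OF a(1)] by (simp add: n_def)
      have "of_nat m * \<phi> x y \<in> \<int>"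
        using zmul_annihilator_iff[OF q y, of "int m"] m x by (auto simp: C0_def)
      moreover have "of_nat m * \<phi> x y - of_int (int m) / of_nat n = of_nat m * (\<phi> x y - 1 / of_nat n)"
        by (simp add: algebra_simps)
      then have "of_nat m * \<phi> x y - of_int (int m) / of_nat n \<in> \<int>" using xy by simp
      ultimately have "of_int (int m) / of_nat n \<in> (\<int> :: rat set)" using Ints_cong by blast
      from Ints_of_int_div[OF this n(1)] have "n dvd m" by simp
      then have "m = n" using \<open>m \<le> n\<close> m(1) by (simp add: dvd_imp_le le_antisym)
      then show ?thesis using m by simp
    qed
    define A' where "A' = annihilator A {y} \<phi>"
    define C' where "C' = annihilator C {x} (\<lambda>c a. \<phi> a c)"
    have A': "add_subgroup A'" "A' \<subseteq> A" "A0 \<subseteq> A'"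
      using add_subgroup_annihilator_subset[OF p, of "{y}"] y
      by (auto simp: A'_def A0_def annihilator_def)
    have C': "add_subgroup C'" "C' \<subseteq> C" "C0 \<subseteq> C'"
      using add_subgroup_annihilator_subset[OF q, of "{x}"] x
      by (auto simp: C'_def C0_def annihilator_def)
    have p': "pairing_mod_Z A' C' \<phi>" by (rule pairing_mod_Z_subset[OF p A'(1,2) C'(1,2)])
    have decA: "\<exists>k. a - zmul k x \<in> A'" if a: "a \<in> A" for a
    proof -
      have "of_nat n * \<phi> a y \<in> \<int>"
        using zmul_annihilator_iff[OF q y, of "int n"] ny a by (auto simp: C0_def)
      then show ?thesis
        using pairing_split[OF p x y n(1) xy a] a add_subgroup_zmul[OF A x] A
        by (auto simp: A'_def annihilator_def add_subgroup_diff)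
    qed
    have decC: "\<exists>k. c - zmul k y \<in> C'" if c: "c \<in> C" for c
    proof -
      have "of_nat n * \<phi> x c \<in> \<int>"
        using zmul_annihilator_iff[OF p x, of "int n"] n c by (auto simp: A0_def)
      then show ?thesis
        using pairing_split[OF q y x n(1) xy c] c add_subgroup_zmul[OF C y] C
        by (auto simp: C'_def annihilator_def add_subgroup_diff)
    qed
    \<comment> \<open>\<open>C\<close> is generated by \<open>C'\<close> and \<open>y\<close>, and
      \<open>A'\<close> is orthogonal to \<open>y\<close>, so testing against \<open>C'\<close>
      suffices.\<close>
    have annA: "annihilator A' C' \<phi> = A0"
    proof
      show "A0 \<subseteq> annihilator A' C' \<phi>" using A' C' by (auto simp: A0_def annihilator_def)
      show "annihilator A' C' \<phi> \<subseteq> A0"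
      proof
        fix a assume "a \<in> annihilator A' C' \<phi>"
        then have a: "a \<in> A" "\<phi> a y \<in> \<int>" and aC: "\<And>c. c \<in> C' \<Longrightarrow> \<phi> a c \<in> \<int>"
          by (auto simp: A'_def annihilator_def)
        have "\<phi> a c \<in> \<int>" if c: "c \<in> C" for c
        proof -
          obtain k where k: "c - zmul k y \<in> C'" using decC[OF c] by blast
          have ky: "zmul k y \<in> C" by (rule add_subgroup_zmul[OF C y])
          have "\<phi> a (zmul k y) \<in> \<int>"
            using Ints_cong[OF pairing_zmul_right[OF p a(1) y, of k]] a(2) by simp
          then show ?thesis
            using Ints_cong[OF pairing_diff_right[OF p a(1) c ky]] aC[OF k]
            by (metis Ints_add diff_add_cancel)
        qed
        then show "a \<in> A0" using a by (simp add: A0_def annihilator_def)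
      qed
    qed
    have annC: "annihilator C' A' (\<lambda>c a. \<phi> a c) = C0"
    proof
      show "C0 \<subseteq> annihilator C' A' (\<lambda>c a. \<phi> a c)" using A' C' by (auto simp: C0_def annihilator_def)
      show "annihilator C' A' (\<lambda>c a. \<phi> a c) \<subseteq> C0"
      proof
        fix c assume "c \<in> annihilator C' A' (\<lambda>c a. \<phi> a c)"
        then have c: "c \<in> C" "\<phi> x c \<in> \<int>" and cA: "\<And>a. a \<in> A' \<Longrightarrow> \<phi> a c \<in> \<int>"
          by (auto simp: C'_def annihilator_def)
        have "\<phi> a c \<in> \<int>" if a: "a \<in> A" for a
        proof -
          obtain k where k: "a - zmul k x \<in> A'" using decA[OF a] by blast
          have kx: "zmul k x \<in> A" by (rule add_subgroup_zmul[OF A x])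
          have "\<phi> (zmul k x) c \<in> \<int>"
            using Ints_cong[OF pairing_zmul_left[OF p x c(1), of k]] c(2) by simp
          then show ?thesis
            using Ints_cong[OF pairing_diff_left[OF p a c(1) kx]] cA[OF k]
            by (metis Ints_add diff_add_cancel)
        qed
        then show "c \<in> C0" using c by (simp add: C0_def annihilator_def)
      qed
    qed
    have inv_n: "1 / of_nat n \<notin> (\<int> :: rat set)"
    proof
      assume "1 / of_nat n \<in> (\<int> :: rat set)"
      then have "int n dvd 1" using Ints_of_int_div[of 1 n] n by simp
      then show False using \<open>n > 1\<close> by simp
    qed
    then have "\<phi> x y \<notin> \<int>" using Ints_cong[OF xy] by blast
    then have "x \<notin> A'" by (simp add: A'_def annihilator_def)
    have mult: "index A A0 = index A A' * index A' A0" by (rule index_mult[OF A A'(1) A0(1) A'(3,2)])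
    have "index A A' \<noteq> 1" using index_eq_1_iff[OF A A'(1,2)] x \<open>x \<notin> A'\<close> by blast
    then have "index A' A0 < index A A0" "index A' A0 > 0"
      using mult pos by (cases "index A A'"; cases "index A' A0"; simp)+
    then obtain R' where R': "correspondence A' A0 C' C0 R'"
      using less.hyps[OF _ p'] annA annC by (auto simp: A0_def)
    \<comment> \<open>The sum of \<open>R'\<close> and the relation between \<open>k x\<close> and
      \<open>k y\<close>. It respects cosets because \<open>x\<close> and \<open>y\<close> have the
      same order \<open>n\<close>.\<close>
    define R where "R = {(a + zmul k x, c + zmul k y) | a c k. (a, c) \<in> R'}"
    have "correspondence A A0 C C0 R"
      unfolding correspondence_def
    proof (intro conjI allI impI ballI)
      have R'_sub: "R' \<subseteq> A \<times> C" using R' A' C' unfolding correspondence_def by blast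
      show "R \<subseteq> A \<times> C"
        using R'_sub add_subgroup_zmul[OF A x] add_subgroup_zmul[OF C y]
        by (auto simp: R_def intro!: add_subgroup_add[OF A] add_subgroup_add[OF C])
      fix a c a' c' assume "(a, c) \<in> R" "(a', c') \<in> R"
      then obtain b d k b' d' k' where *: "a = b + zmul k x" "c = d + zmul k y" "(b, d) \<in> R'"
        "a' = b' + zmul k' x" "c' = d' + zmul k' y" "(b', d') \<in> R'"
        by (auto simp: R_def)
      have "(b - b', d - d') \<in> R'" using R' * unfolding correspondence_def by blast
      moreover have "a - a' = (b - b') + zmul (k - k') x" "c - c' = (d - d') + zmul (k - k') y"
        using * by (simp_all add: zmul_diff_left)
      ultimately show "(a - a', c - c') \<in> R" unfolding R_def by blast
    next
      fix a assume "a \<in> A"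
      then obtain k where "a - zmul k x \<in> A'" using decA by blast
      then obtain c where "(a - zmul k x, c) \<in> R'" using R' unfolding correspondence_def by blast
      moreover have "a = (a - zmul k x) + zmul k x" by simp
      ultimately show "\<exists>c. (a, c) \<in> R" unfolding R_def by blast
    next
      fix c assume "c \<in> C"
      then obtain k where "c - zmul k y \<in> C'" using decC by blast
      then obtain a where "(a, c - zmul k y) \<in> R'" using R' unfolding correspondence_def by blast
      moreover have "c = (c - zmul k y) + zmul k y" by simp
      ultimately show "\<exists>a. (a, c) \<in> R" unfolding R_def by blast
    next
      fix a c assume "(a, c) \<in> R"
      then obtain b d k where *: "a = b + zmul k x" "c = d + zmul k y" "(b, d) \<in> R'"
        by (auto simp: R_def)
      have bd: "b \<in> A'" "d \<in> C'" "b \<in> A0 \<longleftrightarrow> d \<in> C0" using R' *(3) unfolding correspondence_def by blast+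
      have dvd: "int n dvd k" if "of_int k * \<phi> x y \<in> \<int>"
      proof (rule Ints_of_int_div[OF _ n(1)])
        have "of_int k * \<phi> x y - of_int k / of_nat n = of_int k * (\<phi> x y - 1 / of_nat n)"
          by (simp add: algebra_simps)
        then have "of_int k * \<phi> x y - of_int k / of_nat n \<in> \<int>" using xy by simp
        then show "of_int k / of_nat n \<in> (\<int> :: rat set)" using Ints_cong that by blast
      qed
      have zx: "zmul k x \<in> A0" and zy: "zmul k y \<in> C0" if "int n dvd k"
        using add_subgroup_dvd_zmul[OF A0(1) n(2) that] add_subgroup_dvd_zmul[OF C0(1) ny that] by auto
      \<comment> \<open>Both \<open>a\<close> and \<open>b\<close> are integral against
        \<open>y\<close>, so \<open>k x\<close> is as well, and \<open>k / n\<close> is an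
        integer.\<close>
      have 1: "int n dvd k" if "a \<in> A0"
      proof (rule dvd)
        have bA: "b \<in> A" "\<phi> b y \<in> \<int>" using bd by (auto simp: A'_def annihilator_def)
        have "\<phi> a y \<in> \<int>" using that y by (auto simp: A0_def annihilator_def)
        moreover have "\<phi> a y - (\<phi> b y + \<phi> (zmul k x) y) \<in> \<int>"
          unfolding *(1) by (rule pairing_add_left[OF p bA(1) y add_subgroup_zmul[OF A x]])
        ultimately have "\<phi> (zmul k x) y \<in> \<int>"
          using bA(2) by (metis Ints_cong add_diff_cancel_left' Ints_diff)
        then show "of_int k * \<phi> x y \<in> \<int>" using Ints_cong[OF pairing_zmul_left[OF p x y]] by blast
      qed
      have 2: "int n dvd k" if "c \<in> C0"
      proof (rule dvd)
        have dC: "d \<in> C" "\<phi> x d \<in> \<int>" using bd by (auto simp: C'_def annihilator_def)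
        have "\<phi> x c \<in> \<int>" using that x by (auto simp: C0_def annihilator_def)
        moreover have "\<phi> x c - (\<phi> x d + \<phi> x (zmul k y)) \<in> \<int>"
          unfolding *(2) by (rule pairing_add_right[OF p x dC(1) add_subgroup_zmul[OF C y]])
        ultimately have "\<phi> x (zmul k y) \<in> \<int>"
          using dC(2) by (metis Ints_cong add_diff_cancel_left' Ints_diff)
        then show "of_int k * \<phi> x y \<in> \<int>" using Ints_cong[OF pairing_zmul_right[OF p x y]] by blast
      qed
      show "a \<in> A0 \<longleftrightarrow> c \<in> C0"
      proof
        assume "a \<in> A0"
        then have "int n dvd k" by (rule 1)
        then show "c \<in> C0"
          using \<open>a \<in> A0\<close> zx zy bd(3) * add_subgroup_cancel_right[OF A0(1)] add_subgroup_cancel_right[OF C0(1)]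
          by metis
      next
        assume "c \<in> C0"
        then have "int n dvd k" by (rule 2)
        then show "a \<in> A0"
          using \<open>c \<in> C0\<close> zx zy bd(3) * add_subgroup_cancel_right[OF A0(1)] add_subgroup_cancel_right[OF C0(1)]
          by metis
      qed
    qed
    then show ?thesis by (auto simp: A0_def C0_def)
  qed
qed

lemma pairing_index:
  assumes "pairing_mod_Z A C \<phi>" and "index A (annihilator A C \<phi>) > 0"
  shows "index A (annihilator A C \<phi>) = index C (annihilator C A (\<lambda>c a. \<phi> a c))"
  using pairing_correspondence[OF assms] correspondence_index
    add_subgroup_annihilator[OF assms(1)] add_subgroup_annihilator[OF pairing_mod_Z_swap[OF assms(1)]]
  by blast

section \<open>Antisymmetric pairings\<close>

lemma square_or_twice_square_mult_square:
  "square_or_twice_square n \<Longrightarrow> square_or_twice_square (n * k\<^sup>2)"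
  unfolding square_or_twice_square_def by (metis mult.assoc power_mult_distrib)

text \<open>The positive numbers in question are those with class \<open>1\<close> or
  \<open>2\<close> modulo rational squares, and these two classes form a group.\<close>

lemma square_or_twice_square_cancel:
  assumes "square_or_twice_square a" "square_or_twice_square (a * b)" "a > 0"
  shows "square_or_twice_square b"
proof -
  have sq: "\<exists>m. c = m\<^sup>2" if "k\<^sup>2 * c = l\<^sup>2" "k > 0" for c k l :: nat
  proof -
    have "k dvd l" using that by (metis dvd_triv_left pow_divides_pow_iff zero_less_numeral)
    then obtain m where "l = k * m" by blast
    then show ?thesis using that by (auto simp: power_mult_distrib)
  qed
  have tw: "\<exists>m. c = 2 * m\<^sup>2" if "2 * c = m\<^sup>2" for c m :: nat
  proof -
    have "even (m\<^sup>2)" using that by (metis dvd_triv_left)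
    then obtain j where "m = 2 * j" by auto
    then have "c = 2 * j\<^sup>2" using that by (simp add: power2_eq_square)
    then show ?thesis by blast
  qed
  obtain k where k: "a = k\<^sup>2 \<or> a = 2 * k\<^sup>2" using assms by (auto simp: square_or_twice_square_def)
  then have "k > 0" using assms(3) by auto
  obtain l where l: "a * b = l\<^sup>2 \<or> a * b = 2 * l\<^sup>2" using assms by (auto simp: square_or_twice_square_def)
  \<comment> \<open>The second and third cases are those in which exactly one of \<open>a\<close>
    and \<open>a * b\<close> is written as twice a square.\<close>
  consider "k\<^sup>2 * b = l\<^sup>2" | "k\<^sup>2 * (2 * b) = l\<^sup>2" | "k\<^sup>2 * (2 * b) = (2 * l)\<^sup>2"
  proof (cases "a = k\<^sup>2")
    case True
    then show ?thesis using l that(1,3) by (auto simp: power_mult_distrib mult.commute)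
  next
    case False
    then have "a = 2 * k\<^sup>2" using k by simp
    then show ?thesis using l that by (auto simp: mult.commute mult.left_commute)
  qed
  then show ?thesis
  proof cases
    case 1
    then show ?thesis using sq[OF _ \<open>k > 0\<close>] by (auto simp: square_or_twice_square_def)
  next
    case 2
    then obtain m where "2 * b = m\<^sup>2" using sq[OF _ \<open>k > 0\<close>] by blast
    then show ?thesis using tw by (auto simp: square_or_twice_square_def)
  next
    case 3
    then obtain m where "2 * b = m\<^sup>2" using sq[OF _ \<open>k > 0\<close>] by blast
    then show ?thesis using tw by (auto simp: square_or_twice_square_def)
  qed
qed

text \<open>Weaker than alternating: \<open>\<phi> x x\<close> may be half an odd integer.\<close>

definition antisymmetric_mod_Z :: "'a set \<Rightarrow> ('a \<Rightarrow> 'a \<Rightarrow> rat) \<Rightarrow> bool" where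
  "antisymmetric_mod_Z T \<phi> \<longleftrightarrow> (\<forall>x\<in>T. \<forall>y\<in>T. \<phi> x y + \<phi> y x \<in> \<int>)"

lemma antisymmetric_mod_Z_swap:
  "antisymmetric_mod_Z T \<phi> \<Longrightarrow> x \<in> T \<Longrightarrow> y \<in> T \<Longrightarrow> \<phi> x y \<in> \<int> \<longleftrightarrow> \<phi> y x \<in> \<int>"
  unfolding antisymmetric_mod_Z_def by (metis Ints_diff add_diff_cancel_left' add_diff_cancel_right')

text \<open>If \<open>x\<close> is isotropic of order \<open>n\<close>, passing to \<open>x\<^sup>\<bottom> / x\<close> divides the order by \<open>n\<^sup>2\<close>. If no
  nonzero element is isotropic, then the homomorphism \<open>x \<mapsto> \<phi> x x\<close> into \<open>(1/2) \<int> / \<int>\<close> is injective.\<close>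

theorem antisymmetric_index:
  assumes "pairing_mod_Z T T \<phi>" "antisymmetric_mod_Z T \<phi>" "index T (annihilator T T \<phi>) > 0"
  shows "square_or_twice_square (index T (annihilator T T \<phi>))"
  using assms
proof (induction "index T (annihilator T T \<phi>)" arbitrary: T rule: less_induct)
  case less
  note p = less.prems(1) and anti = less.prems(2)
  define S where "S = annihilator T T \<phi>"
  have T: "add_subgroup T" by (rule pairing_subgroup_left[OF p])
  have S: "add_subgroup S" "S \<subseteq> T"
    unfolding S_def by (rule add_subgroup_annihilator[OF p] annihilator_subset)+
  have S_iff: "s \<in> S \<longleftrightarrow> s \<in> T \<and> (\<forall>t\<in>T. \<phi> t s \<in> \<int>)" for s
    using antisymmetric_mod_Z_swap[OF anti] by (auto simp: S_def annihilator_def)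
  have pos: "index T S > 0" using less.prems by (simp add: S_def)
  show ?case
  proof (cases "\<exists>x\<in>T - S. \<phi> x x \<in> \<int>")
    case True
    then obtain x where x: "x \<in> T" "x \<notin> S" "\<phi> x x \<in> \<int>" by blast
    have fin: "zmul (int (index T S)) x \<in> annihilator T T \<phi>"
      using zmul_index_mem[OF T S x(1)] by (simp add: S_def)
    define n where "n = order_mod S x"
    have n: "n > 0" "zmul (int n) x \<in> S" using order_mod[OF pos fin] by (auto simp: n_def S_def)
    obtain y where y: "y \<in> T" "\<phi> x y - 1 / of_nat n \<in> \<int>"
      using pairing_attains_inverse_order[OF p x(1) pos fin] by (auto simp: n_def S_def)
    \<comment> \<open>\<open>S' / S\<close> is the cyclic group generated by \<open>x\<close>, and
      \<open>T'\<close> below is its orthogonal complement. Isotropy of \<open>x\<close> is what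
      places \<open>S'\<close> inside \<open>T'\<close>.\<close>
    define S' where "S' = S + range (\<lambda>k. zmul k x)"
    have Zx: "add_subgroup (range (\<lambda>k. zmul k x))"
    proof (rule add_subgroupI)
      show "0 \<in> range (\<lambda>k. zmul k x)" by (metis rangeI zmul_0)
      show "u - v \<in> range (\<lambda>k. zmul k x)" if "u \<in> range (\<lambda>k. zmul k x)" "v \<in> range (\<lambda>k. zmul k x)" for u v
        using that by (auto simp flip: zmul_diff_left)
    qed
    have S': "add_subgroup S'" "S \<subseteq> S'" "S' \<subseteq> T"
      unfolding S'_def using add_subgroup_plus[OF S(1) Zx] subset_plus_left[OF Zx]
        plus_subset_add_subgroup[OF T S(2), of "range (\<lambda>k. zmul k x)"] add_subgroup_zmul[OF T x(1)] by auto
    have S'_mem: "s + zmul k x \<in> S'" if "s \<in> S" for s k unfolding S'_def using that by blast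
    have xS': "x \<in> S'" using S'_mem[OF add_subgroup_zero[OF S(1)], of 1] by simp
    define T' where "T' = annihilator T S' \<phi>"
    have T': "add_subgroup T'" "T' \<subseteq> T"
      unfolding T'_def by (rule add_subgroup_annihilator_subset[OF p S'(3)] annihilator_subset)+
    have T'_iff: "t \<in> T' \<longleftrightarrow> t \<in> T \<and> \<phi> t x \<in> \<int>" for t
    proof
      assume t: "t \<in> T \<and> \<phi> t x \<in> \<int>"
      have "\<phi> t s' \<in> \<int>" if s': "s' \<in> S'" for s'
      proof -
        obtain s k where s: "s \<in> S" "s' = s + zmul k x" using s' unfolding S'_def by (auto elim!: set_plus_elim)
        have "\<phi> t s' - (\<phi> t s + \<phi> t (zmul k x)) \<in> \<int>"
          unfolding s using pairing_add_right[OF p, of t s "zmul k x"] t s(1) S add_subgroup_zmul[OF T x(1)] by blast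
        moreover have "\<phi> t s \<in> \<int>" using s S_iff t by blast
        moreover have "\<phi> t (zmul k x) \<in> \<int>"
          using Ints_cong[OF pairing_zmul_right[OF p _ x(1), of t k]] t by simp
        ultimately show ?thesis using Ints_cong by (metis Ints_add)
      qed
      then show "t \<in> T'" using t by (simp add: T'_def annihilator_def)
    qed (use xS' in \<open>auto simp: T'_def annihilator_def\<close>)
    have S'T': "S' \<subseteq> T'"
    proof
      fix s' assume s': "s' \<in> S'"
      then obtain s k where s: "s \<in> S" "s' = s + zmul k x" unfolding S'_def by (auto elim!: set_plus_elim)
      have "\<phi> s' x - (\<phi> s x + \<phi> (zmul k x) x) \<in> \<int>"
        unfolding s using pairing_add_left[OF p, of s x "zmul k x"] x s(1) S add_subgroup_zmul[OF T x(1)] by blast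
      moreover have "\<phi> s x \<in> \<int>" using s x by (auto simp: S_def annihilator_def)
      moreover have "\<phi> (zmul k x) x \<in> \<int>"
        using Ints_cong[OF pairing_zmul_left[OF p x(1) x(1), of k]] x by simp
      ultimately have "\<phi> s' x \<in> \<int>" using Ints_cong by (metis Ints_add)
      then show "s' \<in> T'" using s' S'(3) by (auto simp: T'_iff)
    qed
    have ann: "annihilator T' T' \<phi> = S'"
    proof
      show "S' \<subseteq> annihilator T' T' \<phi>"
      proof
        fix s assume s: "s \<in> S'"
        have "\<phi> s t \<in> \<int>" if "t \<in> T'" for t
          using antisymmetric_mod_Z_swap[OF anti, of s t] that s S'(3) by (auto simp: T'_def annihilator_def)
        then show "s \<in> annihilator T' T' \<phi>" using s S'T' by (auto simp: annihilator_def)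
      qed
      show "annihilator T' T' \<phi> \<subseteq> S'"
      proof
        fix t assume "t \<in> annihilator T' T' \<phi>"
        then have t: "t \<in> T" "t \<in> T'" and tT': "\<And>u. u \<in> T' \<Longrightarrow> \<phi> t u \<in> \<int>"
          using T'(2) by (auto simp: annihilator_def)
        have nx: "of_nat n * \<phi> x u \<in> \<int>" if "u \<in> T" for u
          using zmul_annihilator_iff[OF p x(1), of "int n"] n that by (simp add: S_def)
        \<comment> \<open>\<open>n y\<close> is orthogonal to \<open>x\<close>, so it lies in
          \<open>T'\<close> and \<open>n\<close> kills \<open>\<phi> t y\<close>. A multiple of
          \<open>x\<close> then corrects \<open>t\<close> to be orthogonal to \<open>y\<close>;
          since \<open>T\<close> is generated by \<open>T'\<close> and \<open>y\<close>, the
          corrected element lies in \<open>S\<close>.\<close>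
        have "\<phi> (zmul (int n) y) x \<in> \<int>"
        proof -
          have "\<phi> x (zmul (int n) y) \<in> \<int>"
            using Ints_cong[OF pairing_zmul_right[OF p x(1) y(1), of "int n"]] nx[OF y(1)] by simp
          then show ?thesis
            using antisymmetric_mod_Z_swap[OF anti x(1) add_subgroup_zmul[OF T y(1)]] by blast
        qed
        then have "\<phi> t (zmul (int n) y) \<in> \<int>"
          using tT' T'_iff add_subgroup_zmul[OF T y(1)] by blast
        then have "of_nat n * \<phi> t y \<in> \<int>"
          using Ints_cong[OF pairing_zmul_right[OF p t(1) y(1), of "int n"]] by simp
        then obtain k where k: "\<phi> (t - zmul k x) y \<in> \<int>"
          using pairing_split[OF p x(1) y(1) n(1) y(2) t(1)] by blast
        let ?t = "t - zmul k x"
        have t': "?t \<in> T" using T t x by (simp add: add_subgroup_diff add_subgroup_zmul)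
        have "\<phi> ?t u \<in> \<int>" if u: "u \<in> T" for u
        proof -
          obtain j where j: "\<phi> x (u - zmul j y) \<in> \<int>"
            using pairing_split[OF pairing_mod_Z_swap[OF p] y(1) x(1) n(1) y(2) u nx[OF u]] by blast
          have u': "u - zmul j y \<in> T" using T u y by (simp add: add_subgroup_diff add_subgroup_zmul)
          then have "u - zmul j y \<in> T'"
            using antisymmetric_mod_Z_swap[OF anti x(1)] j T'_iff by blast
          then have "\<phi> t (u - zmul j y) \<in> \<int>" by (rule tT')
          moreover have "\<phi> (zmul k x) (u - zmul j y) \<in> \<int>"
            using Ints_cong[OF pairing_zmul_left[OF p x(1) u', of k]] j by simp
          ultimately have 1: "\<phi> ?t (u - zmul j y) \<in> \<int>"
            using Ints_cong[OF pairing_diff_left[OF p t(1) u' add_subgroup_zmul[OF T x(1)]]] by (metis Ints_diff)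
          have "\<phi> ?t (zmul j y) \<in> \<int>"
            using Ints_cong[OF pairing_zmul_right[OF p t' y(1), of j]] k by simp
          then show ?thesis
            using Ints_cong[OF pairing_diff_right[OF p t' u add_subgroup_zmul[OF T y(1), of j]]] 1
            by (metis Ints_add diff_add_cancel)
        qed
        then have "?t \<in> S" using t' by (simp add: S_def annihilator_def)
        then show "t \<in> S'" using S'_mem[of ?t k] by simp
      qed
    qed
    have p': "pairing_mod_Z T' T' \<phi>" by (rule pairing_mod_Z_subset[OF p T' T'])
    have anti': "antisymmetric_mod_Z T' \<phi>" using anti T' unfolding antisymmetric_mod_Z_def by blast
    have pS: "pairing_mod_Z S' T \<phi>" by (rule pairing_mod_Z_subset[OF p S'(1,3) T subset_refl])
    have i1: "index T S = index T T' * index T' S" by (rule index_mult[OF T T'(1) S(1) _ T'(2)]) (use S'(2) S'T' in auto)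
    have i2: "index T' S = index T' S' * index S' S" by (rule index_mult[OF T'(1) S'(1) S(1) S'(2) S'T'])
    have ann1: "annihilator S' T \<phi> = S" using S' by (auto simp: S_def annihilator_def)
    have ann2: "annihilator T S' (\<lambda>t s. \<phi> s t) = T'"
      unfolding T'_def annihilator_def using antisymmetric_mod_Z_swap[OF anti] S'(3) by blast
    \<comment> \<open>\<open>S' / S\<close> and \<open>T / T'\<close> are in duality, so the two
      outer factors of the index combine to a square.\<close>
    have eq: "index S' S = index T T'"
      using pairing_index[OF pS] pos i1 i2 by (simp add: ann1 ann2)
    then have i: "index T S = index T' S' * (index S' S)\<^sup>2"
      using i1 i2 by (simp add: power2_eq_square)
    have "index S' S \<noteq> 1" using index_eq_1_iff[OF S'(1) S(1) S'(2)] xS' x by blast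
    moreover have gt0: "index S' S > 0" "index T' S' > 0" using i pos by (auto intro: gr0I)
    ultimately have "index T' S' < index T S" using i
      by (metis One_nat_def Suc_lessI mult.right_neutral nat_mult_less_cancel_disj one_less_power pos2)
    then have "square_or_twice_square (index T' S')"
      using less.hyps[OF _ p' anti'] gt0 ann by (simp add: S_def)
    then show ?thesis using i square_or_twice_square_mult_square by (simp add: S_def)
  next
    case False
    have half: "x - y \<in> S" if "x \<in> T" "y \<in> T" "x \<notin> S" "y \<notin> S" for x y
    proof -
      have h: "\<phi> u u - 1/2 \<in> \<int>" if u: "u \<in> T" "u \<notin> S" for u
      proof -
        have "\<phi> u u + \<phi> u u \<in> \<int>" using anti u unfolding antisymmetric_mod_Z_def by blast
        then obtain k where k: "\<phi> u u + \<phi> u u = of_int k" by (auto elim: Ints_cases)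
        have "odd k"
        proof
          assume "even k"
          then obtain j where "k = 2 * j" by blast
          then have "\<phi> u u \<in> \<int>" using k by simp
          then show False using False u by blast
        qed
        then obtain j where "k = 2 * j + 1" by (elim oddE)
        then have "\<phi> u u - 1/2 = of_int j" using k by (simp add: field_simps)
        then show ?thesis by simp
      qed
      have xy: "x - y \<in> T" using T that by (simp add: add_subgroup_diff)
      \<comment> \<open>Modulo integers this is
        \<open>\<phi> x x + \<phi> y y - (\<phi> x y + \<phi> y x)\<close>, that is
        \<open>1/2 + 1/2\<close>.\<close>
      have "\<phi> (x - y) (x - y) = (\<phi> (x - y) (x - y) - (\<phi> x (x - y) - \<phi> y (x - y)))
          + (\<phi> x (x - y) - (\<phi> x x - \<phi> x y)) - (\<phi> y (x - y) - (\<phi> y x - \<phi> y y))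
          + ((\<phi> x x - 1/2) + (\<phi> y y - 1/2) - (\<phi> x y + \<phi> y x) + 1)"
        by (simp add: algebra_simps)
      also have "\<dots> \<in> \<int>"
        using pairing_diff_left[OF p that(1) xy that(2)] pairing_diff_right[OF p that(1) that(1) that(2)]
          pairing_diff_right[OF p that(2) that(1) that(2)] h[OF that(1,3)] h[OF that(2,4)] anti that(1,2)
        unfolding antisymmetric_mod_Z_def by (metis Ints_add Ints_diff Ints_1)
      finally show ?thesis using False xy by blast
    qed
    have "index T S \<le> 2"
    proof (cases "T = S")
      case True
      then show ?thesis using index_eq_1_iff[OF T S] by simp
    next
      case False
      then obtain x where x: "x \<in> T" "x \<notin> S" using S by blast
      have "coset S t \<in> {S, coset S x}" if "t \<in> T" for t
        using half[OF that x(1) _ x(2)] coset_eq_iff[OF S(1), of t x] coset_eq_iff[OF S(1), of t 0]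
        by (cases "t \<in> S") (auto simp: coset_zero)
      then have "coset S ` T \<subseteq> {S, coset S x}" by blast
      then have "card (coset S ` T) \<le> card {S, coset S x}" by (intro card_mono) auto
      also have "\<dots> \<le> 2" by (simp add: card_insert_if)
      finally show ?thesis by (simp add: index_altdef)
    qed
    then have "index T S = 1\<^sup>2 \<or> index T S = 2 * 1\<^sup>2" using pos by auto
    then show ?thesis unfolding square_or_twice_square_def S_def by blast
  qed
qed

text \<open>\<open>e * \<phi>\<close> is again antisymmetric, and its kernel is the preimage
  \<open>Te\<close> of the \<open>e\<close>-torsion. So both \<open>T / S\<close> and
  \<open>T / Te\<close> have order a square or twice a square, and the order of
  \<open>Te / S\<close> is their quotient.\<close>

lemma antisymmetric_torsion_index:
  assumes p: "pairing_mod_Z T T \<phi>" and anti: "antisymmetric_mod_Z T \<phi>"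
    and S: "annihilator T T \<phi> = S" and pos: "index T S > 0"
  shows "square_or_twice_square (index {t \<in> T. zmul (int e) t \<in> S} S)"
proof -
  define \<psi> where "\<psi> x y = of_nat e * \<phi> x y" for x y
  define Te where "Te = {t \<in> T. zmul (int e) t \<in> S}"
  have scale: "additive_mod_Z T (\<lambda>x. of_nat e * f x)" if "additive_mod_Z T f" for f
    using that unfolding additive_mod_Z_def
    by (metis Ints_mult Ints_of_nat right_diff_distrib distrib_left)
  have p': "pairing_mod_Z T T \<psi>"
    using p scale unfolding pairing_mod_Z_def \<psi>_def[abs_def] by auto
  have anti': "antisymmetric_mod_Z T \<psi>"
    using anti unfolding antisymmetric_mod_Z_def \<psi>_def
    by (metis Ints_mult Ints_of_nat distrib_left)
  have ann: "annihilator T T \<psi> = Te"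
    using zmul_annihilator_iff[OF p, of _ "int e"] unfolding Te_def S[symmetric]
    by (auto simp: annihilator_def[of T T \<psi>] \<psi>_def)
  have T: "add_subgroup T" and sS: "add_subgroup S" "S \<subseteq> T"
    using pairing_subgroup_left[OF p] add_subgroup_annihilator[OF p] annihilator_subset[of T T \<phi>] S by auto
  have Te: "add_subgroup Te" "Te \<subseteq> T" "S \<subseteq> Te"
    using add_subgroup_annihilator[OF p'] ann sS add_subgroup_zmul[OF sS(1)] unfolding Te_def by auto
  have i: "index T S = index T Te * index Te S" by (rule index_mult[OF T Te(1) sS(1) Te(3,2)])
  then have "index T Te > 0" using pos by (auto intro: gr0I)
  moreover have "square_or_twice_square (index T S)" using antisymmetric_index[OF p anti] pos S by simp
  moreover have "square_or_twice_square (index T Te)"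
    using antisymmetric_index[OF p' anti'] \<open>index T Te > 0\<close> ann by simp
  ultimately show ?thesis
    using square_or_twice_square_cancel[of "index T Te" "index Te S"] unfolding i Te_def by blast
qed

lemma torsion_Mod:
  assumes "add_subgroup A" "add_subgroup B" "B \<subseteq> A"
  shows "card (torsion (add_group A Mod B) e) = index {a \<in> A. zmul (int e) a \<in> B} B"
proof -
  have "torsion (add_group A Mod B) e = coset B ` {a \<in> A. zmul (int e) a \<in> B}"
  proof -
    have "coset B a [^]\<^bsub>add_group A Mod B\<^esub> e = \<one>\<^bsub>add_group A Mod B\<^esub> \<longleftrightarrow> zmul (int e) a \<in> B"
      if "a \<in> A" for a
      unfolding pow_Mod[OF assms that] one_Mod
      using coset_eq_iff[OF assms(2), of "zmul (int e) a" 0] by (simp only: coset_zero diff_zero)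
    then show ?thesis unfolding torsion_def carrier_Mod by blast
  qed
  then show ?thesis by (simp add: index_altdef)
qed

text \<open>The functions on \<open>T\<close> inducing characters of \<open>T / S\<close> are paired with \<open>T\<close> by evaluation,
  so there are at most \<open>|T / S|\<close> of them modulo \<open>\<int>\<close>.\<close>

lemma character_represented:
  assumes p: "pairing_mod_Z T T \<phi>" and anti: "antisymmetric_mod_Z T \<phi>"
    and S: "annihilator T T \<phi> = S" and pos: "index T S > 0"
    and f: "additive_mod_Z T f" "\<And>s. s \<in> S \<Longrightarrow> f s \<in> \<int>"
  shows "\<exists>x\<in>T. \<forall>t\<in>T. f t - \<phi> x t \<in> \<int>"
proof -
  have T: "add_subgroup T" by (rule pairing_subgroup_left[OF p])
  define D where "D = {f. additive_mod_Z T f \<and> (\<forall>s\<in>S. f s \<in> \<int>)}"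
  have D: "add_subgroup D"
  proof (rule add_subgroupI)
    show "0 \<in> D" by (simp add: D_def additive_mod_Z_def)
    fix g h assume gh: "g \<in> D" "h \<in> D"
    have "(g - h) (x + y) - ((g - h) x + (g - h) y) \<in> \<int>" if "x \<in> T" "y \<in> T" for x y
    proof -
      have "g (x + y) - (g x + g y) \<in> \<int>" "h (x + y) - (h x + h y) \<in> \<int>"
        using gh that by (auto simp: D_def additive_mod_Z_def)
      from Ints_diff[OF this] show ?thesis by (simp add: algebra_simps)
    qed
    then show "g - h \<in> D" using gh by (auto simp: D_def additive_mod_Z_def)
  qed
  have ev: "pairing_mod_Z T D (\<lambda>t g. g t)"
    using T D by (auto simp: pairing_mod_Z_def D_def additive_mod_Z_def)
  have swap: "\<phi> x t \<in> \<int> \<longleftrightarrow> \<phi> t x \<in> \<int>" if "x \<in> T" "t \<in> T" for x t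
    by (rule antisymmetric_mod_Z_swap[OF anti that])
  have \<phi>D: "\<phi> x \<in> D" if "x \<in> T" for x
    using pairing_right[OF p that] swap that S by (auto simp: D_def annihilator_def)
  have ann: "annihilator T D (\<lambda>t g. g t) = S"
  proof
    show "annihilator T D (\<lambda>t g. g t) \<subseteq> S"
      using \<phi>D swap S unfolding annihilator_def by blast
    show "S \<subseteq> annihilator T D (\<lambda>t g. g t)" using S by (auto simp: annihilator_def D_def)
  qed
  define D0 where "D0 = annihilator D T (\<lambda>g t. g t)"
  have D0: "add_subgroup D0" "D0 \<subseteq> D"
    unfolding D0_def by (rule add_subgroup_annihilator[OF pairing_mod_Z_swap[OF ev]] annihilator_subset)+
  have i0: "index T S = index D D0" using pairing_index[OF ev] ann pos by (simp add: D0_def)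
  \<comment> \<open>The characters given by elements of \<open>T\<close> already number
    \<open>|T / S|\<close>, because \<open>x\<close> gives the trivial one only for
    \<open>x \<in> S\<close>. This leaves no room for others.\<close>
  define D1 where "D1 = {g \<in> D. \<exists>x\<in>T. \<forall>t\<in>T. g t - \<phi> x t \<in> \<int>}"
  have D1: "add_subgroup D1"
  proof (rule add_subgroupI)
    show "0 \<in> D1"
      using add_subgroup_zero[OF D] add_subgroup_zero[OF T] pairing_zero_left[OF p]
      by (auto simp: D1_def intro!: bexI[of _ 0])
    fix g h assume "g \<in> D1" "h \<in> D1"
    then obtain x y where xy: "x \<in> T" "y \<in> T" "\<And>t. t \<in> T \<Longrightarrow> g t - \<phi> x t \<in> \<int>"
      "\<And>t. t \<in> T \<Longrightarrow> h t - \<phi> y t \<in> \<int>" and gh: "g \<in> D" "h \<in> D" by (auto simp: D1_def)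
    have "(g - h) t - \<phi> (x - y) t \<in> \<int>" if t: "t \<in> T" for t
    proof -
      have "(g t - \<phi> x t) - (h t - \<phi> y t) - (\<phi> (x - y) t - (\<phi> x t - \<phi> y t)) \<in> \<int>"
        by (intro Ints_diff xy(3,4) t pairing_diff_left[OF p xy(1) t xy(2)])
      then show ?thesis by (simp add: algebra_simps)
    qed
    then show "g - h \<in> D1"
      using xy gh add_subgroup_diff[OF D] add_subgroup_diff[OF T xy(1,2)] unfolding D1_def by blast
  qed
  have D1_sub: "D1 \<subseteq> D" and D0_sub: "D0 \<subseteq> D1"
    using pairing_zero_left[OF p] add_subgroup_zero[OF T]
    by (auto simp: D1_def D0_def annihilator_def intro!: bexI[of _ 0])
  have sS: "add_subgroup S" using add_subgroup_annihilator[OF p] S by simp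
  have i1: "index T S = index D1 D0"
  proof (rule index_eqI[where f = \<phi>])
    show "\<phi> a \<in> D1" if "a \<in> T" for a using that \<phi>D by (auto simp: D1_def intro!: bexI[of _ a])
    show "\<phi> a - \<phi> b \<in> D0 \<longleftrightarrow> a - b \<in> S" if "a \<in> T" "b \<in> T" for a b
      using Ints_cong[OF pairing_diff_left[OF p that(1) _ that(2)]] that \<phi>D add_subgroup_diff[OF D]
        add_subgroup_diff[OF T]
      unfolding D0_def S[symmetric] by (auto simp: annihilator_def)
    show "\<exists>a\<in>T. \<phi> a - g \<in> D0" if g: "g \<in> D1" for g
    proof -
      obtain x where x: "x \<in> T" "\<And>t. t \<in> T \<Longrightarrow> g t - \<phi> x t \<in> \<int>" using g by (auto simp: D1_def)
      have "\<phi> x t - g t \<in> \<int>" if "t \<in> T" for t using Ints_minus[OF x(2)[OF that]] by simp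
      then show ?thesis
        using x g \<phi>D add_subgroup_diff[OF D] D1_sub by (auto simp: D0_def annihilator_def intro!: bexI[of _ x])
    qed
  qed (use sS D0 in auto)
  have "index D D0 = index D D1 * index D1 D0" by (rule index_mult[OF D D1 D0(1) D0_sub D1_sub])
  then have "index D D1 = 1" using i0 i1 pos by simp
  then have "D = D1" using index_eq_1_iff[OF D D1 D1_sub] by simp
  moreover have "f \<in> D" using f by (simp add: D_def)
  ultimately show ?thesis by (auto simp: D1_def)
qed

section \<open>From rational lifts back to homomorphisms into the rationals modulo the
  integers\<close>

lemma comm_group_rat_mod_int: "comm_group rat_mod_int"
  unfolding rat_mod_int_def by (rule comm_group_Mod[OF add_subgroup_UNIV add_subgroup_Ints]) simp

lemma mult_rat_mod_int: "coset \<int> x \<otimes>\<^bsub>rat_mod_int\<^esub> coset \<int> y = coset \<int> (x + y)"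
  unfolding rat_mod_int_def by (rule mult_Mod[OF add_subgroup_UNIV add_subgroup_Ints]) auto

lemma carrier_rat_mod_int: "carrier rat_mod_int = range (coset \<int>)"
  unfolding rat_mod_int_def carrier_Mod ..

lemma inv_rat_mod_int: "inv\<^bsub>rat_mod_int\<^esub> (coset \<int> x) = coset \<int> (- x)"
proof -
  interpret comm_group rat_mod_int by (rule comm_group_rat_mod_int)
  show ?thesis
  proof (rule inv_equality)
    have "\<one>\<^bsub>rat_mod_int\<^esub> = coset \<int> 0" by (simp add: rat_mod_int_def one_Mod coset_zero)
    then show "coset \<int> (- x) \<otimes>\<^bsub>rat_mod_int\<^esub> coset \<int> x = \<one>\<^bsub>rat_mod_int\<^esub>"
      by (simp add: mult_rat_mod_int)
  qed (auto simp: carrier_rat_mod_int)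
qed

text \<open>Injectivity holds because the annihilator is divided out, surjectivity is
  \<open>character_represented\<close>, and antisymmetry transfers both to the other
  argument.\<close>

theorem perfect_pairing_Mod:
  assumes p: "pairing_mod_Z T T \<phi>" and anti: "antisymmetric_mod_Z T \<phi>"
    and S: "annihilator T T \<phi> = S" and pos: "index T S > 0"
  shows "\<exists>\<Phi>. perfect_pairing (add_group T Mod S) \<Phi> \<and> antisymmetric_pairing (add_group T Mod S) \<Phi>"
proof -
  have T: "add_subgroup T" and sS: "add_subgroup S" "S \<subseteq> T"
    using pairing_subgroup_left[OF p] add_subgroup_annihilator[OF p] annihilator_subset[of T T \<phi>] S by auto
  let ?G = "add_group T Mod S"
  define rep where "rep X = (SOME a. a \<in> T \<and> coset S a = X)" for X
  have rep: "rep (coset S a) \<in> T" "a - rep (coset S a) \<in> S" if "a \<in> T" for a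
  proof -
    have "rep (coset S a) \<in> T \<and> coset S (rep (coset S a)) = coset S a"
      unfolding rep_def by (rule someI[of _ a]) (use that in auto)
    then show "rep (coset S a) \<in> T" "a - rep (coset S a) \<in> S" using coset_eq_iff[OF sS(1)] by metis+
  qed
  define \<Phi> where "\<Phi> X Y = coset \<int> (\<phi> (rep X) (rep Y))" for X Y
  have \<Phi>: "\<Phi> (coset S x) (coset S y) = coset \<int> (\<phi> x y)" if xy: "x \<in> T" "y \<in> T" for x y
  proof -
    let ?x = "rep (coset S x)" and ?y = "rep (coset S y)"
    have 1: "\<phi> (x - ?x) y \<in> \<int>" using rep(2)[OF xy(1)] xy S by (auto simp: annihilator_def)
    have "\<phi> (y - ?y) ?x \<in> \<int>" using rep(2)[OF xy(2)] rep(1)[OF xy(1)] S by (auto simp: annihilator_def)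
    then have 2: "\<phi> ?x (y - ?y) \<in> \<int>"
      using antisymmetric_mod_Z_swap[OF anti] rep xy T by (metis add_subgroup_diff)
    have "\<phi> ?x ?y - \<phi> x y = (\<phi> (x - ?x) y - (\<phi> x y - \<phi> ?x y)) - \<phi> (x - ?x) y
        + (\<phi> ?x (y - ?y) - (\<phi> ?x y - \<phi> ?x ?y)) - \<phi> ?x (y - ?y)" by simp
    also have "\<dots> \<in> \<int>"
      by (intro Ints_add Ints_diff 1 2 pairing_diff_left[OF p xy(1) xy(2) rep(1)[OF xy(1)]]
          pairing_diff_right[OF p rep(1)[OF xy(1)] xy(2) rep(1)[OF xy(2)]])
    finally show ?thesis by (simp add: \<Phi>_def coset_eq_iff[OF add_subgroup_Ints])
  qed
  note cosetZ = coset_eq_iff[OF add_subgroup_Ints]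
  have hom1: "\<Phi> (coset S x) \<in> hom ?G rat_mod_int" if x: "x \<in> T" for x
  proof (rule homI)
    show "\<Phi> (coset S x) Y \<in> carrier rat_mod_int" for Y by (simp add: \<Phi>_def carrier_rat_mod_int)
    fix Y Z assume "Y \<in> carrier ?G" "Z \<in> carrier ?G"
    then obtain y z where yz: "y \<in> T" "z \<in> T" "Y = coset S y" "Z = coset S z" by (auto simp: carrier_Mod)
    have "\<Phi> (coset S x) (coset S (y + z)) = coset \<int> (\<phi> x (y + z))"
      by (rule \<Phi>[OF x add_subgroup_add[OF T yz(1,2)]])
    also have "\<dots> = coset \<int> (\<phi> x y + \<phi> x z)"
      by (simp only: cosetZ pairing_add_right[OF p x yz(1,2)])
    finally show "\<Phi> (coset S x) (Y \<otimes>\<^bsub>?G\<^esub> Z) = \<Phi> (coset S x) Y \<otimes>\<^bsub>rat_mod_int\<^esub> \<Phi> (coset S x) Z"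
      unfolding yz mult_Mod[OF T sS yz(1,2)] \<Phi>[OF x yz(1)] \<Phi>[OF x yz(2)] mult_rat_mod_int .
  qed
  have hom2: "(\<lambda>X. \<Phi> X (coset S x)) \<in> hom ?G rat_mod_int" if x: "x \<in> T" for x
  proof (rule homI)
    show "\<Phi> Y (coset S x) \<in> carrier rat_mod_int" for Y by (simp add: \<Phi>_def carrier_rat_mod_int)
    fix Y Z assume "Y \<in> carrier ?G" "Z \<in> carrier ?G"
    then obtain y z where yz: "y \<in> T" "z \<in> T" "Y = coset S y" "Z = coset S z" by (auto simp: carrier_Mod)
    have "\<Phi> (coset S (y + z)) (coset S x) = coset \<int> (\<phi> (y + z) x)"
      by (rule \<Phi>[OF add_subgroup_add[OF T yz(1,2)] x])
    also have "\<dots> = coset \<int> (\<phi> y x + \<phi> z x)"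
      by (simp only: cosetZ pairing_add_left[OF p yz(1) x yz(2)])
    finally show "\<Phi> (Y \<otimes>\<^bsub>?G\<^esub> Z) (coset S x) = \<Phi> Y (coset S x) \<otimes>\<^bsub>rat_mod_int\<^esub> \<Phi> Z (coset S x)"
      unfolding yz mult_Mod[OF T sS yz(1,2)] \<Phi>[OF yz(1) x] \<Phi>[OF yz(2) x] mult_rat_mod_int .
  qed
  have antiP: "antisymmetric_pairing ?G \<Phi>"
    unfolding antisymmetric_pairing_def
  proof (intro ballI)
    fix X Y assume "X \<in> carrier ?G" "Y \<in> carrier ?G"
    then obtain x y where xy: "x \<in> T" "y \<in> T" "X = coset S x" "Y = coset S y" by (auto simp: carrier_Mod)
    have "\<phi> x y - (- \<phi> y x) \<in> \<int>" using anti xy by (simp add: antisymmetric_mod_Z_def)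
    then show "\<Phi> X Y = inv\<^bsub>rat_mod_int\<^esub> (\<Phi> Y X)"
      unfolding xy \<Phi>[OF xy(1,2)] \<Phi>[OF xy(2,1)] inv_rat_mod_int cosetZ .
  qed
  \<comment> \<open>The values of \<open>h\<close> are lifted to rationals one by one, so
    \<open>f\<close> is additive only modulo \<int>.\<close>
  have lift: "\<exists>x\<in>T. \<forall>t\<in>T. h (coset S t) = coset \<int> (\<phi> x t)" if h: "h \<in> hom ?G rat_mod_int" for h
  proof -
    have "\<forall>t\<in>T. \<exists>q. h (coset S t) = coset \<int> q"
    proof
      fix t assume "t \<in> T"
      then have "h (coset S t) \<in> carrier rat_mod_int"
        by (intro hom_in_carrier[OF h]) (auto simp: carrier_Mod)
      then show "\<exists>q. h (coset S t) = coset \<int> q" unfolding carrier_rat_mod_int by blast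
    qed
    then obtain f where f: "\<And>t. t \<in> T \<Longrightarrow> h (coset S t) = coset \<int> (f t)" by metis
    have add: "f (t + u) - (f t + f u) \<in> \<int>" if tu: "t \<in> T" "u \<in> T" for t u
    proof -
      have "h (coset S t \<otimes>\<^bsub>?G\<^esub> coset S u) = h (coset S t) \<otimes>\<^bsub>rat_mod_int\<^esub> h (coset S u)"
        by (rule hom_mult[OF h]) (use tu in \<open>auto simp: carrier_Mod\<close>)
      then have "coset \<int> (f (t + u)) = coset \<int> (f t + f u)"
        unfolding mult_Mod[OF T sS tu] f[OF tu(1)] f[OF tu(2)] f[OF add_subgroup_add[OF T tu]] mult_rat_mod_int .
      then show ?thesis by (simp only: cosetZ)
    qed
    then have fadd: "additive_mod_Z T f" by (simp add: additive_mod_Z_def)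
    have "f s \<in> \<int>" if s: "s \<in> S" for s
    proof -
      have "coset S s = coset S 0" using s by (simp add: coset_eq_iff[OF sS(1)])
      then have "coset \<int> (f s) = coset \<int> (f 0)" using f s sS add_subgroup_zero[OF T] by (metis subsetD)
      then have "f s - f 0 \<in> \<int>" by (simp only: cosetZ)
      then show ?thesis using Ints_cong additive_mod_Z_zero[OF T fadd] by blast
    qed
    then obtain x where "x \<in> T" "\<forall>t\<in>T. f t - \<phi> x t \<in> \<int>"
      using character_represented[OF p anti S pos fadd] by blast
    then show ?thesis using f cosetZ by metis
  qed
  have bij1: "bij_betw (\<lambda>x. restrict (\<Phi> x) (carrier ?G)) (carrier ?G) (hom ?G rat_mod_int \<inter> extensional (carrier ?G))"
  proof (rule bij_betwI')
    fix X Y assume "X \<in> carrier ?G" "Y \<in> carrier ?G"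
    then obtain x y where xy: "x \<in> T" "y \<in> T" "X = coset S x" "Y = coset S y" by (auto simp: carrier_Mod)
    show "restrict (\<Phi> X) (carrier ?G) = restrict (\<Phi> Y) (carrier ?G) \<longleftrightarrow> X = Y"
    proof
      assume eq: "restrict (\<Phi> X) (carrier ?G) = restrict (\<Phi> Y) (carrier ?G)"
      have "\<phi> (x - y) t \<in> \<int>" if t: "t \<in> T" for t
      proof -
        have "\<Phi> X (coset S t) = \<Phi> Y (coset S t)"
          using fun_cong[OF eq, of "coset S t"] t by (simp add: carrier_Mod)
        then have "\<phi> x t - \<phi> y t \<in> \<int>" unfolding xy \<Phi>[OF xy(1) t] \<Phi>[OF xy(2) t] by (simp only: cosetZ)
        then show ?thesis using Ints_cong[OF pairing_diff_left[OF p xy(1) t xy(2)]] by blast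
      qed
      then have "x - y \<in> S" using S add_subgroup_diff[OF T xy(1,2)] by (auto simp: annihilator_def)
      then show "X = Y" unfolding xy coset_eq_iff[OF sS(1)] .
    qed simp
  next
    fix X assume "X \<in> carrier ?G"
    then obtain x where x: "x \<in> T" "X = coset S x" by (auto simp: carrier_Mod)
    have "comm_group ?G" by (rule comm_group_Mod[OF T sS])
    then interpret G: comm_group ?G .
    show "restrict (\<Phi> X) (carrier ?G) \<in> hom ?G rat_mod_int \<inter> extensional (carrier ?G)"
      using G.hom_restrict[OF hom1[OF x(1)], of "restrict (\<Phi> X) (carrier ?G)"] x(2) by simp
  next
    fix h assume h: "h \<in> hom ?G rat_mod_int \<inter> extensional (carrier ?G)"
    then obtain x where x: "x \<in> T" "\<forall>t\<in>T. h (coset S t) = coset \<int> (\<phi> x t)" using lift by blast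
    have "h = restrict (\<Phi> (coset S x)) (carrier ?G)"
      by (rule extensionalityI[of _ "carrier ?G"]) (use h x \<Phi>[OF x(1)] in \<open>auto simp: carrier_Mod\<close>)
    then show "\<exists>X\<in>carrier ?G. h = restrict (\<Phi> X) (carrier ?G)" using x by (auto simp: carrier_Mod)
  qed
  have bij2: "bij_betw (\<lambda>Y. restrict (\<lambda>X. \<Phi> X Y) (carrier ?G)) (carrier ?G) (hom ?G rat_mod_int \<inter> extensional (carrier ?G))"
  proof -
    interpret G: comm_group ?G by (rule comm_group_Mod[OF T sS])
    interpret R: comm_group rat_mod_int by (rule comm_group_rat_mod_int)
    \<comment> \<open>By antisymmetry, pairing with \<open>Y\<close> on the right is pairing with
      the inverse of \<open>Y\<close> on the left, and inversion permutes the group.\<close>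
    have "\<Phi> (inv\<^bsub>?G\<^esub> Y) X = \<Phi> X Y" if "X \<in> carrier ?G" "Y \<in> carrier ?G" for X Y
    proof -
      have "(\<lambda>Y. \<Phi> Y X) \<in> hom ?G rat_mod_int" using hom2 that(1) unfolding carrier_Mod by blast
      then have "group_hom ?G rat_mod_int (\<lambda>Y. \<Phi> Y X)"
        by (rule group_hom.intro[OF G.is_group R.is_group group_hom_axioms.intro])
      then have "\<Phi> (inv\<^bsub>?G\<^esub> Y) X = inv\<^bsub>rat_mod_int\<^esub> (\<Phi> Y X)" by (rule group_hom.hom_inv[OF _ that(2)])
      moreover have "\<Phi> X Y = inv\<^bsub>rat_mod_int\<^esub> (\<Phi> Y X)"
        using antiP that unfolding antisymmetric_pairing_def by blast
      ultimately show ?thesis by (simp only:)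
    qed
    then have eq: "restrict (\<Phi> (inv\<^bsub>?G\<^esub> Y)) (carrier ?G) = restrict (\<lambda>X. \<Phi> X Y) (carrier ?G)"
      if "Y \<in> carrier ?G" for Y using that by (intro restrict_ext) blast
    have "bij_betw (\<lambda>Y. inv\<^bsub>?G\<^esub> Y) (carrier ?G) (carrier ?G)"
      by (rule bij_betw_byWitness[where f' = "\<lambda>Y. inv\<^bsub>?G\<^esub> Y"]) (use G.inv_inv G.inv_closed in blast)+
    from bij_betw_trans[OF this bij1] show ?thesis
      by (rule iffD1[OF bij_betw_cong, rotated]) (simp only: comp_def eq)
  qed
  have "perfect_pairing ?G \<Phi>"
    unfolding perfect_pairing_def using bij1 bij2 hom1 hom2 unfolding carrier_Mod by blast
  then show ?thesis using antiP by blast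
qed

section \<open>Indices and determinants\<close>

lemma index_int_multiples:
  assumes "g \<noteq> 0" shows "index (UNIV :: int set) {k. g dvd k} = nat \<bar>g\<bar>"
proof -
  have sub: "add_subgroup {k. g dvd k}" by (auto intro: add_subgroupI)
  have "coset {k. g dvd k} x \<in> coset {k. g dvd k} ` {0..<\<bar>g\<bar>}" for x
  proof -
    have "g dvd x - x mod \<bar>g\<bar>" by (simp add: minus_mod_eq_mult_div)
    then have "coset {k. g dvd k} x = coset {k. g dvd k} (x mod \<bar>g\<bar>)" by (simp add: coset_eq_iff[OF sub])
    then show ?thesis using assms by auto
  qed
  then have "range (coset {k. g dvd k}) = coset {k. g dvd k} ` {0..<\<bar>g\<bar>}" by blast
  moreover have "inj_on (coset {k. g dvd k}) {0..<\<bar>g\<bar>}"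
  proof (rule inj_onI)
    fix x y assume "x \<in> {0..<\<bar>g\<bar>}" "y \<in> {0..<\<bar>g\<bar>}" "coset {k. g dvd k} x = coset {k. g dvd k} y"
    then have "\<bar>g\<bar> dvd x - y" "\<bar>x - y\<bar> < \<bar>g\<bar>" by (auto simp: coset_eq_iff[OF sub])
    then show "x = y" using zdvd_imp_le[of "\<bar>g\<bar>" "\<bar>x - y\<bar>"] by force
  qed
  ultimately show ?thesis by (simp add: index_altdef card_image)
qed

section \<open>The index of the column lattice of an integer matrix\<close>

locale rat_lattice = vector_space scale
  for scale :: "rat \<Rightarrow> 'v::ab_group_add \<Rightarrow> 'v" (infixr \<open>*s\<close> 75) +
  fixes d :: nat and b :: "nat \<Rightarrow> 'v" and L :: "'v set"
  assumes lattice: "lattice_basis scale d b L"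
begin

lemma basis: "inj_on b {..<d}" "independent (b ` {..<d})" "span (b ` {..<d}) = UNIV"
  and L_def: "L = range (\<lambda>c :: nat \<Rightarrow> int. \<Sum>i<d. of_int (c i) *s b i)"
  using lattice by (auto simp: lattice_basis_def)

definition coord :: "nat \<Rightarrow> 'v \<Rightarrow> rat" where
  "coord i v = representation (b ` {..<d}) v (b i)"

lemma coord_add: "coord i (u + v) = coord i u + coord i v"
  and coord_diff: "coord i (u - v) = coord i u - coord i v"
  and coord_scale: "coord i (q *s v) = q * coord i v"
  and coord_sum: "coord i (sum f I) = (\<Sum>j\<in>I. coord i (f j))"
  using basis by (simp_all add: coord_def representation_add representation_diff representation_scale
      representation_sum)

lemma coord_basis: "i < d \<Longrightarrow> j < d \<Longrightarrow> coord i (b j) = (if i = j then 1 else 0)"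
  using basis by (auto simp: coord_def representation_basis inj_on_eq_iff)

lemma coord_combination:
  assumes "i < d" shows "coord i (\<Sum>j<d. c j *s b j) = c i"
proof -
  have "coord i (\<Sum>j<d. c j *s b j) = (\<Sum>j<d. if i = j then c j else 0)"
    unfolding coord_sum coord_scale by (rule sum.cong) (use assms in \<open>auto simp: coord_basis\<close>)
  then show ?thesis using assms by simp
qed

lemma expansion: "v = (\<Sum>i<d. coord i v *s b i)"
proof -
  have "(\<Sum>x\<in>b ` {..<d}. representation (b ` {..<d}) v x *s x) = v"
    by (rule sum_representation_eq) (use basis in auto)
  then show ?thesis by (simp add: sum.reindex[OF basis(1)] coord_def)
qed

definition zspan :: "nat \<Rightarrow> (nat \<Rightarrow> 'v) \<Rightarrow> 'v set" where
  "zspan n a = range (\<lambda>c :: nat \<Rightarrow> int. \<Sum>i<n. of_int (c i) *s a i)"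

lemma L_zspan: "L = zspan d b"
  by (simp add: L_def zspan_def)

lemma zmul_scale: "zmul k v = of_int k *s v"
  by (induction k rule: int_induct[where k = 0])
    (auto simp: zmul_add_left zmul_diff_left scale_left_distrib scale_left_diff_distrib)

lemma add_subgroup_zspan: "add_subgroup (zspan n a)"
proof (rule add_subgroupI)
  show "0 \<in> zspan n a" unfolding zspan_def by (rule range_eqI[of _ _ "\<lambda>_. 0"]) simp
  fix x y assume "x \<in> zspan n a" "y \<in> zspan n a"
  then obtain c e :: "nat \<Rightarrow> int"
    where "x = (\<Sum>i<n. of_int (c i) *s a i)" "y = (\<Sum>i<n. of_int (e i) *s a i)" by (auto simp: zspan_def)
  then show "x - y \<in> zspan n a" unfolding zspan_def
    by (intro range_eqI[of _ _ "\<lambda>i. c i - e i"]) (simp add: scale_left_diff_distrib sum_subtractf)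
qed

lemma zspan_base: "i < n \<Longrightarrow> a i \<in> zspan n a"
proof -
  assume i: "i < n"
  have "(\<Sum>j<n. of_int (if j = i then 1 else 0) *s a j) = (\<Sum>j<n. if j = i then a j else 0)"
    by (rule sum.cong) auto
  also have "\<dots> = a i" using i by simp
  finally have "a i = (\<Sum>j<n. of_int (if j = i then 1 else 0) *s a j)" by (rule sym)
  then show ?thesis unfolding zspan_def by (rule range_eqI[where x = "\<lambda>j. if j = i then 1 else 0"])
qed

lemma zspan_least:
  assumes "add_subgroup M" "\<And>i. i < n \<Longrightarrow> a i \<in> M" shows "zspan n a \<subseteq> M"
proof
  fix x assume "x \<in> zspan n a"
  then obtain c :: "nat \<Rightarrow> int" where x: "x = (\<Sum>i<n. of_int (c i) *s a i)" by (auto simp: zspan_def)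
  have "(\<Sum>i<k. of_int (c i) *s a i) \<in> M" if "k \<le> n" for k
    using that
  proof (induction k)
    case 0
    then show ?case using assms(1) by (simp add: add_subgroup_zero)
  next
    case (Suc k)
    then show ?case
      using assms add_subgroup_zmul[OF assms(1), of "a k" "c k"]
      by (simp add: zmul_scale add_subgroup_add)
  qed
  then show "x \<in> M" using x by simp
qed

lemma zspan_Suc: "zspan (Suc n) a = zspan n a + range (\<lambda>k. of_int k *s a n)"
proof
  show "zspan (Suc n) a \<subseteq> zspan n a + range (\<lambda>k. of_int k *s a n)"
    unfolding zspan_def by (auto intro!: set_plus_intro)
  have "of_int k *s a n \<in> zspan (Suc n) a" for k
    using add_subgroup_zmul[OF add_subgroup_zspan zspan_base[of n "Suc n" a], of k] by (simp add: zmul_scale)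
  moreover have "zspan n a \<subseteq> zspan (Suc n) a"
    by (rule zspan_least[OF add_subgroup_zspan]) (simp add: zspan_base)
  ultimately show "zspan n a + range (\<lambda>k. of_int k *s a n) \<subseteq> zspan (Suc n) a"
    by (intro plus_subset_add_subgroup[OF add_subgroup_zspan]) auto
qed

text \<open>A column read as a vector in the span of the first \<open>n\<close> basis vectors. The
  size \<open>n\<close> varies because the index formula is proved by induction on leading
  blocks.\<close>

definition column :: "nat \<Rightarrow> int mat \<Rightarrow> nat \<Rightarrow> 'v" where
  "column n A j = (\<Sum>i<n. of_int (A $$ (i, j)) *s b i)"

lemma zspan_column_addcol:
  assumes A: "A \<in> carrier_mat n n" and jk: "j < n" "k < n" "j \<noteq> k"
  shows "zspan n (column n (addcol s k j A)) = zspan n (column n A)"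
proof -
  let ?B = "addcol s k j A"
  have col: "column n ?B i = (if i = k then column n A k + of_int s *s column n A j else column n A i)"
    if "i < n" for i
    using A jk that
    by (auto simp: column_def scale_sum_right sum.distrib[symmetric] scale_left_distrib algebra_simps intro!: sum.cong)
  have A_in: "column n A i \<in> zspan n (column n A)" if "i < n" for i by (rule zspan_base[OF that])
  have B_in: "column n ?B i \<in> zspan n (column n ?B)" if "i < n" for i by (rule zspan_base[OF that])
  have "column n ?B i \<in> zspan n (column n A)" if "i < n" for i
    using col[OF that] A_in jk that add_subgroup_zmul[OF add_subgroup_zspan A_in[OF jk(1)], of s]
    by (simp add: zmul_scale add_subgroup_add[OF add_subgroup_zspan])
  moreover have "column n A i \<in> zspan n (column n ?B)" if "i < n" for i
  proof (cases "i = k")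
    case True
    have "column n ?B k - of_int s *s column n ?B j \<in> zspan n (column n ?B)"
      using add_subgroup_zmul[OF add_subgroup_zspan B_in[OF jk(1)], of s] B_in[OF jk(2)]
      by (simp add: zmul_scale add_subgroup_diff[OF add_subgroup_zspan])
    then show ?thesis using col[OF jk(1)] col[OF jk(2)] jk True by simp
  qed (use col[OF that] B_in[OF that] in simp)
  ultimately show ?thesis
    by (intro equalityI zspan_least add_subgroup_zspan)
qed

lemma zspan_column_swapcols:
  assumes A: "A \<in> carrier_mat n n" and jk: "j < n" "k < n"
  shows "zspan n (column n (swapcols j k A)) = zspan n (column n A)"
proof -
  let ?B = "swapcols j k A"
  have col: "column n ?B i = column n A (if i = j then k else if i = k then j else i)" if "i < n" for i
    using A jk that by (auto simp: column_def intro!: sum.cong)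
  have "column n ?B i \<in> zspan n (column n A)" if "i < n" for i
    using col[OF that] jk that by (auto intro!: zspan_base)
  moreover have "column n A i \<in> zspan n (column n ?B)" if "i < n" for i
    using col[OF jk(1)] col[OF jk(2)] col[OF that] jk that zspan_base[of _ n "column n ?B"]
    by (cases "i = j"; cases "i = k") (metis (full_types))+
  ultimately show ?thesis
    by (intro equalityI zspan_least add_subgroup_zspan)
qed

text \<open>Insert \<open>M' + H\<close> between \<open>M\<close> and \<open>H\<close>. The last
  coordinate identifies \<open>M / (M' + H)\<close> with \<int> modulo the corner entry
  \<open>g\<close>, and the lower step is \<open>M' / (M' \<inter> H) = M' / H'\<close>, the smaller
  block. Laplace expansion along the last row splits the determinant in the same way.\<close>

lemma index_column_block:
  assumes A: "A \<in> carrier_mat (Suc m) (Suc m)" and m: "Suc m \<le> d" and det: "det A \<noteq> 0"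
    and zero: "\<And>j. j < m \<Longrightarrow> A $$ (m, j) = 0"
    and IH: "\<And>A. A \<in> carrier_mat m m \<Longrightarrow> det A \<noteq> 0 \<Longrightarrow>
      index (zspan m b) (zspan m (column m A)) = nat \<bar>det A\<bar>"
  shows "index (zspan (Suc m) b) (zspan (Suc m) (column (Suc m) A)) = nat \<bar>det A\<bar>"
proof -
  define g where "g = A $$ (m, m)"
  define A' where "A' = mat_delete A m m"
  have A': "A' \<in> carrier_mat m m" using A by (auto simp: A'_def mat_delete_def)
  have "det A = (\<Sum>j<Suc m. A $$ (m, j) * cofactor A m j)" by (rule laplace_expansion_row[OF A]) simp
  also have "\<dots> = g * det A'" using zero by (simp add: g_def A'_def cofactor_def)
  finally have detA: "det A = g * det A'" .
  then have g: "g \<noteq> 0" and detA': "det A' \<noteq> 0" using det by auto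
  define M where "M = zspan (Suc m) b"
  define M' where "M' = zspan m b"
  define H where "H = zspan (Suc m) (column (Suc m) A)"
  define H' where "H' = zspan m (column m A')"
  define w where "w = column (Suc m) A m"
  have sub: "add_subgroup M" "add_subgroup M'" "add_subgroup H" "add_subgroup H'"
    by (simp_all add: M_def M'_def H_def H'_def add_subgroup_zspan)
  have "column (Suc m) A j = column m A' j" if "j < m" for j
    using that A zero[OF that] by (simp add: column_def A'_def mat_delete_def)
  then have "zspan m (column (Suc m) A) = H'" by (simp add: H'_def zspan_def)
  then have H: "H = H' + range (\<lambda>k. of_int k *s w)" by (simp add: H_def zspan_Suc w_def)
  have M: "M = M' + range (\<lambda>k. of_int k *s b m)" by (simp add: M_def M'_def zspan_Suc)
  have H'M': "H' \<subseteq> M'" unfolding H'_def M'_def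
  proof (rule zspan_least[OF add_subgroup_zspan])
    show "column m A' i \<in> zspan m b" for i unfolding column_def zspan_def by (rule range_eqI) simp
  qed
  define w' where "w' = (\<Sum>i<m. of_int (A $$ (i, m)) *s b i)"
  have w: "w = w' + of_int g *s b m" by (simp add: w_def w'_def column_def g_def)
  have w': "w' \<in> M'" unfolding w'_def M'_def zspan_def by (rule range_eqI) simp
  have cM': "coord m u = 0" if "u \<in> M'" for u
    using that m by (auto simp: M'_def zspan_def coord_sum coord_scale coord_basis)
  have cb: "coord m (b m) = 1" using m by (simp add: coord_basis)
  have cw: "coord m w = of_int g" using cM'[OF w'] cb by (simp add: w coord_add coord_scale)
  have M'M: "M' \<subseteq> M" unfolding M_def M'_def by (rule zspan_least[OF add_subgroup_zspan]) (simp add: zspan_base)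
  have HM: "H \<subseteq> M"
    unfolding H
  proof (rule plus_subset_add_subgroup[OF sub(1)])
    show "H' \<subseteq> M" using H'M' M'M by blast
    have "b m \<in> M" unfolding M_def by (rule zspan_base) simp
    then have "w \<in> M" using w w' M'M add_subgroup_zmul[OF sub(1), of "b m" g]
      by (auto simp: zmul_scale add_subgroup_add[OF sub(1)])
    then show "range (\<lambda>k. of_int k *s w) \<subseteq> M"
      using add_subgroup_zmul[OF sub(1), of w] by (auto simp: zmul_scale)
  qed
  have Zw: "of_int k *s w \<in> H" for k
    using add_subgroup_zmul[OF sub(3) , of w k] zspan_base[of m "Suc m" "column (Suc m) A"]
    by (simp add: zmul_scale H_def w_def)
  have "M' \<inter> H = H'"
  proof
    show "M' \<inter> H \<subseteq> H'"
    proof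
      fix u assume u: "u \<in> M' \<inter> H"
      then obtain h k where h: "h \<in> H'" "u = h + of_int k *s w" unfolding H by (auto elim!: set_plus_elim)
      have "coord m u = of_int k * of_int g" using h H'M' cM' by (auto simp: coord_add coord_scale cw)
      then have "k = 0" using cM'[of u] u g by simp
      then show "u \<in> H'" using h by simp
    qed
    have "H' \<subseteq> H" unfolding H_def
      using \<open>zspan m (column (Suc m) A) = H'\<close> zspan_least[OF add_subgroup_zspan, of m "column (Suc m) A" "Suc m" "column (Suc m) A"]
      by (auto simp: zspan_base)
    then show "H' \<subseteq> M' \<inter> H" using H'M' by blast
  qed
  then have i1: "index (M' + H) H = nat \<bar>det A'\<bar>"
    using index_plus_right[OF sub(2,3)] IH[OF A' detA'] by (simp add: M'_def H'_def)
  have sum: "add_subgroup (M' + H)" by (rule add_subgroup_plus[OF sub(2,3)])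
  have mem: "u \<in> M' + H \<longleftrightarrow> g dvd k" if "u = v + of_int k *s b m" "v \<in> M'" for u v k
  proof
    assume "u \<in> M' + H"
    then obtain v' h j where *: "v' \<in> M'" "h \<in> H'" "u = v' + (h + of_int j *s w)"
      unfolding H by (auto elim!: set_plus_elim)
    have "coord m u = of_int (j * g)" using * cM' H'M' by (auto simp: coord_add coord_scale cw)
    moreover have "coord m u = of_int k" using that cM' by (simp add: coord_add coord_scale cb)
    ultimately have "k = j * g" by (simp only: of_int_eq_iff)
    then show "g dvd k" by simp
  next
    assume "g dvd k"
    then obtain j where j: "k = g * j" by blast
    have "u = (v - of_int j *s w') + of_int j *s w"
      using that j by (simp add: w scale_right_distrib mult.commute)
    moreover have "v - of_int j *s w' \<in> M'"
      using add_subgroup_zmul[OF sub(2) w', of j] that add_subgroup_diff[OF sub(2)] by (simp add: zmul_scale)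
    ultimately show "u \<in> M' + H" using Zw by blast
  qed
  have i2: "index M (M' + H) = nat \<bar>g\<bar>"
    unfolding index_int_multiples[OF g, symmetric]
  \<comment> \<open>On \<open>M\<close> this coordinate is an integer; the floor only changes its
    type.\<close>
  proof (rule index_eqI[where f = "\<lambda>v. \<lfloor>coord m v\<rfloor>"])
    show "add_subgroup {k. g dvd k}" by (auto intro: add_subgroupI)
    fix u v assume "u \<in> M" "v \<in> M"
    then obtain x k y l where u: "x \<in> M'" "u = x + of_int k *s b m" and v: "y \<in> M'" "v = y + of_int l *s b m"
      unfolding M by (auto elim!: set_plus_elim)
    have "coord m u = of_int k" "coord m v = of_int l" using u v cM' by (auto simp: coord_add coord_scale cb)
    moreover have "u - v = (x - y) + of_int (k - l) *s b m" using u v by (simp add: scale_left_diff_distrib)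
    ultimately show "\<lfloor>coord m u\<rfloor> - \<lfloor>coord m v\<rfloor> \<in> {k. g dvd k} \<longleftrightarrow> u - v \<in> M' + H"
      using mem[of "u - v" "x - y" "k - l"] add_subgroup_diff[OF sub(2) u(1) v(1)] by simp
  next
    fix k :: int
    have "of_int k *s b m \<in> M" using add_subgroup_zmul[OF sub(1) zspan_base[of m "Suc m" b, folded M_def]]
      by (simp add: zmul_scale)
    then show "\<exists>v\<in>M. \<lfloor>coord m v\<rfloor> - k \<in> {k. g dvd k}"
      by (intro bexI[of _ "of_int k *s b m"]) (auto simp: coord_scale cb)
  qed (use sum in auto)
  have "index M H = index M (M' + H) * index (M' + H) H"
    by (rule index_mult[OF sub(1) sum sub(3) subset_plus_right[OF sub(2)]
          plus_subset_add_subgroup[OF sub(1) M'M HM]])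
  then show ?thesis using i1 i2 detA by (simp add: M_def H_def abs_mult nat_mult_distrib)
qed

text \<open>Column operations make the last row vanish except for its last entry; each step lowers the
  sum of the absolute values of the last row.\<close>

lemma index_column:
  assumes "n \<le> d" "A \<in> carrier_mat n n" "det A \<noteq> 0"
  shows "index (zspan n b) (zspan n (column n A)) = nat \<bar>det A\<bar>"
  using assms
proof (induction n arbitrary: A)
  case 0
  have "zspan 0 (column 0 A) = zspan 0 b" by (simp add: zspan_def)
  then have "index (zspan 0 b) (zspan 0 (column 0 A)) = 1"
    using index_eq_1_iff[OF add_subgroup_zspan add_subgroup_zspan, of 0 "column 0 A" 0 b] by simp
  then show ?case using 0 by simp
next
  case (Suc m)
  note outer = Suc.IH[OF Suc_leD[OF Suc.prems(1)]]
  show ?case using Suc.prems(2,3)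
  proof (induction "\<Sum>j<Suc m. nat \<bar>A $$ (m, j)\<bar>" arbitrary: A rule: less_induct)
    case less
    note A = less.prems(1)
    show ?case
    proof (cases "\<exists>j<Suc m. \<exists>k<Suc m. j \<noteq> k \<and> A $$ (m, j) \<noteq> 0 \<and> A $$ (m, k) \<noteq> 0")
      case True
      then obtain j k where jk: "j < Suc m" "k < Suc m" "j \<noteq> k" "A $$ (m, j) \<noteq> 0" "A $$ (m, k) \<noteq> 0"
        "\<bar>A $$ (m, j)\<bar> \<le> \<bar>A $$ (m, k)\<bar>" by (metis linear)
      \<comment> \<open>The sign sets the two entries against each other. As the one in column
        \<open>j\<close> is nonzero and not the larger, the one in column \<open>k\<close> strictly
        shrinks in absolute value.\<close>
      define s :: int where "s = (if sgn (A $$ (m, j)) = sgn (A $$ (m, k)) then -1 else 1)"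
      let ?B = "addcol s k j A"
      have B: "?B \<in> carrier_mat (Suc m) (Suc m)" using A by (simp add: mat_addcol_def)
      have lt: "\<bar>A $$ (m, k) + s * A $$ (m, j)\<bar> < \<bar>A $$ (m, k)\<bar>"
        using jk(4-6) by (auto simp: s_def sgn_if split: if_splits)
      have "(\<Sum>i<Suc m. nat \<bar>?B $$ (m, i)\<bar>) < (\<Sum>i<Suc m. nat \<bar>A $$ (m, i)\<bar>)"
      proof (rule sum_strict_mono_ex1)
        show "\<forall>i\<in>{..<Suc m}. nat \<bar>?B $$ (m, i)\<bar> \<le> nat \<bar>A $$ (m, i)\<bar>"
          using A jk(1,2) lt by (auto simp: add.commute)
        show "\<exists>i\<in>{..<Suc m}. nat \<bar>?B $$ (m, i)\<bar> < nat \<bar>A $$ (m, i)\<bar>"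
          using A jk(1,2) lt by (intro bexI[of _ k]) (auto simp: add.commute)
      qed simp
      moreover have "det ?B = det A" by (rule det_addcol[OF jk(1) jk(3)[symmetric] A])
      ultimately show ?thesis
        using less.hyps[of ?B] B less.prems(2) zspan_column_addcol[OF A jk(1-3)] by simp
    next
      case False
      show ?thesis
      proof (cases "\<forall>j<m. A $$ (m, j) = 0")
        case True
        then show ?thesis
          using index_column_block[OF A Suc.prems(1) less.prems(2) _ outer] by blast
      next
        case noblock: False
        \<comment> \<open>Only one nonzero entry is left in the last row; a swap brings it to the
          last column and changes the determinant by a sign.\<close>
        then obtain j where j: "j < m" "A $$ (m, j) \<noteq> 0" by blast
        then have zero: "A $$ (m, k) = 0" if "k < Suc m" "k \<noteq> j" for k using False that less_SucI by blast
        let ?B = "swapcols j m A"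
        have B: "?B \<in> carrier_mat (Suc m) (Suc m)" using A by simp
        have detB: "det ?B = - det A" by (rule det_swapcols[OF _ _ _ A]) (use j in auto)
        have "?B $$ (m, i) = 0" if "i < m" for i using A that j zero[of m] zero[of i] by auto
        then have "index (zspan (Suc m) b) (zspan (Suc m) (column (Suc m) ?B)) = nat \<bar>det ?B\<bar>"
          using index_column_block[OF B Suc.prems(1) _ _ outer] detB less.prems(2) by simp
        then show ?thesis using detB zspan_column_swapcols[OF A, of j m] j by simp
      qed
    qed
  qed
qed

end

lemma index_image:
  assumes f: "\<And>x y. f (x - y) = f x - f y" "inj f" and A: "add_subgroup A" "add_subgroup B" "B \<subseteq> A"
  shows "index (f ` A) (f ` B) = index A B"
proof (rule sym, rule index_eqI[where f = f])
  have "0 \<in> B" by (rule add_subgroup_zero[OF A(2)])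
  then have "f 0 \<in> f ` B" by simp
  moreover have "f 0 = 0" using f(1)[of 0 0] by simp
  ultimately have "0 \<in> f ` B" by simp
  then show "add_subgroup (f ` B)"
    using A by (auto intro!: add_subgroupI simp: f(1)[symmetric] add_subgroup_diff)
  show "f a - f c \<in> f ` B \<longleftrightarrow> a - c \<in> B" for a c
    by (simp add: f(1)[symmetric] inj_image_mem_iff[OF f(2)])
  show "\<exists>a\<in>A. f a - a' \<in> f ` B" if a': "a' \<in> f ` A" for a'
  proof -
    obtain a where "a \<in> A" "a' = f a" using a' by blast
    then show ?thesis using \<open>0 \<in> f ` B\<close> by (intro bexI[of _ a]) simp_all
  qed
qed (use A in auto)

lemma add_subgroup_image:
  assumes "\<And>x y. f (x - y) = f x - f y" and "add_subgroup A" shows "add_subgroup (f ` A)"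
proof -
  have "f 0 = 0" using assms(1)[of 0 0] by simp
  moreover have "f 0 \<in> f ` A" using add_subgroup_zero[OF assms(2)] by simp
  ultimately have "0 \<in> f ` A" by simp
  then show ?thesis
    using assms(2) by (auto intro!: add_subgroupI simp: assms(1)[symmetric] add_subgroup_diff)
qed

section \<open>Common denominators and polynomial identities\<close>

lemma finite_common_denominator:
  fixes S :: "rat set"
  assumes "finite S" shows "\<exists>k :: nat. k > 0 \<and> (\<forall>q\<in>S. of_nat k * q \<in> \<int>)"
  using assms
proof (induction S rule: finite_induct)
  case (insert q S)
  obtain k :: nat where k: "k > 0" "\<forall>q\<in>S. of_nat k * q \<in> \<int>" using insert.IH by blast
  obtain m n :: int where q: "q = of_int m / of_int n" "n > 0"
    using quotient_of_div quotient_of_denom_pos by (metis surj_pair)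
  define l where "l = nat n"
  have "of_nat l * q = of_int m" "l > 0" using q by (auto simp: l_def)
  then have "of_nat l * q \<in> \<int>" by simp
  have "of_nat (k * l) * x \<in> \<int>" if "x \<in> insert q S" for x
  proof (cases "x = q")
    case True
    have "of_nat (k * l) * x = of_nat k * (of_nat l * q)" using True by simp
    then show ?thesis using \<open>of_nat l * q \<in> \<int>\<close> by (metis Ints_mult Ints_of_nat)
  next
    case False
    have "of_nat (k * l) * x = of_nat l * (of_nat k * x)" by simp
    then show ?thesis using k that False by (metis Ints_mult Ints_of_nat insertE)
  qed
  then show ?case using k \<open>l > 0\<close> by (intro exI[of _ "k * l"]) auto
qed (auto intro: exI[of _ 1])

lemma det_pencil_poly:
  fixes A B :: "rat mat"
  assumes "A \<in> carrier_mat n n" "B \<in> carrier_mat n n"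
  shows "\<exists>q. \<forall>c. poly q c = det (A + c \<cdot>\<^sub>m B)"
proof (intro exI allI)
  fix c
  show "poly (det (mat n n (\<lambda>ij. [:A $$ ij, B $$ ij:]))) c = det (A + c \<cdot>\<^sub>m B)"
    by (rule poly_det_cong[of _ n]) (use assms in auto)
qed

text \<open>Multiplying by the variable makes the excluded point harmless, and the factor
  cancels.\<close>

lemma poly_eqI_nonzero:
  fixes u v :: "rat poly"
  assumes "\<And>c. c \<noteq> 0 \<Longrightarrow> poly u c = poly v c" shows "u = v"
proof -
  have "poly ([:0, 1:] * u) = poly ([:0, 1:] * v)"
  proof
    show "poly ([:0, 1:] * u) c = poly ([:0, 1:] * v) c" for c using assms[of c] by (cases "c = 0") auto
  qed
  then show ?thesis unfolding poly_eq_poly_eq_iff by simp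
qed

text \<open>Write \<open>f\<close> as a power of the variable times \<open>g\<close> with
  \<open>g(0) \<noteq> 0\<close>. For fixed \<open>x \<noteq> 0\<close>, multiplicativity gives
  \<open>g(x c) = g(x) g(c)\<close> as polynomials in \<open>c\<close>, and \<open>c = 0\<close>
  yields \<open>g(x) = 1\<close>.\<close>

lemma multiplicative_poly_eq_power:
  fixes f :: "rat poly"
  assumes "\<And>x y. poly f (x * y) = poly f x * poly f y" and "poly f 1 = 1"
  shows "\<exists>s. \<forall>c. poly f c = c ^ s"
proof -
  have "f \<noteq> 0" using assms(2) by auto
  then obtain g where f: "f = [:0, 1:] ^ order 0 f * g" and g: "\<not> [:0, 1:] dvd g"
    using order_decomp[of f 0] by auto
  define s where "s = order 0 f"
  have g0: "poly g 0 \<noteq> 0" using g by (simp add: poly_eq_0_iff_dvd)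
  have fp: "poly f c = c ^ s * poly g c" for c by (subst f) (simp add: s_def)
  have "poly g x = 1" if x: "x \<noteq> 0" for x
  proof -
    have "g \<circ>\<^sub>p [:0, x:] = [:poly g x:] * g"
    proof (rule poly_eqI_nonzero)
      fix c :: rat assume c: "c \<noteq> 0"
      have "(x * c) ^ s * poly g (x * c) = (x ^ s * poly g x) * (c ^ s * poly g c)"
        using assms(1)[of x c] by (simp add: fp)
      then show "poly (g \<circ>\<^sub>p [:0, x:]) c = poly ([:poly g x:] * g) c"
        using x c by (simp add: poly_pcompose power_mult_distrib mult.commute)
    qed
    then have "poly (g \<circ>\<^sub>p [:0, x:]) 0 = poly ([:poly g x:] * g) 0" by simp
    then show ?thesis using g0 by (simp add: poly_pcompose)
  qed
  then have "g = 1" by (intro poly_eqI_nonzero) simp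
  then show ?thesis using fp by auto
qed

text \<open>The two sides vanish at \<open>c = 0\<close> to the exact orders \<open>r\<close> and
  \<open>s\<close>; after cancelling, the constant terms are compared.\<close>

lemma poly_pencil_order:
  fixes p h :: "rat poly"
  assumes eq: "\<And>c. c ^ r * poly p (1 + c) = c ^ s * poly h c" and "poly p 1 \<noteq> 0" "poly h 0 \<noteq> 0"
  shows "r = s" "poly p 1 = poly h 0"
proof -
  define p' where "p' = p \<circ>\<^sub>p [:1, 1:]"
  have p': "poly p' c = poly p (1 + c)" for c by (simp add: p'_def poly_pcompose add.commute)
  have lem: "v = [:0, 1:] ^ (m - l) * u" if "l \<le> m" "\<And>c. c ^ l * poly v c = c ^ m * poly u c"
    for l m and u v :: "rat poly"
  proof (rule poly_eqI_nonzero)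
    fix c :: rat assume "c \<noteq> 0"
    moreover have "c ^ m = c ^ l * c ^ (m - l)" using that(1) by (simp flip: power_add)
    ultimately show "poly v c = poly ([:0, 1:] ^ (m - l) * u) c" using that(2)[of c] by simp
  qed
  have "r = s"
  proof (cases "r \<le> s")
    case True
    then have "p' = [:0, 1:] ^ (s - r) * h" using lem[of r s p' h] eq p' by simp
    then have "poly p' 0 = 0 ^ (s - r) * poly h 0" by simp
    then show ?thesis using assms(2) True p'[of 0] by (cases "s - r") auto
  next
    case False
    then have "h = [:0, 1:] ^ (r - s) * p'" using lem[of s r h p'] eq p' by simp
    then have "poly h 0 = 0 ^ (r - s) * poly p' 0" by simp
    then show ?thesis using assms(3) False by (cases "r - s") auto
  qed
  then show "r = s" .
  then have "p' = [:0, 1:] ^ (r - r) * h" using lem[of r r p' h] eq p' by simp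
  then have "p' = h" by simp
  then show "poly p 1 = poly h 0" using p'[of 0] by simp
qed

section \<open>Determinants of rational endomorphisms as indices\<close>

context rat_lattice
begin

abbreviation lin :: "('v \<Rightarrow> 'v) \<Rightarrow> bool" where
  "lin \<equiv> Vector_Spaces.linear scale scale"

lemma lin_iff: "lin G \<longleftrightarrow> (\<forall>u v. G (u + v) = G u + G v) \<and> (\<forall>q v. G (q *s v) = q *s G v)"
  unfolding Vector_Spaces.linear_iff using vector_space_axioms by blast

lemma lin_add: "lin G \<Longrightarrow> G (u + v) = G u + G v"
  and lin_scale: "lin G \<Longrightarrow> G (q *s v) = q *s G v"
  by (simp_all add: lin_iff)

lemma lin_zero: "lin G \<Longrightarrow> G 0 = 0"
  using lin_scale[of G 0 0] by simp

lemma lin_diff: "lin G \<Longrightarrow> G (u - v) = G u - G v"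
  using lin_add[of G "u - v" v] by (simp add: algebra_simps)

lemma lin_sum: "lin G \<Longrightarrow> G (sum f I) = (\<Sum>i\<in>I. G (f i))"
  by (induction I rule: infinite_finite_induct) (auto simp: lin_zero lin_add)

lemma lin_expansion: "lin G \<Longrightarrow> G v = (\<Sum>j<d. coord j v *s G (b j))"
  by (subst expansion[of v]) (simp only: lin_sum lin_scale)

lemma add_subgroup_L: "add_subgroup L"
  by (simp add: L_zspan add_subgroup_zspan)

lemma mem_L_iff: "v \<in> L \<longleftrightarrow> (\<forall>i<d. coord i v \<in> \<int>)"
proof
  assume "v \<in> L"
  then show "\<forall>i<d. coord i v \<in> \<int>" by (auto simp: L_def coord_combination)
next
  assume "\<forall>i<d. coord i v \<in> \<int>"
  then have "\<forall>i\<in>{..<d}. \<exists>k. coord i v = of_int k" by (auto elim: Ints_cases)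
  then obtain c where c: "\<forall>i\<in>{..<d}. coord i v = of_int (c i)" by metis
  have "v = (\<Sum>i<d. of_int (c i) *s b i)" by (subst expansion[of v]) (use c in auto)
  then show "v \<in> L" by (auto simp: L_def)
qed

lemma add_subgroup_scale_mem: "add_subgroup M \<Longrightarrow> v \<in> M \<Longrightarrow> of_nat k *s v \<in> M"
  using add_subgroup_zmul[of M v "int k"] by (simp add: zmul_scale)

lemma L_clear_denominators:
  assumes "finite S" shows "\<exists>k :: nat. k > 0 \<and> (\<forall>v\<in>S. of_nat k *s v \<in> L)"
proof -
  have "finite ((\<lambda>(i, v). coord i v) ` ({..<d} \<times> S))" using assms by simp
  then obtain k :: nat where "k > 0" "\<forall>q\<in>(\<lambda>(i, v). coord i v) ` ({..<d} \<times> S). of_nat k * q \<in> \<int>"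
    using finite_common_denominator by blast
  then show ?thesis by (auto simp: mem_L_iff coord_scale)
qed

lemma lin_clear_denominators:
  assumes "lin G" shows "\<exists>k :: nat. k > 0 \<and> (\<forall>v\<in>L. of_nat k *s G v \<in> L)"
proof -
  obtain k :: nat where k: "k > 0" "\<forall>v\<in>(\<lambda>j. G (b j)) ` {..<d}. of_nat k *s v \<in> L"
    using L_clear_denominators[of "(\<lambda>j. G (b j)) ` {..<d}"] by auto
  have "add_subgroup {v. of_nat k *s G v \<in> L}"
    using add_subgroup_L by (auto intro!: add_subgroupI
        simp: lin_zero[OF assms] lin_diff[OF assms] scale_right_diff_distrib add_subgroup_closed)
  then have "L \<subseteq> {v. of_nat k *s G v \<in> L}" unfolding L_zspan
    by (rule zspan_least) (use k L_zspan in auto)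
  then show ?thesis using k by blast
qed

definition lmat :: "('v \<Rightarrow> 'v) \<Rightarrow> rat mat" where
  "lmat G = mat d d (\<lambda>(i, j). coord i (G (b j)))"

lemma lmat_carrier [simp]: "lmat G \<in> carrier_mat d d"
  by (simp add: lmat_def)

lemma lmat_compose:
  assumes "lin G" shows "lmat (\<lambda>v. G (H v)) = lmat G * lmat H"
proof (rule eq_matI)
  fix i j assume ij: "i < dim_row (lmat G * lmat H)" "j < dim_col (lmat G * lmat H)"
  then have "coord i (G (H (b j))) = (\<Sum>k<d. coord i (G (b k)) * coord k (H (b j)))"
    by (subst lin_expansion[OF assms]) (simp add: coord_sum coord_scale mult.commute)
  then show "lmat (\<lambda>v. G (H v)) $$ (i, j) = (lmat G * lmat H) $$ (i, j)"
    using ij by (simp add: lmat_def scalar_prod_def atLeast0LessThan)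
qed (auto simp: lmat_def)

lemma lmat_add: "lmat (\<lambda>v. G v + H v) = lmat G + lmat H"
  and lmat_scale: "lmat (\<lambda>v. q *s G v) = q \<cdot>\<^sub>m lmat G"
  and lmat_id: "lmat (\<lambda>v. v) = 1\<^sub>m d"
  by (auto simp: lmat_def coord_add coord_scale coord_basis intro!: eq_matI)

definition ldet :: "('v \<Rightarrow> 'v) \<Rightarrow> rat" where
  "ldet G = det (lmat G)"

lemma ldet_compose: "lin G \<Longrightarrow> ldet (\<lambda>v. G (H v)) = ldet G * ldet H"
  unfolding ldet_def by (simp add: lmat_compose det_mult[OF lmat_carrier lmat_carrier])

lemma ldet_scale: "ldet (\<lambda>v. q *s G v) = q ^ d * ldet G"
  unfolding ldet_def lmat_scale by (simp add: lmat_def)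

lemma ldet_id: "ldet (\<lambda>v. v) = 1"
  by (simp add: ldet_def lmat_id)

lemma ldet_nonzero:
  assumes "lin G" "inj G" shows "ldet G \<noteq> 0"
proof -
  interpret vector_space_pair scale scale by unfold_locales
  obtain H where H: "lin H" "H \<circ> G = id" using linear_injective_left_inverse[OF assms] by blast
  have "(\<lambda>v. H (G v)) = (\<lambda>v. v)" using H(2) by (auto simp: fun_eq_iff)
  then have "ldet H * ldet G = 1" using ldet_compose[OF H(1), of G] ldet_id by simp
  then show ?thesis by auto
qed

lemma index_endomorphism:
  assumes G: "lin G" "inj G" and stable: "G ` L \<subseteq> L"
  shows "of_nat (index L (G ` L)) = \<bar>ldet G\<bar>"
proof -
  define A where "A = mat d d (\<lambda>(i, j). \<lfloor>coord i (G (b j))\<rfloor>)"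
  have A: "A \<in> carrier_mat d d" by (simp add: A_def)
  have "b j \<in> L" if "j < d" for j using that by (simp add: L_zspan zspan_base)
  then have Gb: "G (b j) \<in> L" if "j < d" for j using stable that by blast
  have int: "of_int (A $$ (i, j)) = coord i (G (b j))" if "i < d" "j < d" for i j
    using Gb[OF that(2)] that unfolding mem_L_iff by (auto simp: A_def elim: Ints_cases)
  have "lmat G = map_mat of_int A"
    by (rule eq_matI) (use A int in \<open>auto simp: lmat_def\<close>)
  then have det: "ldet G = of_int (det A)" by (simp add: ldet_def)
  then have "det A \<noteq> 0" using ldet_nonzero[OF G] by auto
  have col: "column d A j = G (b j)" if "j < d" for j
    unfolding column_def using expansion[of "G (b j)"] int that by simp
  have "zspan d (column d A) = G ` L"
    unfolding L_zspan zspan_def image_image lin_sum[OF G(1)] lin_scale[OF G(1)] using col by simp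
  then show ?thesis
    using index_column[OF le_refl A \<open>det A \<noteq> 0\<close>] det by (simp add: L_zspan)
qed

lemma inj_scale: "q \<noteq> 0 \<Longrightarrow> inj ((*s) q)"
  by (auto intro!: injI)

lemma lin_scale_left: "lin ((*s) q)"
  by (simp add: lin_iff scale_right_distrib mult.commute)

lemma lin_scale_comp: "lin G \<Longrightarrow> lin (\<lambda>v. q *s G v)"
  by (simp add: lin_iff scale_right_distrib mult.commute)

lemma index_scale_image:
  "q \<noteq> 0 \<Longrightarrow> add_subgroup A \<Longrightarrow> add_subgroup B \<Longrightarrow> B \<subseteq> A \<Longrightarrow> index ((*s) q ` A) ((*s) q ` B) = index A B"
  by (rule index_image) (auto simp: scale_right_diff_distrib inj_scale)

text \<open>\<open>M\<close> lies between \<open>k L\<close> and \<open>L\<close>, and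
  \<open>k L\<close> has finite index because multiplication by \<open>k\<close> has nonzero
  determinant.\<close>

lemma index_L_pos:
  assumes M: "add_subgroup M" "M \<subseteq> L" and k: "k > 0" and kL: "\<And>v. v \<in> L \<Longrightarrow> of_nat k *s v \<in> M"
  shows "index L M > 0"
proof -
  let ?k = "(*s) (of_nat k :: rat)"
  have "?k ` L \<subseteq> L" using M kL by blast
  then have "of_nat (index L (?k ` L)) = \<bar>ldet ?k\<bar>"
    using index_endomorphism[OF lin_scale_left inj_scale, of "of_nat k"] k by simp
  moreover have "ldet ?k \<noteq> 0" using ldet_nonzero[OF lin_scale_left inj_scale, of "of_nat k"] k by simp
  ultimately have "index L (?k ` L) > 0" by (cases "index L (?k ` L)") auto
  moreover have "index L (?k ` L) = index L M * index M (?k ` L)"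
    by (rule index_mult[OF add_subgroup_L M(1) _ _ M(2)])
      (use kL add_subgroup_image[OF _ add_subgroup_L, of ?k] in \<open>auto simp: scale_right_diff_distrib\<close>)
  ultimately show ?thesis by (auto intro: gr0I)
qed

text \<open>The index of \<open>G M\<close> in \<open>L\<close> can be computed through
  \<open>G L\<close> or through \<open>M\<close>. As \<open>G\<close> is injective, the index of
  \<open>M\<close> in \<open>L\<close> occurs on both sides and cancels.\<close>

lemma index_endomorphism_sublattice_integral:
  assumes G: "lin G" "inj G" and M: "add_subgroup M" "M \<subseteq> L" "index L M > 0"
    and stable: "G ` L \<subseteq> L" "G ` M \<subseteq> M"
  shows "of_nat (index M (G ` M)) = \<bar>ldet G\<bar>"
proof -
  have sub: "add_subgroup (G ` L)" "add_subgroup (G ` M)"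
    using add_subgroup_image[OF lin_diff[OF G(1)]] add_subgroup_L M(1) by auto
  have "index L (G ` M) = index L (G ` L) * index (G ` L) (G ` M)"
    by (rule index_mult[OF add_subgroup_L sub _ stable(1)]) (use M in auto)
  moreover have "index (G ` L) (G ` M) = index L M"
    by (rule index_image[OF lin_diff[OF G(1)] G(2) add_subgroup_L M(1,2)])
  moreover have "index L (G ` M) = index L M * index M (G ` M)"
    by (rule index_mult[OF add_subgroup_L M(1) sub(2) stable(2) M(2)])
  ultimately have "index M (G ` M) = index L (G ` L)" using M(3) by simp
  then show ?thesis using index_endomorphism[OF G stable(1)] by simp
qed

text \<open>The maps of interest involve the projection \<open>P\<close> and need not preserve
  \<open>L\<close>. A multiple \<open>k G\<close> does, and the determinant and the index both grow
  by the factor \<open>k ^ d\<close>.\<close>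

theorem index_endomorphism_sublattice:
  assumes G: "lin G" "inj G" and M: "add_subgroup M" "M \<subseteq> L" "index L M > 0"
    and stable: "G ` M \<subseteq> M"
  shows "of_nat (index M (G ` M)) = \<bar>ldet G\<bar>"
proof -
  obtain k :: nat where k: "k > 0" "\<And>v. v \<in> L \<Longrightarrow> of_nat k *s G v \<in> L"
    using lin_clear_denominators[OF G(1)] by blast
  let ?k = "(*s) (of_nat k :: rat)"
  let ?H = "\<lambda>v. of_nat k *s G v"
  have H: "lin ?H" "inj ?H" "?H ` L \<subseteq> L" "?H ` M \<subseteq> M"
    using G k stable add_subgroup_scale_mem[OF M(1)] by (auto simp: lin_scale_comp inj_def)
  have kM: "?k ` M \<subseteq> M" "?k ` L \<subseteq> L"
    using add_subgroup_scale_mem[OF M(1)] add_subgroup_scale_mem[OF add_subgroup_L] by auto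
  have 1: "of_nat (index M (?H ` M)) = of_nat k ^ d * \<bar>ldet G\<bar>"
    using index_endomorphism_sublattice_integral[OF H(1,2) M H(3,4)] by (simp add: ldet_scale abs_mult)
  have 2: "of_nat (index M (?k ` M)) = (of_nat k ^ d :: rat)"
    using index_endomorphism_sublattice_integral[OF lin_scale_left inj_scale M kM(2,1)] k
      ldet_scale[of "of_nat k" "\<lambda>v. v"] by (simp add: ldet_id)
  have sG: "add_subgroup (G ` M)" by (rule add_subgroup_image[OF lin_diff[OF G(1)] M(1)])
  have sk: "add_subgroup (?k ` A)" if "add_subgroup A" for A
    by (rule add_subgroup_image[OF _ that]) (simp add: scale_right_diff_distrib)
  have HM: "?H ` M = ?k ` (G ` M)" by (simp add: image_image)
  have "index M (?H ` M) = index M (?k ` M) * index (?k ` M) (?H ` M)"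
    unfolding HM by (rule index_mult[OF M(1) sk[OF M(1)] sk[OF sG] _ kM(1)]) (use stable in auto)
  moreover have "index (?k ` M) (?H ` M) = index M (G ` M)"
    unfolding HM using index_scale_image[OF _ M(1) sG stable, of "of_nat k"] k by simp
  ultimately have "of_nat k ^ d * \<bar>ldet G\<bar> = of_nat k ^ d * (of_nat (index M (G ` M)) :: rat)"
    using 1 2 by (simp only: of_nat_mult)
  then show ?thesis using k by simp
qed

end

section \<open>The fixed and the moved space\<close>

lemma index_direct_sum:
  assumes U: "add_subgroup U" and X: "add_subgroup X" and X': "add_subgroup X'" "X' \<subseteq> X"
    and disj: "U \<inter> X = {0}"
  shows "index (U + X) (U + X') = index X X'"
proof (rule sym, rule index_eqI[where f = "\<lambda>x. x"])
  show "x \<in> U + X" if "x \<in> X" for x using that subset_plus_right[OF U] by blast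
  show "a - c \<in> U + X' \<longleftrightarrow> a - c \<in> X'" if "a \<in> X" "c \<in> X" for a c
  proof
    assume "a - c \<in> U + X'"
    then obtain u x where ux: "u \<in> U" "x \<in> X'" "a - c = u + x" by (auto elim!: set_plus_elim)
    have "a - c - x \<in> X" using that ux X' by (blast intro: add_subgroup_diff[OF X])
    then have "u \<in> X" using ux by simp
    then have "u = 0" using disj ux by blast
    then show "a - c \<in> X'" using ux by simp
  qed (use subset_plus_right[OF U] in blast)
  show "\<exists>x\<in>X. x - y \<in> U + X'" if y: "y \<in> U + X" for y
  proof -
    obtain u x where ux: "u \<in> U" "x \<in> X" "y = u + x" using y by (auto elim!: set_plus_elim)
    have "- u + 0 \<in> U + X'" using ux U X' by (intro set_plus_intro) (auto simp: add_subgroup_uminus add_subgroup_zero)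
    then show ?thesis using ux by (intro bexI[of _ x]) auto
  qed
qed (use add_subgroup_plus[OF U X'(1)] X' in auto)

locale lattice_endomorphism = rat_lattice scale d b L
  for scale :: "rat \<Rightarrow> 'v::ab_group_add \<Rightarrow> 'v" (infixr \<open>*s\<close> 75) and d b L +
  fixes F :: "'v \<Rightarrow> 'v"
  assumes lin_F: "lin F" and F_stable: "F ` L \<subseteq> L"
    and semisimple_L: "{v \<in> L. F v - v = 0} = {v \<in> L. F (F v - v) - (F v - v) = 0}"
begin

definition N :: "'v \<Rightarrow> 'v" where "N v = F v - v"

abbreviation VF :: "'v set" where "VF \<equiv> fixed_space F"
abbreviation W :: "'v set" where "W \<equiv> moved_space F"

lemma VF_iff: "v \<in> VF \<longleftrightarrow> N v = 0"
  by (simp add: fixed_space_def N_def)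

lemma W_eq: "W = range N"
  by (simp add: moved_space_def N_def[abs_def])

lemma lin_N: "lin N"
  using lin_F by (simp add: lin_iff N_def scale_right_diff_distrib)

text \<open>The hypothesis concerns lattice vectors only; clearing denominators extends it to
  \<open>V\<close>.\<close>

lemma N_kernel:
  assumes "N (N v) = 0" shows "N v = 0"
proof -
  obtain k :: nat where k: "k > 0" "of_nat k *s v \<in> L" using L_clear_denominators[of "{v}"] by auto
  have "N (N (of_nat k *s v)) = 0" using assms by (simp add: lin_scale[OF lin_N])
  then have "N (of_nat k *s v) = 0" using semisimple_L k(2) unfolding N_def by blast
  then show ?thesis using k(1) by (simp add: lin_scale[OF lin_N])
qed

lemma VF_W_disjoint: "v \<in> VF \<Longrightarrow> v \<in> W \<Longrightarrow> v = 0"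
  unfolding W_eq VF_iff using N_kernel by auto

text \<open>\<open>N\<close> is injective on \<open>W\<close> because \<open>VF\<close> and
  \<open>W\<close> meet in \<open>0\<close>, hence bijective there by dimension. With
  \<open>g\<close> inverting \<open>N\<close> on \<open>W\<close>, the component of \<open>v\<close>
  in \<open>W\<close> is \<open>g (N v)\<close>.\<close>

lemma ex_projection: "\<exists>P. lin P \<and> (\<forall>v. P v \<in> VF) \<and> (\<forall>v. v - P v \<in> W)"
proof -
  interpret fd: finite_dimensional_vector_space scale "b ` {..<d}"
    by unfold_locales (use basis in auto)
  interpret finite_dimensional_vector_space_pair scale "b ` {..<d}" scale "b ` {..<d}" ..
  interpret N: Vector_Spaces.linear scale scale N by (rule lin_N)
  have sub: "subspace W" unfolding W_eq by (rule N.subspace_image[OF subspace_UNIV])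
  have inj: "inj_on N W"
  proof (rule inj_onI)
    fix x y assume xy: "x \<in> W" "y \<in> W" "N x = N y"
    then have "x - y \<in> W" "x - y \<in> VF"
      using subspace_diff[OF sub] by (auto simp: VF_iff lin_diff[OF lin_N])
    then show "x = y" using VF_W_disjoint by fastforce
  qed
  have "dim (N ` W) = dim W" using dim_image_eq[OF lin_N, of W] inj sub by (simp add: span_eq_iff[THEN iffD2])
  moreover have "subspace (N ` W)" by (rule N.subspace_image[OF sub])
  ultimately have NW: "N ` W = W"
    using fd.subspace_dim_equal[of "N ` W" W] sub by (auto simp: W_eq)
  obtain g where g: "range g \<subseteq> W" "lin g" "\<forall>v\<in>W. g (N v) = v"
    using linear_exists_left_inverse_on[OF lin_N sub inj] by blast
  define P where "P v = v - g (N v)" for v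
  have "lin P" using g(2) lin_N by (simp add: lin_iff P_def scale_right_diff_distrib)
  moreover have "P v \<in> VF" for v
  proof -
    obtain w where "w \<in> W" "N v = N w" using NW unfolding W_eq by (metis imageE rangeI)
    then show ?thesis using g(3) by (simp add: VF_iff P_def lin_diff[OF lin_N])
  qed
  moreover have "v - P v \<in> W" for v using g(1) by (auto simp: P_def)
  ultimately show ?thesis by blast
qed

section \<open>The projection onto the fixed space and the factors of \<open>c - N\<close>\<close>

definition P :: "'v \<Rightarrow> 'v" where
  "P = (SOME P. lin P \<and> (\<forall>v. P v \<in> VF) \<and> (\<forall>v. v - P v \<in> W))"

lemma lin_P: "lin P" and P_VF: "P v \<in> VF" and P_W: "v - P v \<in> W"
  using someI_ex[OF ex_projection] unfolding P_def[symmetric] by auto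

lemma add_subgroup_VF: "add_subgroup VF"
  by (rule add_subgroupI) (auto simp: VF_iff lin_zero[OF lin_N] lin_diff[OF lin_N])

lemma add_subgroup_W: "add_subgroup W"
  unfolding W_eq by (rule add_subgroup_image[OF lin_diff[OF lin_N] add_subgroup_UNIV])

lemma P_fixed: "v \<in> VF \<Longrightarrow> P v = v"
  using VF_W_disjoint[OF add_subgroup_diff[OF add_subgroup_VF _ P_VF] P_W, of v] by simp

lemma P_moved: "v \<in> W \<Longrightarrow> P v = 0"
  using VF_W_disjoint[OF P_VF, of v] add_subgroup_diff[OF add_subgroup_W _ P_W, of v v] by simp

lemma N_P: "N (P v) = 0"
  using P_VF VF_iff by blast

lemma P_N: "P (N v) = 0"
  by (rule P_moved) (simp add: W_eq)

lemma P_P: "P (P v) = P v"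
  by (rule P_fixed[OF P_VF])

lemmas lin_simps = lin_add[OF lin_P] lin_diff[OF lin_P] lin_scale[OF lin_P]
  lin_add[OF lin_N] lin_diff[OF lin_N] lin_scale[OF lin_N] N_P P_N P_P

text \<open>Multiplication by \<open>c\<close> on \<open>VF\<close> and the identity on
  \<open>W\<close>.\<close>

definition stretch :: "rat \<Rightarrow> 'v \<Rightarrow> 'v" where
  "stretch c v = (v - P v) + c *s P v"

text \<open>The identity on \<open>VF\<close> and \<open>c - N\<close> on \<open>W\<close>. At
  \<open>c = 0\<close> its determinant is that of \<open>-N\<close> on \<open>W\<close>.\<close>

definition shear :: "rat \<Rightarrow> 'v \<Rightarrow> 'v" where
  "shear c v = (P v - N v) + c *s (v - P v)"

lemma lin_stretch: "lin (stretch c)"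
  unfolding lin_iff stretch_def
  by (simp add: lin_simps scale_right_distrib scale_right_diff_distrib algebra_simps)

lemma lin_shear: "lin (shear c)"
  unfolding lin_iff shear_def
  by (simp add: lin_simps scale_right_distrib scale_right_diff_distrib algebra_simps)

lemma stretch_shear: "stretch c (shear c v) = c *s v - N v"
  unfolding stretch_def shear_def by (simp add: lin_simps scale_right_diff_distrib)

lemma stretch_stretch: "stretch x (stretch y v) = stretch (x * y) v"
  unfolding stretch_def by (simp add: lin_simps)

lemma inj_stretch:
  assumes "c \<noteq> 0" shows "inj (stretch c)"
proof (rule injI)
  fix u v assume "stretch c u = stretch c v"
  then have "stretch (inverse c) (stretch c u) = stretch (inverse c) (stretch c v)" by simp
  then show "u = v" using assms by (simp add: stretch_stretch) (simp add: stretch_def)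
qed

text \<open>If \<open>P u = N u\<close>, this vector lies in both \<open>VF\<close> and
  \<open>W\<close> and vanishes; then \<open>u\<close> is fixed and
  \<open>u = P u = 0\<close>.\<close>

lemma inj_shear_0: "inj (shear 0)"
proof (rule injI)
  fix u v assume "shear 0 u = shear 0 v"
  then have eq: "P (u - v) = N (u - v)" by (simp add: shear_def lin_simps algebra_simps)
  then have "N (u - v) = 0" using VF_W_disjoint[OF P_VF, of "u - v"] W_eq by auto
  then have "u - v \<in> VF" "P (u - v) = 0" using eq VF_iff by auto
  then show "u = v" using P_fixed[of "u - v"] by simp
qed

lemma lattice_mat: "lattice_mat scale d b F \<in> carrier_mat d d"
  "map_mat of_int (lattice_mat scale d b F) = lmat F"
proof -
  define A where "A = mat d d (\<lambda>(i, j). \<lfloor>coord i (F (b j))\<rfloor>)"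
  have Fb: "F (b j) \<in> L" if "j < d" for j using F_stable that zspan_base[of j d b] by (auto simp: L_zspan)
  have int: "of_int (A $$ (i, j)) = coord i (F (b j))" if "i < d" "j < d" for i j
    using Fb[OF that(2)] that unfolding mem_L_iff by (auto simp: A_def elim: Ints_cases)
  have "lattice_mat scale d b F = A"
    unfolding lattice_mat_def
  proof (rule the_equality)
    show "A \<in> carrier_mat d d \<and> (\<forall>j<d. F (b j) = (\<Sum>i<d. of_int (A $$ (i, j)) *s b i))"
    proof (intro conjI allI impI)
      show "F (b j) = (\<Sum>i<d. of_int (A $$ (i, j)) *s b i)" if "j < d" for j
        using expansion[of "F (b j)"] int that by simp
    qed (simp add: A_def)
  next
    fix B assume B: "B \<in> carrier_mat d d \<and> (\<forall>j<d. F (b j) = (\<Sum>i<d. of_int (B $$ (i, j)) *s b i))"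
    show "B = A"
    proof (rule eq_matI)
      fix i j assume "i < dim_row A" "j < dim_col A"
      then have ij: "i < d" "j < d" by (auto simp: A_def)
      then have "of_int (A $$ (i, j)) = (of_int (B $$ (i, j)) :: rat)"
        using int[OF ij] B coord_combination[OF ij(1), of "\<lambda>i. of_int (B $$ (i, j))"] by simp
      then show "B $$ (i, j) = A $$ (i, j)" by simp
    qed (use B in \<open>auto simp: A_def\<close>)
  qed
  moreover have "map_mat of_int A = lmat F"
    by (rule eq_matI) (use int in \<open>auto simp: lmat_def A_def\<close>)
  ultimately show "lattice_mat scale d b F \<in> carrier_mat d d"
    "map_mat of_int (lattice_mat scale d b F) = lmat F" by (auto simp: A_def)
qed

lemma ldet_char_poly: "ldet (\<lambda>v. c *s v - N v) = poly (char_poly (lmat F)) (1 + c)"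
proof -
  have "lmat (\<lambda>v. c *s v - N v) = - char_matrix (lmat F) (1 + c)"
    by (rule eq_matI)
      (auto simp: lmat_def char_matrix_def N_def coord_add coord_diff coord_scale coord_basis algebra_simps)
  then show ?thesis by (simp add: ldet_def char_poly_matrix[OF lmat_carrier])
qed

text \<open>With \<open>P\<close> the projection onto the fixed space, \<open>c - N\<close> factors as \<open>stretch c \<circ> shear c\<close>. The
  determinant of \<open>stretch c\<close> is polynomial and multiplicative in \<open>c\<close>, hence a power of \<open>c\<close>, and
  \<open>shear 0\<close> is invertible, so the characteristic polynomial determines both.\<close>

lemma char_poly_determinants:
  assumes char: "char_poly (lattice_mat scale d b F) = [:-1, 1:] ^ r * p \<or>
         char_poly (lattice_mat scale d b F) = - ([:-1, 1:] ^ r * p)"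
    and pos: "poly p 1 > 0"
  shows "ldet (stretch c) = c ^ r" "\<bar>ldet (shear 0)\<bar> = of_int (poly p 1)"
proof -
  have st: "lmat (stretch c) = lmat (\<lambda>v. v - P v) + c \<cdot>\<^sub>m lmat P" for c
    unfolding stretch_def[abs_def] lmat_add lmat_scale ..
  obtain f where f: "\<And>c. poly f c = ldet (stretch c)"
    using det_pencil_poly[OF lmat_carrier lmat_carrier, of "\<lambda>v. v - P v" P] by (auto simp: ldet_def st)
  have sh: "lmat (shear c) = lmat (\<lambda>v. P v - N v) + c \<cdot>\<^sub>m lmat (\<lambda>v. v - P v)" for c
    unfolding shear_def[abs_def] lmat_add lmat_scale ..
  obtain h where h: "\<And>c. poly h c = ldet (shear c)"
    using det_pencil_poly[OF lmat_carrier lmat_carrier, of "\<lambda>v. P v - N v" "\<lambda>v. v - P v"]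
    by (auto simp: ldet_def sh)
  have "stretch 1 = (\<lambda>v. v)" by (simp add: stretch_def[abs_def])
  then have "poly f 1 = 1" by (simp add: f ldet_id)
  moreover have "poly f (x * y) = poly f x * poly f y" for x y
    using ldet_compose[OF lin_stretch, of x "stretch y"]
    by (simp add: f stretch_stretch)
  ultimately obtain s where s: "\<And>c. poly f c = c ^ s" using multiplicative_poly_eq_power by blast
  define p' :: "rat poly" where "p' = map_poly of_int p"
  have p'_1: "poly p' 1 = of_int (poly p 1)"
    unfolding p'_def using of_int_hom.poly_map_poly_1 by (metis of_int_1 of_int_hom.poly_map_poly)
  \<comment> \<open>The undetermined sign of the characteristic polynomial; it disappears on taking
    absolute values.\<close>
  define \<sigma> :: rat where "\<sigma> = (if char_poly (lattice_mat scale d b F) = [:-1, 1:] ^ r * p then 1 else -1)"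
  have "char_poly (lmat F) = map_poly of_int (char_poly (lattice_mat scale d b F))"
    unfolding lattice_mat(2)[symmetric] by (rule of_int_hom.char_poly_hom[OF lattice_mat(1)])
  also have "\<dots> = [:\<sigma>:] * ([:-1, 1:] ^ r * p')"
    using char by (auto simp: \<sigma>_def p'_def of_int_poly_hom.hom_mult of_int_poly_hom.hom_power
        of_int_poly_hom.hom_uminus)
  finally have cp: "char_poly (lmat F) = [:\<sigma>:] * ([:-1, 1:] ^ r * p')" .
  have "c ^ r * poly ([:\<sigma>:] * p') (1 + c) = c ^ s * poly h c" for c
  proof -
    have "c ^ s * poly h c = ldet (\<lambda>v. stretch c (shear c v))"
      using ldet_compose[OF lin_stretch, of c "shear c"] s f h by simp
    also have "\<dots> = poly (char_poly (lmat F)) (1 + c)"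
      unfolding stretch_shear by (rule ldet_char_poly)
    also have "\<dots> = c ^ r * poly ([:\<sigma>:] * p') (1 + c)" unfolding cp by simp
    finally show ?thesis by simp
  qed
  moreover have "\<sigma> \<noteq> 0" "\<bar>\<sigma>\<bar> = 1" by (auto simp: \<sigma>_def)
  moreover have "poly ([:\<sigma>:] * p') 1 \<noteq> 0" using pos p'_1 \<open>\<sigma> \<noteq> 0\<close> by simp
  moreover have "poly h 0 \<noteq> 0" using ldet_nonzero[OF lin_shear inj_shear_0] h by simp
  ultimately have *: "r = s" "poly ([:\<sigma>:] * p') 1 = poly h 0" using poly_pencil_order by blast+
  show "ldet (stretch c) = c ^ r" using * s f by simp
  have "\<bar>ldet (shear 0)\<bar> = \<bar>\<sigma>\<bar> * \<bar>poly p' 1\<bar>" using *(2) h[of 0] by (simp flip: abs_mult)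
  then show "\<bar>ldet (shear 0)\<bar> = of_int (poly p 1)" using \<open>\<bar>\<sigma>\<bar> = 1\<close> p'_1 pos by simp
qed

text \<open>Finite index replaces the choice of a basis, so that multiples of \<open>L'\<close> are
  handled exactly like \<open>L'\<close> itself.\<close>

definition sublattice :: "'v set \<Rightarrow> bool" where
  "sublattice M \<longleftrightarrow> add_subgroup M \<and> M \<subseteq> L \<and> F ` M \<subseteq> M \<and> index L M > 0"

text \<open>The subgroup divided out in the separation group. It is the part of \<open>M\<close> on
  which the components in \<open>VF\<close> and in \<open>W\<close> can be treated
  independently.\<close>

definition split_part :: "'v set \<Rightarrow> 'v set" where
  "split_part M = (M \<inter> VF) + (M \<inter> W)"

lemma add_subgroup_split_part: "add_subgroup M \<Longrightarrow> add_subgroup (split_part M)"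
  unfolding split_part_def
  by (intro add_subgroup_plus add_subgroup_Int add_subgroup_VF add_subgroup_W)

lemma split_part_subset: "add_subgroup M \<Longrightarrow> split_part M \<subseteq> M"
  unfolding split_part_def by (rule plus_subset_add_subgroup) auto

lemma sublattice_N: "sublattice M \<Longrightarrow> v \<in> M \<Longrightarrow> N v \<in> M"
  unfolding sublattice_def N_def by (blast intro: add_subgroup_diff)

text \<open>If \<open>k\<close> clears the denominators of \<open>P\<close> on \<open>L\<close> and
  \<open>m\<close> is the index of \<open>M\<close>, then \<open>m * k\<close> times any lattice
  vector has both components in \<open>M\<close>.\<close>

lemma index_split_part_pos:
  assumes M: "sublattice M" shows "index L (split_part M) > 0"
proof -
  have sM: "add_subgroup M" "M \<subseteq> L" "index L M > 0" using M by (auto simp: sublattice_def)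
  obtain k :: nat where k: "k > 0" "\<And>v. v \<in> L \<Longrightarrow> of_nat k *s P v \<in> L"
    using lin_clear_denominators[OF lin_P] by blast
  define m where "m = index L M"
  have mM: "of_nat m *s v \<in> M" if "v \<in> L" for v
    using zmul_index_mem[OF add_subgroup_L sM(1,2) that] by (simp add: zmul_scale m_def)
  have "of_nat (m * k) *s v \<in> split_part M" if v: "v \<in> L" for v
  proof -
    have 1: "of_nat (m * k) *s P v \<in> M \<inter> VF"
      using mM[OF k(2)[OF v]] P_VF[of v] by (auto simp: VF_iff lin_simps)
    have "of_nat (m * k) *s v \<in> M"
      using mM[OF add_subgroup_scale_mem[OF add_subgroup_L v, of k]] by simp
    then have "of_nat (m * k) *s (v - P v) \<in> M"
      using 1 add_subgroup_diff[OF sM(1)] by (simp add: scale_right_diff_distrib)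
    moreover have "of_nat (m * k) *s (v - P v) \<in> W"
    proof -
      obtain u where "v - P v = N u" using P_W[of v] unfolding W_eq by blast
      then show ?thesis unfolding W_eq by (metis lin_scale[OF lin_N] rangeI)
    qed
    moreover have "of_nat (m * k) *s v = of_nat (m * k) *s P v + of_nat (m * k) *s (v - P v)"
      by (simp add: scale_right_diff_distrib)
    ultimately show ?thesis using 1 unfolding split_part_def by (metis IntI set_plus_intro)
  qed
  then show ?thesis
    using index_L_pos[OF add_subgroup_split_part[OF sM(1)] _ _ , of "m * k"] split_part_subset[OF sM(1)] sM k
    by (simp add: m_def)
qed

text \<open>Both maps are applied to the split part of \<open>M\<close>. \<open>shear 0\<close>
  shrinks only its component in \<open>W\<close>, to \<open>N\<close> applied to it, and
  \<open>stretch e\<close> only its component in \<open>VF\<close>; so each determinant is the index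
  of a single component.\<close>

lemma
  assumes char: "char_poly (lattice_mat scale d b F) = [:-1, 1:] ^ r * p \<or>
         char_poly (lattice_mat scale d b F) = - ([:-1, 1:] ^ r * p)"
    and pos: "poly p 1 > 0" and M: "sublattice M"
  shows index_moved: "int (index (M \<inter> W) (N ` (M \<inter> W))) = poly p 1"
    and index_fixed: "e > 0 \<Longrightarrow> index (M \<inter> VF) ((*s) (of_nat e) ` (M \<inter> VF)) = e ^ r"
proof -
  have sM: "add_subgroup M" "M \<subseteq> L" using M by (auto simp: sublattice_def)
  let ?U = "M \<inter> VF" and ?X = "M \<inter> W" and ?S = "split_part M"
  have U: "add_subgroup ?U" and X: "add_subgroup ?X"
    using sM by (auto intro: add_subgroup_Int add_subgroup_VF add_subgroup_W)
  have S: "add_subgroup ?S" "?S \<subseteq> L" "index L ?S > 0"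
    using add_subgroup_split_part split_part_subset index_split_part_pos[OF M] sM by blast+
  have disj: "?U \<inter> ?X = {0}" using VF_W_disjoint add_subgroup_zero[OF U] add_subgroup_zero[OF X] by auto
  have NX: "add_subgroup (N ` ?X)" "N ` ?X \<subseteq> ?X"
    using add_subgroup_image[OF lin_diff[OF lin_N] X] sublattice_N[OF M] by (auto simp: W_eq)
  have shear: "shear 0 (u + x) = u + N (- x)" if "u \<in> ?U" "x \<in> ?X" for u x
    using that P_fixed[of u] P_moved[of x] lin_diff[OF lin_N, of 0 x]
    by (simp add: shear_def lin_simps VF_iff lin_zero[OF lin_N])
  have "shear 0 ` ?S = ?U + N ` ?X"
  proof
    show "shear 0 ` ?S \<subseteq> ?U + N ` ?X"
    proof
      fix y assume "y \<in> shear 0 ` ?S"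
      then obtain u x where ux: "u \<in> ?U" "x \<in> ?X" "y = shear 0 (u + x)"
        unfolding split_part_def by (auto elim!: set_plus_elim)
      then show "y \<in> ?U + N ` ?X"
        using shear[OF ux(1,2)] set_plus_intro[OF ux(1) imageI[OF add_subgroup_uminus[OF X ux(2)]]] by simp
    qed
    show "?U + N ` ?X \<subseteq> shear 0 ` ?S"
    proof
      fix y assume "y \<in> ?U + N ` ?X"
      then obtain u x where ux: "u \<in> ?U" "x \<in> ?X" "y = u + N x" by (auto elim!: set_plus_elim)
      have "y = shear 0 (u + - x)" using shear[OF ux(1) add_subgroup_uminus[OF X ux(2)]] ux(3) by simp
      moreover have "u + - x \<in> ?S"
        unfolding split_part_def using ux(1) add_subgroup_uminus[OF X ux(2)] by (rule set_plus_intro)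
      ultimately show "y \<in> shear 0 ` ?S" by blast
    qed
  qed
  moreover have "?U + N ` ?X \<subseteq> ?S" unfolding split_part_def by (rule set_plus_mono2) (use NX in auto)
  ultimately have "of_nat (index ?S (?U + N ` ?X)) = (of_int (poly p 1) :: rat)"
    using index_endomorphism_sublattice[OF lin_shear inj_shear_0 S] char_poly_determinants(2)[OF char pos] by simp
  moreover have "index ?S (?U + N ` ?X) = index ?X (N ` ?X)"
    unfolding split_part_def by (rule index_direct_sum[OF U X NX disj])
  ultimately have "of_int (int (index ?X (N ` ?X))) = (of_int (poly p 1) :: rat)" by simp
  then show "int (index ?X (N ` ?X)) = poly p 1" by (simp only: of_int_eq_iff)
  show "index ?U ((*s) (of_nat e) ` ?U) = e ^ r" if e: "e > 0"
  proof -
    let ?e = "(*s) (of_nat e :: rat)"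
    have eU: "add_subgroup (?e ` ?U)" "?e ` ?U \<subseteq> ?U"
      using add_subgroup_image[OF _ U, of ?e] add_subgroup_scale_mem[OF U] by (auto simp: scale_right_diff_distrib)
    have st: "stretch (of_nat e) (u + x) = ?e u + x" if "u \<in> ?U" "x \<in> ?X" for u x
      using that P_fixed[of u] P_moved[of x] by (simp add: stretch_def lin_simps)
    have "stretch (of_nat e) ` ?S = ?e ` ?U + ?X"
    proof
      show "stretch (of_nat e) ` ?S \<subseteq> ?e ` ?U + ?X"
      proof
        fix y assume "y \<in> stretch (of_nat e) ` ?S"
        then obtain u x where ux: "u \<in> ?U" "x \<in> ?X" "y = stretch (of_nat e) (u + x)"
          unfolding split_part_def by (auto elim!: set_plus_elim)
        then show "y \<in> ?e ` ?U + ?X"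
          using st[OF ux(1,2)] set_plus_intro[OF imageI[OF ux(1)] ux(2)] by simp
      qed
      show "?e ` ?U + ?X \<subseteq> stretch (of_nat e) ` ?S"
      proof
        fix y assume "y \<in> ?e ` ?U + ?X"
        then obtain u x where ux: "u \<in> ?U" "x \<in> ?X" "y = ?e u + x" by (auto elim!: set_plus_elim)
        then show "y \<in> stretch (of_nat e) ` ?S" unfolding split_part_def using st by (metis imageI set_plus_intro)
      qed
    qed
    moreover have "?e ` ?U + ?X \<subseteq> ?S" unfolding split_part_def by (rule set_plus_mono2) (use eU in auto)
    ultimately have "of_nat (index ?S (?e ` ?U + ?X)) = (of_nat e ^ r :: rat)"
      using index_endomorphism_sublattice[OF lin_stretch inj_stretch S, of "of_nat e"]
        char_poly_determinants(1)[OF char pos] e by simp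
    moreover have "index ?S (?e ` ?U + ?X) = index ?U (?e ` ?U)"
      unfolding split_part_def using index_direct_sum[OF X U eU] disj by (simp add: add.commute Int_commute)
    ultimately have "(of_nat (index ?U (?e ` ?U)) :: rat) = of_nat (e ^ r)" by simp
    then show ?thesis by (simp only: of_nat_eq_iff)
  qed
qed

end

section \<open>Counting fixed points\<close>

context lattice_endomorphism
begin

lemma add_subgroup_N_preimage: "add_subgroup M \<Longrightarrow> add_subgroup {v. N v \<in> M}"
  by (rule add_subgroupI) (auto simp: lin_zero[OF lin_N] lin_diff[OF lin_N] add_subgroup_closed)

lemma add_subgroup_fixed_mod:
  assumes "add_subgroup A" "add_subgroup M" shows "add_subgroup {v \<in> A. N v \<in> M}"
  using add_subgroup_Int[OF assms(1) add_subgroup_N_preimage[OF assms(2)]] by (simp add: Int_def)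

lemma card_quotient_fixed:
  assumes A: "add_subgroup A" and M: "add_subgroup M" and stable: "F ` M \<subseteq> M"
  shows "card (quotient_fixed F A M) = index {v \<in> A. N v \<in> M} M"
proof -
  have image: "M + F ` coset M x = coset M (F x)" for x
  proof
    show "M + F ` coset M x \<subseteq> coset M (F x)"
    proof
      fix y assume "y \<in> M + F ` coset M x"
      then obtain m c where mc: "m \<in> M" "c - x \<in> M" "y = m + F c"
        by (auto elim!: set_plus_elim simp: coset_altdef)
      have "F (c - x) \<in> M" using stable mc by blast
      then have "m + F (c - x) \<in> M" by (rule add_subgroup_add[OF M mc(1)])
      then show "y \<in> coset M (F x)" using mc by (simp add: coset_altdef lin_diff[OF lin_F] algebra_simps)
    qed
    show "coset M (F x) \<subseteq> M + F ` coset M x"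
    proof
      fix y assume "y \<in> coset M (F x)"
      then have "y - F x \<in> M" by (simp add: coset_altdef)
      moreover have "F x \<in> F ` coset M x" using add_subgroup_zero[OF M] by (simp add: coset_altdef)
      ultimately have "(y - F x) + F x \<in> M + F ` coset M x" by (rule set_plus_intro)
      then show "y \<in> M + F ` coset M x" by simp
    qed
  qed
  have "quotient_fixed F A M = coset M ` {v \<in> A. N v \<in> M}"
    unfolding quotient_fixed_def carrier_Mod
  proof (intro equalityI subsetI)
    fix C assume "C \<in> {C \<in> coset M ` A. M + F ` C = C}"
    then obtain x where "x \<in> A" "C = coset M x" "coset M (F x) = coset M x" using image by auto
    then show "C \<in> coset M ` {v \<in> A. N v \<in> M}" unfolding coset_eq_iff[OF M] N_def by blast
  next
    fix C assume "C \<in> coset M ` {v \<in> A. N v \<in> M}"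
    then obtain x where "x \<in> A" "N x \<in> M" "C = coset M x" by blast
    then show "C \<in> {C \<in> coset M ` A. M + F ` C = C}"
      using image[of x] coset_eq_iff[OF M, of "F x" x] by (simp add: N_def)
  qed
  then show ?thesis by (simp add: index_altdef)
qed

abbreviation B_num :: "'v set \<Rightarrow> 'v set" where
  "B_num M \<equiv> L + {v. N v \<in> M}"

abbreviation B_den :: "'v set" where
  "B_den \<equiv> L + VF"

lemma add_subgroup_B_num: "add_subgroup M \<Longrightarrow> add_subgroup (B_num M)"
  by (rule add_subgroup_plus[OF add_subgroup_L add_subgroup_N_preimage])

lemma add_subgroup_B_den: "add_subgroup B_den"
  by (rule add_subgroup_plus[OF add_subgroup_L add_subgroup_VF])

lemma B_den_subset: "add_subgroup M \<Longrightarrow> B_den \<subseteq> B_num M"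
  by (rule set_plus_mono2) (auto simp: VF_iff add_subgroup_zero)

lemma N_mem_iff:
  "N v \<in> N ` A \<longleftrightarrow> (\<exists>a\<in>A. v - a \<in> VF)"
proof -
  have "N v = N a \<longleftrightarrow> v - a \<in> VF" for a by (simp add: VF_iff lin_diff[OF lin_N])
  then show ?thesis by blast
qed

lemma plus_VF_iff: "v \<in> A + VF \<longleftrightarrow> (\<exists>a\<in>A. v - a \<in> VF)"
proof
  assume "v \<in> A + VF"
  then obtain a f where "a \<in> A" "f \<in> VF" "v = a + f" by (rule set_plus_elim)
  then show "\<exists>a\<in>A. v - a \<in> VF" by (intro bexI[of _ a]) auto
next
  assume "\<exists>a\<in>A. v - a \<in> VF"
  then obtain a where "a \<in> A" "v - a \<in> VF" by blast
  then have "a + (v - a) \<in> A + VF" by (rule set_plus_intro)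
  then show "v \<in> A + VF" by simp
qed

text \<open>Modulo \<open>B_den\<close>, every class of \<open>B_num M\<close> has a representative
  with \<open>N v \<in> M\<close>. On these \<open>N\<close> maps onto \<open>M \<inter> W\<close>,
  and \<open>N v \<in> N L\<close> says precisely that \<open>v \<in> L + VF\<close>.\<close>

lemma index_B:
  assumes M: "add_subgroup M"
  shows "index (B_num M) B_den = index (M \<inter> W) (M \<inter> N ` L)"
proof -
  let ?C = "{v. N v \<in> M}"
  have C: "add_subgroup ?C" by (rule add_subgroup_N_preimage[OF M])
  have "B_num M = ?C + B_den"
  proof
    show "B_num M \<subseteq> ?C + B_den"
      using set_plus_mono2[OF subset_plus_left[OF add_subgroup_VF, of L] subset_refl, of ?C]
      by (simp add: add.commute)
    show "?C + B_den \<subseteq> B_num M"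
      by (rule plus_subset_add_subgroup[OF add_subgroup_B_num[OF M] subset_plus_right[OF add_subgroup_L] B_den_subset[OF M]])
  qed
  then have "index (B_num M) B_den = index ?C (?C \<inter> B_den)"
    using index_plus_right[OF C add_subgroup_B_den] by simp
  also have "\<dots> = index (M \<inter> W) (M \<inter> N ` L)"
  proof (rule index_eqI[where f = N])
    show "add_subgroup (M \<inter> N ` L)"
      by (rule add_subgroup_Int[OF M add_subgroup_image[OF lin_diff[OF lin_N] add_subgroup_L]])
    show "N a - N c \<in> M \<inter> N ` L \<longleftrightarrow> a - c \<in> ?C \<inter> B_den" for a c
      by (simp add: lin_diff[OF lin_N, symmetric] N_mem_iff plus_VF_iff)
    show "\<exists>a\<in>?C. N a - y \<in> M \<inter> N ` L" if y: "y \<in> M \<inter> W" for y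
    proof -
      obtain a where a: "y = N a" "a \<in> ?C" using y unfolding W_eq by blast
      have "N a - y \<in> M \<inter> N ` L"
        using a add_subgroup_zero[OF M] add_subgroup_zero[OF add_subgroup_image[OF lin_diff[OF lin_N] add_subgroup_L]]
        by simp
      then show ?thesis using a by blast
    qed
  qed (auto simp: W_eq add_subgroup_Int[OF C add_subgroup_B_den])
  finally show ?thesis .
qed

text \<open>The order of the kernel of the map of coinvariants
  \<open>M / N M \<rightarrow> L / N L\<close>.\<close>

definition defect :: "'v set \<Rightarrow> nat" where
  "defect M = index (M \<inter> N ` L) (N ` M)"

text \<open>The intermediate group \<open>M + L^F\<close> collects the cosets that contain a truly
  fixed vector; \<open>N\<close> identifies the rest with the quotient counted by
  \<open>defect M\<close>.\<close>

lemma index_fixed_points: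
  assumes M: "sublattice M"
  shows "index {v \<in> L. N v \<in> M} M = index (L \<inter> VF) (M \<inter> VF) * defect M"
proof -
  have sM: "add_subgroup M" "M \<subseteq> L" using M by (auto simp: sublattice_def)
  let ?T = "{v \<in> L. N v \<in> M}" and ?LF = "L \<inter> VF"
  have T: "add_subgroup ?T" by (rule add_subgroup_fixed_mod[OF add_subgroup_L sM(1)])
  have LF: "add_subgroup ?LF" by (rule add_subgroup_Int[OF add_subgroup_L add_subgroup_VF])
  have sum: "add_subgroup (M + ?LF)" by (rule add_subgroup_plus[OF sM(1) LF])
  have sub: "M + ?LF \<subseteq> ?T"
    by (rule plus_subset_add_subgroup[OF T])
      (use sM sublattice_N[OF M] in \<open>auto simp: VF_iff add_subgroup_zero\<close>)
  have "index ?T M = index ?T (M + ?LF) * index (M + ?LF) M"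
    by (rule index_mult[OF T sum sM(1) subset_plus_left[OF LF] sub])
  moreover have "index (M + ?LF) M = index ?LF (M \<inter> VF)"
  proof -
    have "M \<inter> ?LF = M \<inter> VF" using sM(2) by blast
    then show ?thesis using index_plus_left[OF sM(1) LF] by simp
  qed
  moreover have "index ?T (M + ?LF) = defect M"
    unfolding defect_def
  proof (rule index_eqI[where f = N])
    show "add_subgroup (N ` M)" by (rule add_subgroup_image[OF lin_diff[OF lin_N] sM(1)])
    show "N a - N c \<in> N ` M \<longleftrightarrow> a - c \<in> M + ?LF" if "a \<in> ?T" "c \<in> ?T" for a c
    proof -
      have L: "a - c \<in> L" using that add_subgroup_diff[OF add_subgroup_L] by blast
      have "a - c \<in> M + ?LF \<longleftrightarrow> (\<exists>m\<in>M. a - c - m \<in> VF)"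
      proof
        assume "a - c \<in> M + ?LF"
        then obtain m f where "m \<in> M" "f \<in> ?LF" "a - c = m + f" by (rule set_plus_elim)
        then show "\<exists>m\<in>M. a - c - m \<in> VF" by (intro bexI[of _ m]) auto
      next
        assume "\<exists>m\<in>M. a - c - m \<in> VF"
        then obtain m where m: "m \<in> M" "a - c - m \<in> VF" by blast
        then have "a - c - m \<in> ?LF" using L sM(2) add_subgroup_diff[OF add_subgroup_L] by blast
        then have "m + (a - c - m) \<in> M + ?LF" by (rule set_plus_intro[OF m(1)])
        then show "a - c \<in> M + ?LF" by simp
      qed
      then show ?thesis by (simp add: lin_diff[OF lin_N, symmetric] N_mem_iff)
    qed
    show "\<exists>a\<in>?T. N a - y \<in> N ` M" if y: "y \<in> M \<inter> N ` L" for y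
    proof -
      obtain a where "a \<in> L" "y = N a" using y by blast
      then show ?thesis
        using y add_subgroup_zero[OF add_subgroup_image[OF lin_diff[OF lin_N] sM(1)]]
        by (intro bexI[of _ a]) auto
    qed
  qed (use sum in auto)
  ultimately show ?thesis by simp
qed

lemma index_moved_product:
  assumes M: "sublattice M"
  shows "index (M \<inter> W) (N ` (M \<inter> W)) = index (B_num M) B_den * defect M * index M (split_part M)"
proof -
  have sM: "add_subgroup M" using M by (auto simp: sublattice_def)
  have X: "add_subgroup (M \<inter> W)" by (rule add_subgroup_Int[OF sM add_subgroup_W])
  have img: "add_subgroup (N ` A)" if "add_subgroup A" for A
    by (rule add_subgroup_image[OF lin_diff[OF lin_N] that])
  have MNL: "add_subgroup (M \<inter> N ` L)" by (rule add_subgroup_Int[OF sM img[OF add_subgroup_L]])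
  have NM: "N ` M \<subseteq> M \<inter> N ` L"
    using sublattice_N[OF M] M by (auto simp: sublattice_def)
  have NMW: "N ` M \<subseteq> M \<inter> W" and MNLW: "M \<inter> N ` L \<subseteq> M \<inter> W" using NM by (auto simp: W_eq)
  have 1: "index (M \<inter> W) (N ` (M \<inter> W)) = index (M \<inter> W) (N ` M) * index (N ` M) (N ` (M \<inter> W))"
    by (rule index_mult[OF X img[OF sM] img[OF X] _ NMW]) auto
  have 2: "index (M \<inter> W) (N ` M) = index (M \<inter> W) (M \<inter> N ` L) * defect M"
    unfolding defect_def by (rule index_mult[OF X MNL img[OF sM] NM MNLW])
  have 3: "index M (split_part M) = index (N ` M) (N ` (M \<inter> W))"
  proof (rule index_eqI[where f = N])
    show "N a - N c \<in> N ` (M \<inter> W) \<longleftrightarrow> a - c \<in> split_part M" if "a \<in> M" "c \<in> M" for a c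
    proof -
      have ac: "a - c \<in> M" using that add_subgroup_diff[OF sM] by blast
      have "a - c \<in> split_part M \<longleftrightarrow> (\<exists>m\<in>M \<inter> W. a - c - m \<in> VF)"
      proof
        assume "a - c \<in> split_part M"
        then obtain u w where "u \<in> M \<inter> VF" "w \<in> M \<inter> W" "a - c = u + w"
          unfolding split_part_def by (rule set_plus_elim)
        then show "\<exists>m\<in>M \<inter> W. a - c - m \<in> VF" by (intro bexI[of _ w]) auto
      next
        assume "\<exists>m\<in>M \<inter> W. a - c - m \<in> VF"
        then obtain m where m: "m \<in> M \<inter> W" "a - c - m \<in> VF" by blast
        then have "a - c - m \<in> M \<inter> VF" using ac add_subgroup_diff[OF sM] by blast
        then have "(a - c - m) + m \<in> split_part M" unfolding split_part_def by (rule set_plus_intro[OF _ m(1)])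
        then show "a - c \<in> split_part M" by simp
      qed
      then show ?thesis by (simp add: lin_diff[OF lin_N, symmetric] N_mem_iff)
    qed
    show "\<exists>a\<in>M. N a - y \<in> N ` (M \<inter> W)" if y: "y \<in> N ` M" for y
    proof -
      obtain a where "a \<in> M" "y = N a" using y by blast
      then show ?thesis using add_subgroup_zero[OF img[OF X]] by (intro bexI[of _ a]) auto
    qed
  qed (use img[OF X] add_subgroup_split_part[OF sM] in auto)
  show ?thesis unfolding 1 2 3 index_B[OF sM] by simp
qed

lemma sublattice_scale:
  assumes M: "sublattice M" and e: "e > 0"
  shows "sublattice ((*s) (of_nat e) ` M)"
proof -
  let ?e = "(*s) (of_nat e :: rat)"
  have sM: "add_subgroup M" "M \<subseteq> L" "F ` M \<subseteq> M" "index L M > 0" using M by (auto simp: sublattice_def)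
  have sub: "?e ` M \<subseteq> M" using add_subgroup_scale_mem[OF sM(1)] by blast
  have seM: "add_subgroup (?e ` M)" by (rule add_subgroup_image[OF _ sM(1)]) (simp add: scale_right_diff_distrib)
  have "F ` ?e ` M = ?e ` F ` M" by (simp add: image_image lin_scale[OF lin_F])
  then have "F ` ?e ` M \<subseteq> ?e ` M" using image_mono[OF sM(3), of ?e] by simp
  moreover have "index L (?e ` M) > 0"
  proof (rule index_L_pos[OF seM])
    show "of_nat (e * index L M) *s v \<in> ?e ` M" if "v \<in> L" for v
    proof -
      have "of_nat (index L M) *s v \<in> M"
        using zmul_index_mem[OF add_subgroup_L sM(1,2) that] by (simp add: zmul_scale)
      then show ?thesis using image_eqI[of _ ?e "of_nat (index L M) *s v"] by simp
    qed
  qed (use sub sM e in auto)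
  ultimately show ?thesis using seM sub sM by (auto simp: sublattice_def)
qed

lemma scale_mem_VF_iff: "q \<noteq> 0 \<Longrightarrow> q *s v \<in> VF \<longleftrightarrow> v \<in> VF"
  by (simp add: VF_iff lin_simps)

lemma scale_mem_W_iff:
  assumes "q \<noteq> 0" shows "q *s v \<in> W \<longleftrightarrow> v \<in> W"
proof -
  have sc: "c *s w \<in> W" if "w \<in> W" for c w
    using that unfolding W_eq by (metis imageE lin_scale[OF lin_N] rangeI)
  have "inverse q *s (q *s v) = v" using assms by simp
  then show ?thesis using sc[of "q *s v" "inverse q"] sc[of v q] by auto
qed

text \<open>\<open>index_moved_product\<close> has the same value for \<open>M\<close> and
  \<open>e M\<close>, and the separation index does not change under scaling. Hence the defect gains
  exactly the factor that the index of \<open>B\<close> loses.\<close>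

lemma defect_scale:
  assumes M: "sublattice M" and e: "e > 0"
    and fin: "index (M \<inter> W) (N ` (M \<inter> W)) > 0"
    and fin': "index ((*s) (of_nat e) ` M \<inter> W) (N ` ((*s) (of_nat e) ` M \<inter> W))
      = index (M \<inter> W) (N ` (M \<inter> W))"
  shows "defect ((*s) (of_nat e) ` M) =
    defect M * index {t \<in> B_num M. zmul (int e) t \<in> B_den} B_den"
proof -
  let ?e = "(*s) (of_nat e :: rat)"
  let ?Te = "{t \<in> B_num M. zmul (int e) t \<in> B_den}"
  have sM: "add_subgroup M" using M by (auto simp: sublattice_def)
  have eM: "sublattice (?e ` M)" by (rule sublattice_scale[OF M e])
  then have seM: "add_subgroup (?e ` M)" by (simp add: sublattice_def)
  have "split_part (?e ` M) = ?e ` split_part M"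
  proof -
    have "?e ` M \<inter> VF = ?e ` (M \<inter> VF)" "?e ` M \<inter> W = ?e ` (M \<inter> W)"
      using e scale_mem_VF_iff[of "of_nat e"] scale_mem_W_iff[of "of_nat e"] by auto
    moreover have "?e ` A + ?e ` B = ?e ` (A + B)" for A B
    proof (intro equalityI subsetI)
      fix y assume "y \<in> ?e ` A + ?e ` B"
      then obtain a b where "a \<in> A" "b \<in> B" "y = ?e a + ?e b" by (auto elim!: set_plus_elim)
      then show "y \<in> ?e ` (A + B)"
        using imageI[OF set_plus_intro, of a A b B ?e] by (simp add: scale_right_distrib)
    next
      fix y assume "y \<in> ?e ` (A + B)"
      then obtain a b where "a \<in> A" "b \<in> B" "y = ?e (a + b)" by (auto elim!: set_plus_elim)
      then show "y \<in> ?e ` A + ?e ` B"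
        using set_plus_intro[OF imageI[of a A ?e] imageI[of b B ?e]] by (simp add: scale_right_distrib)
    qed
    ultimately show ?thesis by (simp add: split_part_def)
  qed
  then have T: "index (?e ` M) (split_part (?e ` M)) = index M (split_part M)"
    using index_scale_image[OF _ sM add_subgroup_split_part[OF sM] split_part_subset[OF sM], of "of_nat e"] e
    by simp
  have Te: "add_subgroup ?Te" "?Te \<subseteq> B_num M" "B_den \<subseteq> ?Te"
  proof -
    show "add_subgroup ?Te"
      using add_subgroup_B_num[OF sM] add_subgroup_B_den
      by (auto intro!: add_subgroupI simp: add_subgroup_closed zmul_diff_right)
    show "B_den \<subseteq> ?Te" using B_den_subset[OF sM] add_subgroup_zmul[OF add_subgroup_B_den] by blast
  qed auto
  \<comment> \<open>Multiplication by \<open>e\<close> carries \<open>B_num M\<close> onto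
    \<open>B_num (e M)\<close> modulo \<open>B_den\<close>, with kernel the preimage
    \<open>?Te\<close> of the \<open>e\<close>-torsion.\<close>
  have "index (B_num M) ?Te = index (B_num (?e ` M)) B_den"
  proof (rule index_eqI[where f = "zmul (int e)"])
    show "zmul (int e) a \<in> B_num (?e ` M)" if a: "a \<in> B_num M" for a
    proof -
      obtain l c where "l \<in> L" "N c \<in> M" "a = l + c" using a by (auto elim!: set_plus_elim)
      then have "?e l \<in> L" "N (?e c) \<in> ?e ` M" "?e a = ?e l + ?e c"
        by (auto simp: add_subgroup_scale_mem[OF add_subgroup_L] lin_simps scale_right_distrib)
      then show ?thesis by (auto simp: zmul_scale)
    qed
    show "zmul (int e) a - zmul (int e) c \<in> B_den \<longleftrightarrow> a - c \<in> ?Te" if "a \<in> B_num M" "c \<in> B_num M" for a c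
      using add_subgroup_diff[OF add_subgroup_B_num[OF sM] that] by (simp add: zmul_diff_right)
    show "\<exists>a\<in>B_num M. zmul (int e) a - y \<in> B_den" if y: "y \<in> B_num (?e ` M)" for y
    proof -
      obtain l c m where lc: "l \<in> L" "m \<in> M" "N c = ?e m" "y = l + c" using y by (auto elim!: set_plus_elim)
      let ?c = "inverse (of_nat e) *s c"
      have "N ?c = m" using lc e by (simp add: lin_simps)
      then have "0 + ?c \<in> B_num M" using lc add_subgroup_zero[OF add_subgroup_L] by (intro set_plus_intro) auto
      moreover have "zmul (int e) ?c - y = - l + 0" using lc e by (simp add: zmul_scale)
      moreover have "- l + 0 \<in> B_den"
        using lc by (intro set_plus_intro) (auto simp: add_subgroup_uminus[OF add_subgroup_L] add_subgroup_zero[OF add_subgroup_VF])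
      ultimately show ?thesis by (metis add_0)
    qed
  qed (use Te add_subgroup_B_den in auto)
  then have B: "index (B_num M) B_den = index (B_num (?e ` M)) B_den * index ?Te B_den"
    using index_mult[OF add_subgroup_B_num[OF sM] Te(1) add_subgroup_B_den Te(3,2)] by simp
  have "index (B_num (?e ` M)) B_den * defect (?e ` M) * index M (split_part M) =
      index (B_num M) B_den * defect M * index M (split_part M)"
    using index_moved_product[OF M] index_moved_product[OF eM] fin' T by (simp only:)
  moreover have "index M (split_part M) > 0" "index (B_num (?e ` M)) B_den > 0"
    using fin index_moved_product[OF M] B by (auto intro: gr0I)
  ultimately show ?thesis using B by simp
qed

end

section \<open>Dual lattices\<close>

locale self_dual_endomorphism = lattice_endomorphism scale d b L F
  for scale :: "rat \<Rightarrow> 'v::ab_group_add \<Rightarrow> 'v" (infixr \<open>*s\<close> 75) and d b L F +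
  fixes \<beta> :: "'v \<Rightarrow> 'v \<Rightarrow> rat" and L' :: "'v set"
  assumes form: "nondegenerate_symmetric_form scale \<beta>"
    and invariant: "\<beta> (F v) (F w) = \<beta> v w"
    and dual: "L' = dual_lattice \<beta> L"
    and sublattice_L': "sublattice L'"
begin

lemma \<beta>_sym: "\<beta> v w = \<beta> w v"
  using form by (simp add: nondegenerate_symmetric_form_def)

lemma \<beta>_add_right: "\<beta> v (x + y) = \<beta> v x + \<beta> v y"
  and \<beta>_scale_right: "\<beta> v (q *s x) = q * \<beta> v x"
  using form by (auto simp: nondegenerate_symmetric_form_def Vector_Spaces.linear_iff)

lemma \<beta>_add_left: "\<beta> (x + y) v = \<beta> x v + \<beta> y v"
  and \<beta>_scale_left: "\<beta> (q *s x) v = q * \<beta> x v"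
  by (simp_all add: \<beta>_sym[of _ v] \<beta>_add_right \<beta>_scale_right)

lemma \<beta>_zero_right [simp]: "\<beta> v 0 = 0"
  using \<beta>_scale_right[of v 0 0] by simp

lemma \<beta>_zero_left [simp]: "\<beta> 0 v = 0"
  by (simp add: \<beta>_sym[of 0])

lemma \<beta>_diff_right: "\<beta> v (x - y) = \<beta> v x - \<beta> v y"
  using \<beta>_add_right[of v "x - y" y] by simp

lemma \<beta>_diff_left: "\<beta> (x - y) v = \<beta> x v - \<beta> y v"
  by (simp add: \<beta>_sym[of _ v] \<beta>_diff_right)

lemmas \<beta>_simps = \<beta>_add_left \<beta>_add_right \<beta>_diff_left \<beta>_diff_right \<beta>_scale_left \<beta>_scale_right

lemma \<beta>_sum_right: "\<beta> v (sum f I) = (\<Sum>i\<in>I. \<beta> v (f i))"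
  by (induction I rule: infinite_finite_induct) (auto simp: \<beta>_add_right)

lemma \<beta>_nondegenerate: "(\<And>w. \<beta> v w = 0) \<Longrightarrow> v = 0"
  using form by (simp add: nondegenerate_symmetric_form_def)

lemma pairing_\<beta>: "add_subgroup A \<Longrightarrow> add_subgroup C \<Longrightarrow> pairing_mod_Z A C \<beta>"
  by (simp add: pairing_mod_Z_def additive_mod_Z_def \<beta>_simps)

text \<open>For fixed \<open>u\<close>, invariance reads
  \<open>\<beta> u (F w) = \<beta> u w\<close>.\<close>

lemma \<beta>_fixed_N: "u \<in> VF \<Longrightarrow> \<beta> u (N w) = 0"
  using invariant[of u w] by (simp add: fixed_space_def N_def \<beta>_diff_right)

lemma \<beta>_fixed_moved: "u \<in> VF \<Longrightarrow> w \<in> W \<Longrightarrow> \<beta> u w = 0"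
  unfolding W_eq using \<beta>_fixed_N by auto

text \<open>The projection is self-adjoint because \<open>VF\<close> and \<open>W\<close> are
  orthogonal.\<close>

lemma \<beta>_P: "\<beta> (P u) v = \<beta> u (P v)"
proof -
  have "\<beta> (P u) (v - P v) = 0" "\<beta> (P v) (u - P u) = 0" using \<beta>_fixed_moved[OF P_VF P_W] by auto
  then show ?thesis by (simp add: \<beta>_simps \<beta>_sym[of "P v"])
qed

lemma L'_iff: "v \<in> L' \<longleftrightarrow> (\<forall>l\<in>L. \<beta> v l \<in> \<int>)"
  by (simp add: dual dual_lattice_def)

lemma add_subgroup_L': "add_subgroup L'" and L'_subset: "L' \<subseteq> L"
  using sublattice_L' by (auto simp: sublattice_def)

text \<open>Nondegeneracy provides dual basis vectors \<open>w\<close>, with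
  \<open>\<beta> w\<close> the \<open>i\<close>-th coordinate. They lie in \<open>L'\<close>, so
  integrality against \<open>L'\<close> makes every coordinate integral.\<close>

lemma double_dual: "v \<in> L \<longleftrightarrow> (\<forall>l\<in>L'. \<beta> v l \<in> \<int>)"
proof
  assume "v \<in> L"
  then show "\<forall>l\<in>L'. \<beta> v l \<in> \<int>" using L'_iff \<beta>_sym by metis
next
  assume v: "\<forall>l\<in>L'. \<beta> v l \<in> \<int>"
  interpret fd: finite_dimensional_vector_space scale "b ` {..<d}"
    by unfold_locales (use basis in auto)
  interpret finite_dimensional_vector_space_pair scale "b ` {..<d}" scale "b ` {..<d}" ..
  define T where "T u = (\<Sum>j<d. \<beta> u (b j) *s b j)" for u
  have T: "lin T"
    by (simp add: lin_iff T_def \<beta>_simps scale_left_distrib sum.distrib scale_sum_right)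
  have coord_T: "coord j (T u) = \<beta> u (b j)" if "j < d" for j u
    unfolding T_def by (rule coord_combination[OF that])
  have expand: "\<beta> u w = (\<Sum>j<d. coord j w * \<beta> u (b j))" for u w
    by (subst expansion[of w]) (simp only: \<beta>_sum_right \<beta>_scale_right)
  have "inj T"
  proof (rule injI)
    fix x y assume "T x = T y"
    then have "\<beta> (x - y) (b j) = 0" if "j < d" for j
      using coord_T[OF that, of x] coord_T[OF that, of y] by (simp add: \<beta>_simps)
    then have "\<beta> (x - y) w = 0" for w using expand[of "x - y" w] by simp
    then show "x = y" using \<beta>_nondegenerate[of "x - y"] by simp
  qed
  then have "surj T" using linear_injective_imp_surjective[OF T] by simp
  show "v \<in> L"
    unfolding mem_L_iff
  proof (intro allI impI)
    fix i assume i: "i < d"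
    obtain w where w: "T w = b i" using \<open>surj T\<close> by (metis surjD)
    have wb: "\<beta> w (b j) = (if j = i then 1 else 0)" if "j < d" for j
      using coord_T[OF that, of w] w i that by (simp add: coord_basis)
    have *: "\<beta> w u = coord i u" for u
    proof -
      have "\<beta> w u = (\<Sum>j<d. if j = i then coord j u else 0)"
        unfolding expand[of w u] by (rule sum.cong) (auto simp: wb)
      then show ?thesis using i by simp
    qed
    then have "w \<in> L'" using i by (simp add: L'_iff mem_L_iff)
    then show "coord i v \<in> \<int>" using v *[of v] \<beta>_sym[of v w] by auto
  qed
qed

lemma sublattice_L: "sublattice L"
  using index_eq_1_iff[OF add_subgroup_L add_subgroup_L] F_stable add_subgroup_L by (simp add: sublattice_def)

section \<open>The pairings on the separation groups and on \<open>B\<close>\<close>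

lemma mem_split_part_iff:
  assumes "add_subgroup M" shows "v \<in> split_part M \<longleftrightarrow> v \<in> M \<and> P v \<in> M"
proof
  assume v: "v \<in> split_part M"
  then obtain u w where "u \<in> M \<inter> VF" "w \<in> M \<inter> W" "v = u + w"
    unfolding split_part_def by (rule set_plus_elim)
  then have "P v = u" by (simp add: lin_simps P_fixed P_moved)
  then show "v \<in> M \<and> P v \<in> M" using \<open>u \<in> M \<inter> VF\<close> split_part_subset[OF assms] v by auto
next
  assume v: "v \<in> M \<and> P v \<in> M"
  then have "P v \<in> M \<inter> VF" "v - P v \<in> M \<inter> W" using P_VF P_W add_subgroup_diff[OF assms] by auto
  then have "P v + (v - P v) \<in> split_part M" unfolding split_part_def by (rule set_plus_intro)
  then show "v \<in> split_part M" by simp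
qed

text \<open>The left kernel consists of the \<open>a\<close> with \<open>P a \<in> L\<close> by
  \<open>double_dual\<close>, the right one of the \<open>c\<close> with \<open>P c \<in> L'\<close>
  by self-adjointness of \<open>P\<close>; these are the two split parts.\<close>

theorem separation_groups_iso: "separation_group F L \<cong> separation_group F L'"
proof -
  define \<phi> where "\<phi> a c = \<beta> (P a) c" for a c
  have p: "pairing_mod_Z L L' \<phi>"
    using add_subgroup_L add_subgroup_L'
    by (simp add: pairing_mod_Z_def additive_mod_Z_def \<phi>_def \<beta>_simps lin_simps)
  have 1: "annihilator L L' \<phi> = split_part L"
    using double_dual by (auto simp: annihilator_def \<phi>_def mem_split_part_iff[OF add_subgroup_L])
  have 2: "annihilator L' L (\<lambda>c a. \<phi> a c) = split_part L'"
  proof -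
    have "\<phi> a c = \<beta> (P c) a" for a c using \<beta>_P[of a c] \<beta>_sym[of "P c" a] by (simp add: \<phi>_def)
    then show ?thesis using L'_iff by (auto simp: annihilator_def mem_split_part_iff[OF add_subgroup_L'])
  qed
  obtain R where "correspondence L (split_part L) L' (split_part L') R"
    using pairing_correspondence[OF p] index_split_part_pos[OF sublattice_L] 1 2 by auto
  then show ?thesis
    unfolding separation_group_def split_part_def[symmetric]
    by (rule correspondence_iso[OF _ add_subgroup_L add_subgroup_split_part[OF add_subgroup_L]
          split_part_subset[OF add_subgroup_L] add_subgroup_L' add_subgroup_split_part[OF add_subgroup_L']
          split_part_subset[OF add_subgroup_L']])
qed

text \<open>Write \<open>X\<^sup>\<or>\<close> for the dual of \<open>X \<subseteq> W\<close> inside \<open>W\<close>, and \<open>Q\<close> for the projection onto \<open>W\<close>. As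
  \<open>L \<inter> W = (Q L')\<^sup>\<or>\<close>, it equals its double dual. It has finite index in \<open>Q L\<close>, and duality preserves
  indices, so \<open>Q L\<close> equals its double dual as well.\<close>

lemma integral_on_moved_part:
  assumes v: "\<And>y. y \<in> L' \<inter> W \<Longrightarrow> \<beta> v y \<in> \<int>"
  shows "v \<in> B_den"
proof -
  define Q where "Q u = u - P u" for u
  have Q_W: "Q u \<in> W" for u by (simp add: Q_def P_W)
  have Q_id: "Q w = w" if "w \<in> W" for w using that by (simp add: Q_def P_moved)
  have Q_diff: "Q (x - y) = Q x - Q y" for x y by (simp add: Q_def lin_simps)
  have \<beta>_Q: "\<beta> w (Q u) = \<beta> w u" if "w \<in> W" for w u
    using \<beta>_fixed_moved[OF P_VF that, of u] \<beta>_sym[of w "P u"] by (simp add: Q_def \<beta>_simps)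
  define A where "A = Q ` L"
  define B where "B = L \<inter> W"
  define dl where "dl X = annihilator W X \<beta>" for X
  have A: "add_subgroup A" unfolding A_def by (rule add_subgroup_image[OF Q_diff add_subgroup_L])
  have B: "add_subgroup B" unfolding B_def by (rule add_subgroup_Int[OF add_subgroup_L add_subgroup_W])
  have AW: "A \<subseteq> W" using Q_W by (auto simp: A_def)
  have BA: "B \<subseteq> A" unfolding A_def B_def using Q_id by (metis IntE image_eqI subsetI)
  have dl: "add_subgroup (dl X)" for X
    unfolding dl_def by (rule add_subgroup_annihilator_subset[OF pairing_\<beta>[OF add_subgroup_W add_subgroup_UNIV]]) simp
  have dl_sub: "dl X \<subseteq> W" for X by (simp add: dl_def annihilator_subset)
  have dl_sym: "x \<in> X \<Longrightarrow> y \<in> dl X \<Longrightarrow> \<beta> x y \<in> \<int>" for x y X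
    using \<beta>_sym by (auto simp: dl_def annihilator_def)
  have dl_anti: "dl Y \<subseteq> dl X" if "X \<subseteq> Y" for X Y using that by (auto simp: dl_def annihilator_def)
  have dl_dl: "X \<subseteq> dl (dl X)" if "X \<subseteq> W" for X
    using that dl_sym by (auto simp: dl_def[of "dl X"] annihilator_def)
  \<comment> \<open>So the hypothesis on \<open>v\<close> says that its component \<open>Q v\<close>
    lies in the double dual of \<open>A = Q L\<close>; once that is \<open>A\<close> itself,
    \<open>v\<close> differs from a lattice vector by a fixed vector.\<close>
  have dlA: "dl A = L' \<inter> W"
    using \<beta>_Q by (auto simp: dl_def annihilator_def A_def L'_iff)
  have ddB: "dl (dl B) = B"
  proof
    show "dl (dl B) \<subseteq> B"
    proof
      fix w assume w: "w \<in> dl (dl B)"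
      then have wW: "w \<in> W" using dl_sub by blast
      have "\<beta> w l \<in> \<int>" if l: "l \<in> L'" for l
      proof -
        have "\<beta> (Q l) y \<in> \<int>" if y: "y \<in> B" for y
        proof -
          have "\<beta> (Q l) y = \<beta> l y"
            using \<beta>_Q[of y l] y \<beta>_sym[of y] by (simp add: B_def)
          then show ?thesis using l y L'_iff by (simp add: B_def)
        qed
        then have "Q l \<in> dl B" using Q_W by (simp add: dl_def annihilator_def)
        then have "\<beta> w (Q l) \<in> \<int>" using w by (auto simp: dl_def[of "dl B"] annihilator_def)
        then show ?thesis using \<beta>_Q[OF wW] by simp
      qed
      then show "w \<in> B" using wW double_dual by (simp add: B_def)
    qed
    show "B \<subseteq> dl (dl B)" by (rule dl_dl) (simp add: B_def)
  qed
  have ann: "annihilator X Y \<beta> = X \<inter> dl Y" if "X \<subseteq> W" for X Y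
    using that by (auto simp: dl_def annihilator_def)
  have swap: "(\<lambda>c a. \<beta> a c) = \<beta>" by (intro ext) (rule \<beta>_sym)
  have "index L (split_part L) = index A B"
  proof (rule index_eqI[where f = Q])
    show "Q a - Q c \<in> B \<longleftrightarrow> a - c \<in> split_part L" if ac: "a \<in> L" "c \<in> L" for a c
    proof -
      have L: "a - c \<in> L" using ac add_subgroup_diff[OF add_subgroup_L] by blast
      have "Q (a - c) \<in> L \<longleftrightarrow> P (a - c) \<in> L"
        unfolding Q_def using L add_subgroup_diff[OF add_subgroup_L, of "a - c"]
        by (metis diff_diff_eq2 add_diff_cancel_left')
      then show ?thesis
        using L Q_W[of "a - c"] by (simp add: mem_split_part_iff[OF add_subgroup_L] B_def Q_diff)
    qed
    show "\<exists>a\<in>L. Q a - y \<in> B" if y: "y \<in> A" for y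
    proof -
      obtain a where "a \<in> L" "y = Q a" using y by (auto simp: A_def)
      then show ?thesis using add_subgroup_zero[OF B] by (intro bexI[of _ a]) auto
    qed
  qed (use add_subgroup_split_part[OF add_subgroup_L] B in \<open>auto simp: A_def\<close>)
  then have fin: "index A B > 0" using index_split_part_pos[OF sublattice_L] by simp
  have annA: "annihilator A (dl B) \<beta> = B" using ann[OF AW, of "dl B"] ddB BA by auto
  have annB: "annihilator (dl B) A \<beta> = dl A" using ann[OF dl_sub] dl_anti[OF BA] by blast
  \<comment> \<open>The index of \<open>B\<close> in \<open>A\<close> equals that of the duals, and
    \<open>i2\<close> equates the latter with the index of \<open>B\<close> in the double dual of
    \<open>A\<close>; the inclusion of \<open>A\<close> there has index \<open>1\<close>.\<close>
  have i1: "index A B = index (dl B) (dl A)"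
    using pairing_index[OF pairing_\<beta>[OF A dl[of B]]] fin annA annB swap by simp
  have ddA: "A \<subseteq> dl (dl A)" by (rule dl_dl[OF AW])
  have annA': "annihilator (dl (dl A)) (dl B) \<beta> = B"
    using ann[OF dl_sub, of "dl A" "dl B"] ddB BA ddA by auto
  have "dl (dl (dl A)) = dl A" using dl_anti[OF ddA] dl_dl[OF dl_sub] by blast
  then have annB': "annihilator (dl B) (dl (dl A)) \<beta> = dl A"
    using ann[OF dl_sub] dl_anti[OF BA] by blast
  have i2: "index (dl B) (dl A) = index (dl (dl A)) B"
    using pairing_index[OF pairing_\<beta>[OF dl[of B] dl[of "dl A"]]] fin i1 annA' annB' swap by simp
  have "index (dl (dl A)) B = index (dl (dl A)) A * index A B" by (rule index_mult[OF dl A B BA ddA])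
  then have "index (dl (dl A)) A = 1" using i1 i2 fin by simp
  then have "dl (dl A) = A" using index_eq_1_iff[OF dl A ddA] by blast
  moreover have "Q v \<in> dl (dl A)"
  proof -
    have "\<beta> (Q v) y \<in> \<int>" if "y \<in> dl A" for y
      using that v[of y] \<beta>_Q[of y v] \<beta>_sym[of y] unfolding dlA by simp
    then show ?thesis using Q_W by (simp add: dl_def[of "dl A"] annihilator_def)
  qed
  ultimately obtain l where l: "l \<in> L" "Q v = Q l" by (auto simp: A_def)
  then have "v - l = P (v - l)" by (simp add: Q_def lin_simps algebra_simps)
  then have "v - l \<in> VF" using P_VF by metis
  then show ?thesis using l plus_VF_iff by blast
qed

text \<open>\<open>\<beta> v (N w)\<close> is used only for \<open>v\<close>, \<open>w\<close> in
  \<open>C\<close>, the vectors that \<open>N\<close> sends into \<open>L'\<close>. A class of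
  \<open>B_num L'\<close> is therefore evaluated at a chosen representative
  \<open>\<rho> t \<in> C\<close> modulo \<open>L\<close>.\<close>

lemma B_form:
  obtains \<phi> where "pairing_mod_Z (B_num L') (B_num L') \<phi>" "antisymmetric_mod_Z (B_num L') \<phi>"
    "annihilator (B_num L') (B_num L') \<phi> = B_den"
proof -
  define C where "C = {v. N v \<in> L'}"
  have C: "add_subgroup C" unfolding C_def by (rule add_subgroup_N_preimage[OF add_subgroup_L'])
  let ?T = "B_num L'"
  have T: "add_subgroup ?T" by (rule add_subgroup_B_num[OF add_subgroup_L'])
  have "\<exists>c\<in>C. t - c \<in> L" if t: "t \<in> ?T" for t
  proof -
    obtain l c where "l \<in> L" "c \<in> C" "t = l + c" using t unfolding C_def by (rule set_plus_elim)
    then show ?thesis by (intro bexI[of _ c]) auto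
  qed
  then obtain \<rho> where \<rho>: "\<And>t. t \<in> ?T \<Longrightarrow> \<rho> t \<in> C" "\<And>t. t \<in> ?T \<Longrightarrow> t - \<rho> t \<in> L" by metis
  have CT: "C \<subseteq> ?T" unfolding C_def by (rule subset_plus_right[OF add_subgroup_L])
  have den: "\<beta> v (N w) \<in> \<int>" if v: "v \<in> B_den" and w: "w \<in> C" for v w
  proof -
    obtain l u where "l \<in> L" "u \<in> VF" "v = l + u" using v by (rule set_plus_elim)
    moreover have "\<beta> l (N w) \<in> \<int>" using w \<open>l \<in> L\<close> double_dual by (simp add: C_def)
    ultimately show ?thesis by (simp add: \<beta>_simps \<beta>_fixed_N)
  qed
  \<comment> \<open>Expand \<open>\<beta> (F v) (F w) = \<beta> v w\<close> with
    \<open>F = 1 + N\<close>. The remaining term pairs \<open>L'\<close> with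
    \<open>L' \<subseteq> L\<close> and is integral.\<close>
  have anti: "\<beta> v (N w) + \<beta> w (N v) \<in> \<int>" if v: "v \<in> C" and w: "w \<in> C" for v w
  proof -
    have "F v = v + N v" "F w = w + N w" by (simp_all add: N_def)
    then have "\<beta> v (N w) + \<beta> w (N v) = - \<beta> (N v) (N w)"
      using invariant[of v w] \<beta>_sym[of w "N v"] by (simp add: \<beta>_simps)
    moreover have "\<beta> (N v) (N w) \<in> \<int>"
      using v w L'_subset double_dual by (auto simp: C_def)
    ultimately show ?thesis by simp
  qed
  have den': "\<beta> v (N w) \<in> \<int>" if v: "v \<in> C" and w: "w \<in> C" "w \<in> B_den" for v w
    using anti[OF v w(1)] den[OF w(2) v] by (metis Ints_diff add_diff_cancel_right')
  have LB: "L \<subseteq> B_den" by (rule subset_plus_left[OF add_subgroup_VF])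
  define \<phi> where "\<phi> t u = \<beta> (\<rho> t) (N (\<rho> u))" for t u
  \<comment> \<open>The choice \<open>\<rho>\<close> is not additive, but its error lies in
    \<open>C \<inter> B_den\<close>, where the form is integral in either argument by
    \<open>den\<close> and \<open>den'\<close>.\<close>
  have \<delta>: "\<rho> (t + u) - (\<rho> t + \<rho> u) \<in> C \<inter> B_den" if t: "t \<in> ?T" and u: "u \<in> ?T" for t u
  proof -
    have tu: "t + u \<in> ?T" by (rule add_subgroup_add[OF T t u])
    have "(t - \<rho> t) + (u - \<rho> u) - ((t + u) - \<rho> (t + u)) \<in> L"
      by (intro add_subgroup_diff[OF add_subgroup_L] add_subgroup_add[OF add_subgroup_L] \<rho>(2) t u tu)
    moreover have "\<rho> (t + u) - (\<rho> t + \<rho> u) \<in> C"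
      by (intro add_subgroup_diff[OF C] add_subgroup_add[OF C] \<rho>(1) t u tu)
    ultimately show ?thesis using LB by (auto simp: algebra_simps)
  qed
  have p: "pairing_mod_Z ?T ?T \<phi>"
    unfolding pairing_mod_Z_def additive_mod_Z_def
  proof (intro conjI ballI T)
    fix x t u assume x: "x \<in> ?T" and tu: "t \<in> ?T" "u \<in> ?T"
    have "\<phi> (t + u) x - (\<phi> t x + \<phi> u x) = \<beta> (\<rho> (t + u) - (\<rho> t + \<rho> u)) (N (\<rho> x))"
      by (simp add: \<phi>_def \<beta>_simps)
    then show "\<phi> (t + u) x - (\<phi> t x + \<phi> u x) \<in> \<int>" using den[OF _ \<rho>(1)[OF x]] \<delta>[OF tu] by simp
    have "\<phi> x (t + u) - (\<phi> x t + \<phi> x u) = \<beta> (\<rho> x) (N (\<rho> (t + u) - (\<rho> t + \<rho> u)))"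
      by (simp add: \<phi>_def \<beta>_simps lin_simps)
    then show "\<phi> x (t + u) - (\<phi> x t + \<phi> x u) \<in> \<int>" using den'[OF \<rho>(1)[OF x]] \<delta>[OF tu] by simp
  qed
  moreover have "antisymmetric_mod_Z ?T \<phi>"
    using anti \<rho>(1) by (simp add: antisymmetric_mod_Z_def \<phi>_def)
  moreover have "annihilator ?T ?T \<phi> = B_den"
  proof
    have diff: "t \<in> B_den \<longleftrightarrow> \<rho> t \<in> B_den" if "t \<in> ?T" for t
      using add_subgroup_cancel_diff[OF add_subgroup_B_den, of t "\<rho> t"] \<rho>(2)[OF that] LB by blast
    show "B_den \<subseteq> annihilator ?T ?T \<phi>"
      using diff den \<rho>(1) B_den_subset[OF add_subgroup_L'] by (auto simp: annihilator_def \<phi>_def)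
    show "annihilator ?T ?T \<phi> \<subseteq> B_den"
    proof
      fix t assume "t \<in> annihilator ?T ?T \<phi>"
      then have t: "t \<in> ?T" "\<And>u. u \<in> ?T \<Longrightarrow> \<phi> t u \<in> \<int>" by (auto simp: annihilator_def)
      have "\<rho> t \<in> B_den"
      \<comment> \<open>Every \<open>y \<in> L' \<inter> W\<close> is \<open>N w\<close> with
        \<open>w \<in> C\<close>, so integrality against all classes covers all such
        \<open>y\<close>.\<close>
      proof (rule integral_on_moved_part)
        fix y assume "y \<in> L' \<inter> W"
        then obtain w where w: "y = N w" "w \<in> C" by (auto simp: W_eq C_def)
        have wT: "w \<in> ?T" using w CT by blast
        have "w - \<rho> w \<in> C" "w - \<rho> w \<in> B_den"
          using w \<rho>[OF wT] LB add_subgroup_diff[OF C] by blast+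
        then have "\<beta> (\<rho> t) (N (w - \<rho> w)) \<in> \<int>" by (rule den'[OF \<rho>(1)[OF t(1)]])
        moreover have "\<beta> (\<rho> t) (N (\<rho> w)) \<in> \<int>" using t(2)[OF wT] by (simp add: \<phi>_def)
        moreover have "\<beta> (\<rho> t) y = \<beta> (\<rho> t) (N (w - \<rho> w)) + \<beta> (\<rho> t) (N (\<rho> w))"
          by (simp add: w \<beta>_simps lin_simps)
        ultimately show "\<beta> (\<rho> t) y \<in> \<int>" by simp
      qed
      then show "t \<in> B_den" using diff[OF t(1)] by blast
    qed
  qed
  ultimately show thesis using that by blast
qed

end

theorem theorem1p1p1:
  fixes scale :: "rat \<Rightarrow> 'v::ab_group_add \<Rightarrow> 'v"
    and d r :: nat
    and b :: "nat \<Rightarrow> 'v"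
    and L L' :: "'v set"
    and F :: "'v \<Rightarrow> 'v"
    and p :: "int poly"
  assumes "vector_space scale"
    and "lattice_basis scale d b L"
    and "Vector_Spaces.linear scale scale F"
    and "F ` L \<subseteq> L"
    and "{v \<in> L. F v - v = 0} = {v \<in> L. F (F v - v) - (F v - v) = 0}"
    and "full_rank_lattice scale d L'"
    and "L' \<subseteq> L"
    and "F ` L' \<subseteq> L'"
    and "char_poly (lattice_mat scale d b F) = [:-1, 1:] ^ r * p \<or>
         char_poly (lattice_mat scale d b F) = - ([:-1, 1:] ^ r * p)"
    and "poly p 1 > 0"
  shows
    "rat_of_nat (card (quotient_fixed F L L')) =
       rat_of_nat (card (carrier (add_group (L \<inter> fixed_space F) Mod (L' \<inter> fixed_space F)))) *
       (rat_of_int (poly p 1) /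
         (rat_of_nat (card (carrier (B_group F L L'))) *
          rat_of_nat (card (carrier (separation_group F L')))))
     \<and> (\<forall>e::nat. e \<ge> 1 \<longrightarrow>
          card (quotient_fixed F L (scale (of_nat e) ` L')) =
            card (quotient_fixed F L L') * card (torsion (B_group F L L') e) * e ^ r)
     \<and> comm_group (separation_group F L') \<and> finite (carrier (separation_group F L'))
     \<and> comm_group (B_group F L L') \<and> finite (carrier (B_group F L L'))
     \<and> int (card (carrier (separation_group F L')) * card (carrier (B_group F L L'))) dvd poly p 1
     \<and> (\<forall>\<beta>. nondegenerate_symmetric_form scale \<beta> \<and>
            (\<forall>v w. \<beta> (F v) (F w) = \<beta> v w) \<and>
            L' = dual_lattice \<beta> L \<longrightarrow>
          separation_group F L \<cong> separation_group F L' \<and>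
          (\<exists>\<phi>. perfect_pairing (B_group F L L') \<phi> \<and>
               antisymmetric_pairing (B_group F L L') \<phi>) \<and>
          square_or_twice_square (card (carrier (B_group F L L'))) \<and>
          (\<forall>e::nat. e \<ge> 1 \<longrightarrow>
             square_or_twice_square (card (torsion (B_group F L L') e))))"
proof -
  interpret vector_space scale by fact
  have lat: "rat_lattice scale d b L" by unfold_locales (fact assms(2))
  interpret E: lattice_endomorphism scale d b L F
    by (rule lattice_endomorphism.intro[OF lat lattice_endomorphism_axioms.intro]) (fact assms(3,4,5))+
  obtain b' where b': "lattice_basis scale d b' L'" using assms(6) by (auto simp: full_rank_lattice_def)
  interpret L': rat_lattice scale d b' L' by unfold_locales (rule b')
  \<comment> \<open>A common denominator of the basis of \<open>L\<close> with respect to the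
    lattice \<open>L'\<close> puts a multiple of \<open>L\<close> inside \<open>L'\<close>.\<close>
  have sub: "E.sublattice L'"
  proof -
    obtain k :: nat where k: "k > 0" "\<forall>v\<in>b ` {..<d}. scale (of_nat k) v \<in> L'"
      using L'.L_clear_denominators[of "b ` {..<d}"] by auto
    have "add_subgroup {v. scale (of_nat k) v \<in> L'}"
      using L'.add_subgroup_L by (auto intro!: add_subgroupI simp: scale_right_diff_distrib add_subgroup_closed)
    then have "L \<subseteq> {v. scale (of_nat k) v \<in> L'}"
      unfolding E.L_zspan by (rule E.zspan_least) (use k in auto)
    then have "index L L' > 0"
      using E.index_L_pos[OF L'.add_subgroup_L assms(7) k(1)] by blast
    then show ?thesis using L'.add_subgroup_L assms(7,8) by (simp add: E.sublattice_def)
  qed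
  have sL': "add_subgroup L'" by (rule L'.add_subgroup_L)
  have stable: "F ` L' \<subseteq> L'" by fact
  define Bn where "Bn = E.B_num L'"
  define Bd where "Bd = E.B_den"
  define q where "q = index (L \<inter> fixed_space F) (L' \<inter> fixed_space F)"
  have Bgroup: "B_group F L L' = add_group Bn Mod Bd"
    by (simp add: B_group_def Bn_def Bd_def E.N_def)
  have Sgroup: "separation_group F L' = add_group L' Mod E.split_part L'"
    by (simp add: separation_group_def E.split_part_def)
  have Bn: "add_subgroup Bn" "add_subgroup Bd" "Bd \<subseteq> Bn"
    unfolding Bn_def Bd_def using E.add_subgroup_B_num[OF sL'] E.add_subgroup_B_den E.B_den_subset[OF sL'] by auto
  have S: "add_subgroup (E.split_part L')" "E.split_part L' \<subseteq> L'"
    by (rule E.add_subgroup_split_part[OF sL'] E.split_part_subset[OF sL'])+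
  have cB: "card (carrier (B_group F L L')) = index Bn Bd" by (simp add: Bgroup index_def)
  have cS: "card (carrier (separation_group F L')) = index L' (E.split_part L')" by (simp add: Sgroup index_def)
  have prod: "poly p 1 = int (index Bn Bd * E.defect L' * index L' (E.split_part L'))"
    using E.index_moved[OF assms(9,10) sub] E.index_moved_product[OF sub] by (simp add: Bn_def Bd_def)
  \<comment> \<open>No factor of a positive number is \<open>0\<close>, and by the convention for
    \<open>index\<close> this is the finiteness of both groups.\<close>
  then have pos: "index Bn Bd > 0" "E.defect L' > 0" "index L' (E.split_part L') > 0"
    using assms(10) by (auto intro: gr0I)
  have cq: "card (quotient_fixed F L L') = q * E.defect L'"
    using E.card_quotient_fixed[OF E.add_subgroup_L sL' stable] E.index_fixed_points[OF sub] by (simp add: q_def)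
  have "rat_of_nat (card (quotient_fixed F L L')) =
       rat_of_nat (card (carrier (add_group (L \<inter> fixed_space F) Mod (L' \<inter> fixed_space F)))) *
       (rat_of_int (poly p 1) /
         (rat_of_nat (card (carrier (B_group F L L'))) *
          rat_of_nat (card (carrier (separation_group F L')))))"
    unfolding cB cS cq prod index_def[symmetric] q_def[symmetric] using pos by simp
  moreover have "card (quotient_fixed F L (scale (of_nat e) ` L')) =
      card (quotient_fixed F L L') * card (torsion (B_group F L L') e) * e ^ r" if "e \<ge> 1" for e :: nat
  proof -
    let ?e = "scale (of_nat e :: rat)"
    have e: "e > 0" using that by simp
    have sub': "E.sublattice (?e ` L')" by (rule E.sublattice_scale[OF sub e])
    then have seL: "add_subgroup (?e ` L')" "F ` ?e ` L' \<subseteq> ?e ` L'" by (auto simp: E.sublattice_def)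
    \<comment> \<open>The value \<open>p(1)\<close> depends only on \<open>F\<close>, not on the
      sublattice, so it serves both \<open>L'\<close> and its multiple.\<close>
    have eqp: "int (index (?e ` L' \<inter> E.W) (E.N ` (?e ` L' \<inter> E.W))) = poly p 1"
      "int (index (L' \<inter> E.W) (E.N ` (L' \<inter> E.W))) = poly p 1"
      by (rule E.index_moved[OF assms(9,10)], fact)+
    have VF: "?e ` L' \<inter> fixed_space F = ?e ` (L' \<inter> fixed_space F)"
      using e E.scale_mem_VF_iff[of "of_nat e"] by auto
    have LF: "add_subgroup (L \<inter> fixed_space F)" "add_subgroup (L' \<inter> fixed_space F)"
      using E.add_subgroup_L sL' E.add_subgroup_VF by (auto intro: add_subgroup_Int)
    have eLF: "?e ` (L' \<inter> fixed_space F) \<subseteq> L' \<inter> fixed_space F"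
      using E.add_subgroup_scale_mem[OF LF(2)] by blast
    have "card (quotient_fixed F L (?e ` L')) =
        index (L \<inter> fixed_space F) (?e ` (L' \<inter> fixed_space F)) * E.defect (?e ` L')"
      using E.card_quotient_fixed[OF E.add_subgroup_L seL] E.index_fixed_points[OF sub'] VF by simp
    also have "index (L \<inter> fixed_space F) (?e ` (L' \<inter> fixed_space F)) =
        q * index (L' \<inter> fixed_space F) (?e ` (L' \<inter> fixed_space F))"
      unfolding q_def
      by (rule index_mult[OF LF add_subgroup_image[OF _ LF(2)] eLF])
        (use assms(7) in \<open>auto simp: scale_right_diff_distrib\<close>)
    also have "index (L' \<inter> fixed_space F) (?e ` (L' \<inter> fixed_space F)) = e ^ r"
      by (rule E.index_fixed[OF assms(9,10) sub e])
    also have "E.defect (?e ` L') = E.defect L' * card (torsion (B_group F L L') e)"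
      unfolding Bgroup torsion_Mod[OF Bn] unfolding Bn_def Bd_def
      by (rule E.defect_scale[OF sub e]) (use eqp assms(10) in \<open>auto intro: gr0I\<close>)
    finally show ?thesis by (simp add: cq)
  qed
  moreover have "comm_group (separation_group F L')" "comm_group (B_group F L L')"
    unfolding Sgroup Bgroup by (rule comm_group_Mod[OF sL' S] comm_group_Mod[OF Bn])+
  moreover have "finite (carrier (separation_group F L'))" "finite (carrier (B_group F L L'))"
    using pos cB cS card.infinite by (metis less_irrefl)+
  moreover have "int (card (carrier (separation_group F L')) * card (carrier (B_group F L L'))) dvd poly p 1"
    unfolding cB cS prod by (intro dvdI[of _ _ "int (E.defect L')"]) simp
  moreover have "separation_group F L \<cong> separation_group F L' \<and>
          (\<exists>\<phi>. perfect_pairing (B_group F L L') \<phi> \<and> antisymmetric_pairing (B_group F L L') \<phi>) \<and>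
          square_or_twice_square (card (carrier (B_group F L L'))) \<and>
          (\<forall>e::nat. e \<ge> 1 \<longrightarrow> square_or_twice_square (card (torsion (B_group F L L') e)))"
    if \<beta>: "nondegenerate_symmetric_form scale \<beta> \<and> (\<forall>v w. \<beta> (F v) (F w) = \<beta> v w) \<and> L' = dual_lattice \<beta> L" for \<beta>
  proof -
    interpret D: self_dual_endomorphism scale d b L F \<beta> L'
      by unfold_locales (use \<beta> sub in auto)
    obtain \<phi> where \<phi>: "pairing_mod_Z Bn Bn \<phi>" "antisymmetric_mod_Z Bn \<phi>" "annihilator Bn Bn \<phi> = Bd"
      using D.B_form unfolding Bn_def Bd_def by blast
    show ?thesis
      using D.separation_groups_iso perfect_pairing_Mod[OF \<phi> pos(1)] antisymmetric_index[OF \<phi>(1,2)]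
        antisymmetric_torsion_index[OF \<phi> pos(1)] pos(1)
      by (simp add: cB \<phi>(3)) (simp add: Bgroup torsion_Mod[OF Bn])
  qed
  ultimately show ?thesis by blast
qed

end
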